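(* Let $\alpha\in J(\mathcal A)$. Then the functions $\psi_1(\alpha),\dots,\psi_{d-1}(\alpha),\chi(\alpha)$ belong to $\mathcal H(\alpha)(\mathcal U)$ and are linearly independent.
   Context: Setting: $m\ge 1$ and $0<k_1<\dots<k_m<d$ are integers with $\gcd(k_1,\dots,k_m,d)=1$; $\Lambda=\{0,k_1,\dots,k_m,d\}$, and all $(m+2)$-tuples are indexed by $\Lambda$. $\mathbb N=\{0,1,2,\dots\}$. $\mathcal A$ is the $2\times(m+2)$ integer matrix whose columns are $(1,j)^T$, $j\in\Lambda$. Variables $x=(x_j)_{j\in\Lambda}\in\mathbb C^{m+2}$; $D_j=\partial/\partial x_j$, and $D_u=\prod_jD_j^{u_j}$ for $u\in\mathbb N^{\Lambda}$. The $\mathcal A$-hypergeometric system with exponent $\alpha=(\alpha_1,\alpha_2)$ consists of the equations $\prod_{v_j>0}D_j^{v_j}\varphi=\prod_{v_j<0}D_j^{-v_j}\varphi$ for all $v\in\mathbb Z^{\Lambda}$ with $\mathcal A v=0$, together with $\sum_{j}x_jD_j\varphi=\alpha_1\varphi$ and $\sum_{j}j\,x_jD_j\varphi=\alpha_2\varphi$. $\mathcal H(\alpha)(\mathcal U)$ is the space of its holomorphic solutions on $\mathcal U$. Let $\mathcal B$ (resp. $\mathcal C$) be $\mathcal A$ with the column $(1,d)^T$ (resp. $(1,0)^T$) deleted. $I(\mathcal A)=\mathcal A\cdot\mathbb N^{m+2}$, $F_0(\mathcal A)=\mathcal C\cdot\mathbb N^{m+1}-\mathbb N(1,0)$, $F_d(\mathcal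 A)=\mathcal B\cdot\mathbb N^{m+1}-\mathbb N(1,d)$, $J(\mathcal A)=\mathbb Z^2\setminus(I(\mathcal A)\cup F_0(\mathcal A)\cup F_d(\mathcal A))$. Let $f(x;t)=\sum_{j\in\Lambda}x_jt^j$, and let $\Sigma\subset\mathbb C^{m+2}$ be the set where $x_0=0$, or $x_d=0$, or the discriminant of $f(x;t)$ (in $t$) vanishes. $\mathcal U\subset\mathbb C^{m+2}\setminus\Sigma$ is a nonempty simply-connected open set, $\rho_1,\dots,\rho_d$ the distinct roots of $f(x;t)$, holomorphic on $\mathcal U$, with fixed holomorphic branches of $\log\rho_j$. $\Phi^{\mathcal A}(\beta)=\sum_{u\in\mathbb N^{\Lambda},\,\mathcal A u=\beta}\prod_j x_j^{u_j}/u_j!$ (zero if $\beta\notin I(\mathcal A)$). For $\alpha\in\mathbb Z^2$ with $\alpha_1\ge0$, $$\psi_j(\alpha)=\sum_{0\le i\le d\alpha_1,\ i\ne\alpha_2}\Phi^{\mathcal A}((\alpha_1,i))\,\frac{\rho_j^{\,i-\alpha_2}}{i-\alpha_2}+\Phi^{\mathcal A}(\alpha)\log\rho_j ,$$ and for $\alpha_1<0$, $\psi_j(\alpha)=D_u(\psi_j(\alpha+\mathcal A u))$ for any $u\in\mathbb N^{\Lambda}$ such that the first coordinate of $\mathcal A u$ is $\ge-\alpha_1$ (independent of the choice of $u$). For $\alpha_1\ge0$: $\chi(\alpha)=\sum_{j=1}^d\psi_j(\alpha)\log\rho_j$; in particular $\chi((0,s))=\sum_{j=1}^d\frac{\rho_j^{-s}}{-s}\log\rho_j$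 for $s\ne0$. For $\alpha_1<0$: $\chi(\alpha)=D_0^{-\alpha_1}\chi((0,\alpha_2))$ if $\alpha_2\ne0$, and $\chi(\alpha)=D_{k_1}D_0^{-\alpha_1-1}\chi((0,k_1))$ if $\alpha_2=0$. *)

theory Defs
  imports
    "Subresultants.Resultant_Prelim"
    "HOL-Complex_Analysis.Complex_Analysis"
begin

no_notation Matrix.vec_index (infixl "$" 100)

text \<open>
  Tuples indexed by \<open>\<Lambda> = {0, k\<^sub>1, \<dots>, k\<^sub>m, d}\<close> are indexed by a finite type \<open>'n\<close> together with a
  labelling \<open>a :: 'n \<Rightarrow> nat\<close>, a bijection onto \<open>\<Lambda>\<close>: the coordinate \<open>x\<^sub>j\<close> is \<open>x $ the_inv a j\<close>.
\<close>

definition \<Lambda>_set :: "nat \<Rightarrow> (nat \<Rightarrow> nat) \<Rightarrow> nat \<Rightarrow> nat set" where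
  "\<Lambda>_set m k d = {0} \<union> k ` {1..m} \<union> {d}"

definition mv_holomorphic_on :: "(complex^'n \<Rightarrow> complex) \<Rightarrow> (complex^'n) set \<Rightarrow> bool" where
  "mv_holomorphic_on \<phi> U \<longleftrightarrow>
     (\<forall>x\<in>U. \<exists>\<phi>'. (\<phi> has_derivative \<phi>') (at x within U) \<and> (\<forall>c v. \<phi>' (c *s v) = c * \<phi>' v))"

definition partial :: "'n::finite \<Rightarrow> (complex^'n \<Rightarrow> complex) \<Rightarrow> complex^'n \<Rightarrow> complex" where
  "partial i \<phi> x = deriv (\<lambda>z. \<phi> (x + axis i z)) 0"

text \<open>
  The product \<open>\<Prod>\<^sub>j D\<^sub>j\<^sup>u\<^sup>j\<close> is a composition, taken in increasing order of the labels.  The order is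
  immaterial at points of an open set on which the argument is holomorphic.
\<close>

definition D_op :: "('n::finite \<Rightarrow> nat) \<Rightarrow> ('n \<Rightarrow> nat) \<Rightarrow> (complex^'n \<Rightarrow> complex) \<Rightarrow> complex^'n \<Rightarrow> complex" where
  "D_op a u = foldr (\<lambda>j. partial (the_inv a j) ^^ u (the_inv a j)) (sorted_list_of_set (range a))"

text \<open>The product of the matrix with columns \<open>(1, j)\<close>, \<open>j \<in> \<Lambda>\<close>, with an integer vector.\<close>

definition A_mult :: "('n::finite \<Rightarrow> nat) \<Rightarrow> ('n \<Rightarrow> int) \<Rightarrow> int \<times> int" where
  "A_mult a v = ((\<Sum>i\<in>UNIV. v i), (\<Sum>i\<in>UNIV. int (a i) * v i))"

abbreviation A_mult_nat :: "('n::finite \<Rightarrow> nat) \<Rightarrow> ('n \<Rightarrow> nat) \<Rightarrow> int \<times> int" where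
  "A_mult_nat a u \<equiv> A_mult a (\<lambda>i. int (u i))"

definition hypergeometric_solutions ::
  "('n::finite \<Rightarrow> nat) \<Rightarrow> complex \<times> complex \<Rightarrow> (complex^'n) set \<Rightarrow> (complex^'n \<Rightarrow> complex) set" where
  "hypergeometric_solutions a \<alpha> U =
     {\<phi>. mv_holomorphic_on \<phi> U \<and>
         (\<forall>v. A_mult a v = (0, 0) \<longrightarrow>
            (\<forall>x\<in>U. D_op a (\<lambda>i. nat (v i)) \<phi> x = D_op a (\<lambda>i. nat (- v i)) \<phi> x)) \<and>
         (\<forall>x\<in>U. (\<Sum>i\<in>UNIV. x $ i * partial i \<phi> x) = fst \<alpha> * \<phi> x) \<and>
         (\<forall>x\<in>U. (\<Sum>i\<in>UNIV. of_nat (a i) * x $ i * partial i \<phi> x) = snd \<alpha> * \<phi> x)}"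

definition I_set :: "('n::finite \<Rightarrow> nat) \<Rightarrow> (int \<times> int) set" where
  "I_set a = range (A_mult_nat a)"

text \<open>
  Deleting the column \<open>(1, e)\<close> amounts to requiring the corresponding coordinate to vanish, so
  \<open>F_set a 0\<close> is \<open>F\<^sub>0\<close> and \<open>F_set a d\<close> is \<open>F\<^sub>d\<close>.
\<close>

definition F_set :: "('n::finite \<Rightarrow> nat) \<Rightarrow> nat \<Rightarrow> (int \<times> int) set" where
  "F_set a e = {A_mult_nat a u - (int s, int s * int e) | u s. u (the_inv a e) = 0}"

definition J_set :: "('n::finite \<Rightarrow> nat) \<Rightarrow> nat \<Rightarrow> (int \<times> int) set" where
  "J_set a d = UNIV - (I_set a \<union> F_set a 0 \<union> F_set a d)"

definition generic_poly :: "('n::finite \<Rightarrow> nat) \<Rightarrow> complex^'n \<Rightarrow> complex poly" where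
  "generic_poly a x = (\<Sum>i\<in>UNIV. monom (x $ i) (a i))"

text \<open>
  This is the discriminant with respect to the actual degree.  For \<open>generic_poly a x\<close> it agrees
  with the discriminant in degree \<open>d\<close> whenever \<open>x\<^sub>d \<noteq> 0\<close>, and \<open>x\<^sub>d = 0\<close> is excluded separately below.
\<close>

definition discriminant :: "complex poly \<Rightarrow> complex" where
  "discriminant p =
     (-1) ^ (degree p * (degree p - 1) div 2) * resultant p (pderiv p) / lead_coeff p"

definition \<Sigma>_set :: "('n::finite \<Rightarrow> nat) \<Rightarrow> nat \<Rightarrow> (complex^'n) set" where
  "\<Sigma>_set a d =
     {x. x $ the_inv a 0 = 0 \<or> x $ the_inv a d = 0 \<or> discriminant (generic_poly a x) = 0}"

definition root_branches ::
  "('n::finite \<Rightarrow> nat) \<Rightarrow> nat \<Rightarrow> (complex^'n) set \<Rightarrow> (nat \<Rightarrow> complex^'n \<Rightarrow> complex) \<Rightarrow> bool" where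
  "root_branches a d U \<rho> \<longleftrightarrow>
     (\<forall>j\<in>{1..d}. mv_holomorphic_on (\<rho> j) U) \<and>
     (\<forall>x\<in>U. bij_betw (\<lambda>j. \<rho> j x) {1..d} {t. poly (generic_poly a x) t = 0})"

definition log_branches ::
  "nat \<Rightarrow> (complex^'n) set \<Rightarrow> (nat \<Rightarrow> complex^'n \<Rightarrow> complex) \<Rightarrow> (nat \<Rightarrow> complex^'n \<Rightarrow> complex) \<Rightarrow> bool" where
  "log_branches d U \<rho> log\<rho> \<longleftrightarrow>
     (\<forall>j\<in>{1..d}. mv_holomorphic_on (log\<rho> j) U \<and> (\<forall>x\<in>U. exp (log\<rho> j x) = \<rho> j x))"

text \<open>The index set of the sum is finite, since \<open>A_mult_nat a u = \<beta>\<close> fixes the sum of the \<open>u\<^sub>j\<close>.\<close>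

definition \<Phi> :: "('n::finite \<Rightarrow> nat) \<Rightarrow> int \<times> int \<Rightarrow> complex^'n \<Rightarrow> complex" where
  "\<Phi> a \<beta> x = (\<Sum>u | A_mult_nat a u = \<beta>. \<Prod>i\<in>UNIV. (x $ i) ^ u i / fact (u i))"

lemma finite_\<Phi>_index: "finite {u. A_mult_nat a u = \<beta>}" for a :: "'n::finite \<Rightarrow> nat"
proof (rule finite_subset)
  show "{u. A_mult_nat a u = \<beta>} \<subseteq> UNIV \<rightarrow>\<^sub>E {..nat (fst \<beta>)}"
  proof
    fix u assume "u \<in> {u. A_mult_nat a u = \<beta>}"
    hence s: "fst \<beta> = (\<Sum>i\<in>UNIV. int (u i))" by (auto simp: A_mult_def)
    have "int (u i) \<le> fst \<beta>" for i unfolding s by (rule member_le_sum) auto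
    hence "u i \<le> nat (fst \<beta>)" for i by (metis int_nat_eq nat_int nat_mono)
    thus "u \<in> UNIV \<rightarrow>\<^sub>E {..nat (fst \<beta>)}" by auto
  qed
qed (intro finite_PiE; simp)

definition \<psi>_nonneg ::
  "('n::finite \<Rightarrow> nat) \<Rightarrow> nat \<Rightarrow> (nat \<Rightarrow> complex^'n \<Rightarrow> complex) \<Rightarrow> (nat \<Rightarrow> complex^'n \<Rightarrow> complex) \<Rightarrow>
   nat \<Rightarrow> int \<times> int \<Rightarrow> complex^'n \<Rightarrow> complex" where
  "\<psi>_nonneg a d \<rho> log\<rho> j \<alpha> x =
     (\<Sum>i \<in> {0..int d * fst \<alpha>} - {snd \<alpha>}.
        \<Phi> a (fst \<alpha>, i) x * (\<rho> j x powi (i - snd \<alpha>) / of_int (i - snd \<alpha>)))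
     + \<Phi> a \<alpha> x * log\<rho> j x"

text \<open>
  For \<open>\<alpha>\<^sub>1 < 0\<close> the function \<open>\<psi>\<^sub>j(\<alpha>)\<close> is \<open>D\<^sub>u (\<psi>\<^sub>j(\<alpha> + A u))\<close> for any \<open>u\<close> making the first coordinate of
  \<open>\<alpha> + A u\<close> nonnegative; the result does not depend on \<open>u\<close> on the open set where \<open>\<rho>\<^sub>j\<close> and \<open>log \<rho>\<^sub>j\<close> are
  holomorphic.  \<open>\<psi>_shift\<close> is an arbitrary such \<open>u\<close>.
\<close>

definition \<psi>_shift :: "('n::finite \<Rightarrow> nat) \<Rightarrow> int \<times> int \<Rightarrow> 'n \<Rightarrow> nat" where
  "\<psi>_shift a \<alpha> = (SOME u. fst (A_mult_nat a u) \<ge> - fst \<alpha>)"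

lemma \<psi>_shift: "fst (A_mult_nat a (\<psi>_shift a \<alpha>)) \<ge> - fst \<alpha>" for a :: "'n::finite \<Rightarrow> nat"
proof -
  define n where "n = nat (- fst \<alpha>)"
  have "- fst \<alpha> \<le> int n" by (simp add: n_def)
  also have "\<dots> \<le> int (CARD('n) * n)"
    unfolding of_nat_le_iff using mult_le_mono1[of 1 "CARD('n)" n] by (simp add: Suc_le_eq)
  also have "\<dots> = fst (A_mult_nat a (\<lambda>_. n))" by (simp add: A_mult_def)
  finally have "fst (A_mult_nat a (\<lambda>_. n)) \<ge> - fst \<alpha>" .
  thus ?thesis unfolding \<psi>_shift_def by (rule someI[where P = "\<lambda>u. fst (A_mult_nat a u) \<ge> - fst \<alpha>"])
qed

definition \<psi> ::
  "('n::finite \<Rightarrow> nat) \<Rightarrow> nat \<Rightarrow> (nat \<Rightarrow> complex^'n \<Rightarrow> complex) \<Rightarrow> (nat \<Rightarrow> complex^'n \<Rightarrow> complex) \<Rightarrow>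
   nat \<Rightarrow> int \<times> int \<Rightarrow> complex^'n \<Rightarrow> complex" where
  "\<psi> a d \<rho> log\<rho> j \<alpha> =
     (if fst \<alpha> \<ge> 0 then \<psi>_nonneg a d \<rho> log\<rho> j \<alpha>
      else D_op a (\<psi>_shift a \<alpha>) (\<psi>_nonneg a d \<rho> log\<rho> j (\<alpha> + A_mult_nat a (\<psi>_shift a \<alpha>))))"

definition \<chi>_nonneg ::
  "('n::finite \<Rightarrow> nat) \<Rightarrow> nat \<Rightarrow> (nat \<Rightarrow> complex^'n \<Rightarrow> complex) \<Rightarrow> (nat \<Rightarrow> complex^'n \<Rightarrow> complex) \<Rightarrow>
   int \<times> int \<Rightarrow> complex^'n \<Rightarrow> complex" where
  "\<chi>_nonneg a d \<rho> log\<rho> \<alpha> x = (\<Sum>j=1..d. \<psi> a d \<rho> log\<rho> j \<alpha> x * log\<rho> j x)"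

text \<open>The argument \<open>k\<^sub>1\<close> is the smallest positive label.\<close>

definition \<chi>_fun ::
  "('n::finite \<Rightarrow> nat) \<Rightarrow> nat \<Rightarrow> nat \<Rightarrow> (nat \<Rightarrow> complex^'n \<Rightarrow> complex) \<Rightarrow> (nat \<Rightarrow> complex^'n \<Rightarrow> complex) \<Rightarrow>
   int \<times> int \<Rightarrow> complex^'n \<Rightarrow> complex" where
  "\<chi>_fun a d k\<^sub>1 \<rho> log\<rho> \<alpha> =
     (if fst \<alpha> \<ge> 0 then \<chi>_nonneg a d \<rho> log\<rho> \<alpha>
      else if snd \<alpha> \<noteq> 0 then
        (partial (the_inv a 0) ^^ nat (- fst \<alpha>)) (\<chi>_nonneg a d \<rho> log\<rho> (0, snd \<alpha>))
      else
        partial (the_inv a k\<^sub>1) ((partial (the_inv a 0) ^^ nat (- fst \<alpha> - 1)) (\<chi>_nonneg a d \<rho> log\<rho> (0, int k\<^sub>1))))"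

text \<open>
  Linear independence over \<open>\<complex>\<close> of a finite family, the members being regarded as functions on \<open>U\<close>
  only (their values elsewhere are irrelevant).
\<close>

definition lin_indep_on :: "'x set \<Rightarrow> 'i set \<Rightarrow> ('i \<Rightarrow> 'x \<Rightarrow> complex) \<Rightarrow> bool" where
  "lin_indep_on U S F \<longleftrightarrow>
     (\<forall>c. (\<forall>x\<in>U. (\<Sum>i\<in>S. c i * F i x) = 0) \<longrightarrow> (\<forall>i\<in>S. c i = 0))"

end

theory Submission
  imports Defs
begin

text \<open>
  Put \<open>y\<^sub>j = log \<rho>\<^sub>j\<close>. Up to a constant, \<open>\<psi>\<^sub>j(n, s)\<close> with \<open>n \<ge> 0\<close> is the antiderivative of
  \<open>f(t)^n / n! * t^(-s-1)\<close>, taken term by term and evaluated at the root \<open>\<rho>\<^sub>j\<close>. Inserting the weight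
  \<open>b\<^sub>j + c log t\<close> into the integrand and summing over all roots gives the family \<open>sol b c (n, s)\<close> below; for
  \<open>n < 0\<close> it is continued by differentiating \<open>sol b c (0, s)\<close> with respect to \<open>x\<^sub>0\<close>. All the functions of the
  theorem, and all their linear combinations, belong to this family.

  \<^bold>\<open>Solutions.\<close> Since \<open>f(\<rho>\<^sub>j) = 0\<close>, moving the root contributes nothing when an integral with \<open>n \<ge> 1\<close> is
  differentiated, and \<open>D\<^sub>l sol b c \<alpha> = sol b c (\<alpha> - (1, l))\<close>. At \<open>n = 0\<close> the implicit derivative satisfies
  \<open>D\<^sub>l \<rho>\<^sub>j = \<rho>\<^sub>j^l D\<^sub>0 \<rho>\<^sub>j\<close>, which gives the same rule; as partial derivatives commute, it persists for
  \<open>n < 0\<close> (lemma \<open>partial_sol\<close>). Hence \<open>D\<^sub>u sol b c \<alpha>\<close> depends on \<open>u\<close> only through \<open>A u\<close>, which is the first group of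
  equations. The first Euler equation holds without exception (\<open>sol_euler1\<close>), the second one up to the two terms
  \<open>c \<Psi>(\<alpha>)\<close> and \<open>\<Phi>(\<alpha>) \<Sum>b\<^sub>j\<close>, where \<open>\<Psi> = \<Sum>\<psi>\<^sub>j\<close> (\<open>sol_euler2\<close>).

  \<^bold>\<open>Vanishing on J.\<close> \<open>\<Phi>\<close> is supported on \<open>I(A)\<close>. For \<open>n \<ge> 1\<close>, \<open>\<Psi>(-n, s)\<close> is up to a constant factor the sum of the
  residues of \<open>t^(-s-1) / f^n\<close> at the roots of \<open>f\<close>. For \<open>-d < s < 0\<close> there are no other poles and the sum is zero, by
  Lagrange interpolation. Solving the first Euler equation for its \<open>x\<^sub>0\<close>-term or its \<open>x\<^sub>d\<close>-term spreads the vanishing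
  to everything outside \<open>F\<^sub>0(A) \<union> F\<^sub>d(A)\<close> (\<open>\<Psi>_pos\<close>, \<open>\<Psi>_neg\<close>, \<open>\<Psi>_vanish\<close>). So both error terms disappear on \<open>J(A)\<close>. By
  integration by parts \<open>\<chi>(\<alpha>)\<close> differs from the sum of the antiderivatives of \<open>f^n / n! * t^(-s-1) log t\<close> by multiples
  of values of \<open>\<Psi>\<close> that vanish as well, so \<open>\<chi>(\<alpha>)\<close> is \<open>sol b c \<alpha>\<close> with \<open>b = 0\<close> and \<open>c = 1\<close> (\<open>\<chi>_fun_eq_sol\<close>).

  \<^bold>\<open>Independence.\<close> Let \<open>sol b c \<alpha> = 0\<close> on \<open>U\<close>. Differentiating, \<open>sol b c\<close> vanishes at all
  \<open>\<alpha> - A u\<close>, and since \<open>gcd = 1\<close> these include all \<open>(-n, -e)\<close> with \<open>M \<le> e \<le> d n - M\<close> for a constant \<open>M\<close>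
  (\<open>I_set_conductor\<close>). There \<open>\<Psi>\<close> and \<open>\<Phi>\<close> vanish, so the second Euler equation expresses \<open>e sol b c (-n, -e)\<close> by values at \<open>(-n-1, -e')\<close> with
  \<open>e < e'\<close>, and its mirror image under \<open>t \<mapsto> 1/t\<close> treats the upper end; so the range grows to
  \<open>1 \<le> e \<le> d n - 1\<close>. For \<open>n = 1\<close> this says \<open>\<Sum>\<^sub>j \<rho>\<^sub>j^(e-1) (b\<^sub>j + c y\<^sub>j) / f'(\<rho>\<^sub>j) = 0\<close> for
  \<open>e = 1, \<dots>, d - 1\<close>, which forces all \<open>b\<^sub>j + c y\<^sub>j\<close> to be equal. If \<open>c\<close> were not zero, \<open>\<rho>\<^sub>1 / \<rho>\<^sub>2\<close> would be constant
  on \<open>U\<close>; comparing derivatives, \<open>\<rho>\<^sub>1^l = \<rho>\<^sub>2^l\<close> for all labels \<open>l\<close>, and \<open>\<rho>\<^sub>1 = \<rho>\<^sub>2\<close> because \<open>gcd = 1\<close>. So \<open>c = 0\<close> and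
  all \<open>b\<^sub>j\<close> are equal; in a relation among \<open>\<psi>\<^sub>1, \<dots>, \<psi>\<^sub>d\<^sub>-\<^sub>1, \<chi>\<close> the coefficient \<open>b\<^sub>d\<close> is zero.
\<close>

no_notation fps_nth (infixl "$" 75)

section \<open>Complex derivatives in several variables\<close>

definition has_cderiv :: "(complex^'n::finite \<Rightarrow> complex) \<Rightarrow> (complex^'n \<Rightarrow> complex) \<Rightarrow> complex^'n \<Rightarrow> bool" where
  "has_cderiv \<phi> \<phi>' x \<longleftrightarrow> (\<phi> has_derivative \<phi>') (at x) \<and> (\<forall>c v. \<phi>' (c *s v) = c * \<phi>' v)"

text \<open>
  On an open set the derivative within the set is an ordinary derivative, which is the form that the product
  and chain rules need.
\<close>

lemma mv_holomorphic_on_iff: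
  assumes "open U"
  shows "mv_holomorphic_on \<phi> U \<longleftrightarrow> (\<forall>x\<in>U. \<exists>\<phi>'. has_cderiv \<phi> \<phi>' x)"
  unfolding mv_holomorphic_on_def has_cderiv_def
  by (rule ball_cong[OF refl]) (simp only: at_within_open[OF _ assms])

lemma norm_axis_complex: "norm (axis i z :: complex^'n::finite) = norm z"
proof -
  have "(\<Sum>j\<in>UNIV. (norm ((axis i z :: complex^'n) $ j))\<^sup>2) = (\<Sum>j\<in>UNIV. if j = i then (norm z)\<^sup>2 else 0)"
    by (rule sum.cong) (auto simp: axis_def)
  thus ?thesis by (simp add: norm_vec_def L2_set_def)
qed

lemma has_cderiv_along_axis:
  fixes \<phi> :: "complex^'n::finite \<Rightarrow> complex"
  assumes "has_cderiv \<phi> \<phi>' x"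
  shows "((\<lambda>z. \<phi> (x + axis i z)) has_field_derivative \<phi>' (axis i 1)) (at 0)"
proof -
  have lin: "bounded_linear (axis i :: complex \<Rightarrow> complex^'n)"
  proof (rule bounded_linear_intro[where K = 1])
    show "axis i (u + v) = axis i u + (axis i v :: complex^'n)" for u v
      by (simp add: vec_eq_iff axis_def)
    show "axis i (r *\<^sub>R u) = r *\<^sub>R (axis i u :: complex^'n)" for r u
      by (simp add: vec_eq_iff axis_def)
  qed (simp add: norm_axis_complex)
  have "((\<lambda>z. x + axis i z) has_derivative (axis i :: complex \<Rightarrow> complex^'n)) (at 0)"
    using has_derivative_add[OF has_derivative_const[of x] bounded_linear_imp_has_derivative[OF lin]]
    by simp
  moreover have "(\<phi> has_derivative \<phi>') (at (x + axis i 0))"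
  proof -
    have "x + axis i 0 = x" by (simp add: vec_eq_iff axis_def)
    thus ?thesis using assms by (simp only: has_cderiv_def)
  qed
  ultimately have "((\<lambda>z. \<phi> (x + axis i z)) has_derivative (\<lambda>z. \<phi>' (axis i z))) (at 0)"
    by (rule has_derivative_compose)
  moreover have "(\<lambda>z. \<phi>' (axis i z)) = (*) (\<phi>' (axis i 1))"
  proof
    fix z
    have "axis i z = z *s (axis i 1 :: complex^'n)" by (simp add: vec_eq_iff axis_def)
    hence "\<phi>' (axis i z) = \<phi>' (z *s axis i 1)" by (rule arg_cong)
    also have "\<dots> = z * \<phi>' (axis i 1)" using assms unfolding has_cderiv_def by blast
    finally show "\<phi>' (axis i z) = \<phi>' (axis i 1) * z" by (simp only: mult.commute)
  qed
  ultimately show ?thesis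
    unfolding has_field_derivative_def by (simp only:)
qed

lemma partial_eq:
  "has_cderiv \<phi> \<phi>' x \<Longrightarrow> partial i \<phi> x = \<phi>' (axis i 1)"
  unfolding partial_def by (rule DERIV_imp_deriv[OF has_cderiv_along_axis])

lemma has_cderiv_const: "has_cderiv (\<lambda>x. c) (\<lambda>v. 0) x"
  by (simp add: has_cderiv_def)

lemma has_cderiv_coord: "has_cderiv (\<lambda>x. x $ i) (\<lambda>v. v $ i) x"
  using bounded_linear_imp_has_derivative[OF bounded_linear_vec_nth] by (auto simp: has_cderiv_def)

lemma has_cderiv_add:
  assumes "has_cderiv \<phi> \<phi>' x" "has_cderiv \<theta> \<theta>' x"
  shows "has_cderiv (\<lambda>x. \<phi> x + \<theta> x) (\<lambda>v. \<phi>' v + \<theta>' v) x"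
proof -
  have "((\<lambda>x. \<phi> x + \<theta> x) has_derivative (\<lambda>v. \<phi>' v + \<theta>' v)) (at x)"
    using assms unfolding has_cderiv_def by (intro has_derivative_add) blast+
  moreover have "\<phi>' (c *s v) = c * \<phi>' v" "\<theta>' (c *s v) = c * \<theta>' v" for c v
    using assms unfolding has_cderiv_def by blast+
  ultimately show ?thesis unfolding has_cderiv_def by (simp only: distrib_left simp_thms)
qed

lemma has_cderiv_mult:
  assumes "has_cderiv \<phi> \<phi>' x" "has_cderiv \<theta> \<theta>' x"
  shows "has_cderiv (\<lambda>x. \<phi> x * \<theta> x) (\<lambda>v. \<phi> x * \<theta>' v + \<phi>' v * \<theta> x) x"
proof -
  have "((\<lambda>x. \<phi> x * \<theta> x) has_derivative (\<lambda>v. \<phi> x * \<theta>' v + \<phi>' v * \<theta> x)) (at x)"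
    using assms unfolding has_cderiv_def by (intro has_derivative_mult) blast+
  moreover have "\<phi>' (c *s v) = c * \<phi>' v" "\<theta>' (c *s v) = c * \<theta>' v" for c v
    using assms unfolding has_cderiv_def by blast+
  ultimately show ?thesis
    unfolding has_cderiv_def by (simp only: distrib_left mult.left_commute mult.assoc simp_thms)
qed

lemma has_cderiv_chain:
  assumes "has_cderiv \<phi> \<phi>' x" "(g has_field_derivative g') (at (\<phi> x))"
  shows "has_cderiv (\<lambda>x. g (\<phi> x)) (\<lambda>v. g' * \<phi>' v) x"
proof -
  have "((\<lambda>x. g (\<phi> x)) has_derivative (\<lambda>v. g' * \<phi>' v)) (at x)"
    using assms unfolding has_cderiv_def has_field_derivative_def
    by (intro has_derivative_compose[of \<phi> \<phi>' x UNIV g "(*) g'"]) blast+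
  moreover have "\<phi>' (c *s v) = c * \<phi>' v" for c v
    using assms unfolding has_cderiv_def by blast
  ultimately show ?thesis
    unfolding has_cderiv_def by (simp only: mult.left_commute simp_thms)
qed

lemma has_cderiv_cong:
  assumes "open U" "x \<in> U" "\<And>x. x \<in> U \<Longrightarrow> \<phi> x = \<theta> x" "has_cderiv \<phi> \<phi>' x"
  shows "has_cderiv \<theta> \<phi>' x"
  using assms has_derivative_transform_within_open[of \<phi> \<phi>' x UNIV U \<theta>]
  unfolding has_cderiv_def by blast

text \<open>
  A partial derivative at a point of an open set depends only on the values in the set. Identities between
  functions are known on \<open>U\<close> only, so this is what allows them to be differentiated.
\<close>

lemma partial_cong:
  fixes \<phi> :: "complex^'n::finite \<Rightarrow> complex"
  assumes "open U" "x \<in> U" "\<And>x. x \<in> U \<Longrightarrow> \<phi> x = \<theta> x"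
  shows "partial i \<phi> x = partial i \<theta> x"
proof -
  have "((\<lambda>z. norm (axis i z :: complex^'n)) \<longlongrightarrow> 0) (nhds 0)"
    unfolding norm_axis_complex by (rule tendsto_norm_zero[OF filterlim_ident])
  hence "((\<lambda>z. axis i z :: complex^'n) \<longlongrightarrow> 0) (nhds 0)"
    by (rule tendsto_norm_zero_cancel)
  from tendsto_add[OF tendsto_const[of x] this]
  have "((\<lambda>z. x + axis i z) \<longlongrightarrow> x) (nhds 0)" by (simp only: add_0_right)
  hence "eventually (\<lambda>z. x + axis i z \<in> U) (nhds 0)"
    using assms(1,2) by (rule topological_tendstoD)
  hence "eventually (\<lambda>z. \<phi> (x + axis i z) = \<theta> (x + axis i z)) (nhds 0)"
    by (rule eventually_mono) (rule assms(3))
  thus ?thesis unfolding partial_def by (rule deriv_cong_ev) (rule refl)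
qed

lemma mv_holomorphic_onE:
  assumes "open U" "mv_holomorphic_on \<phi> U" "x \<in> U"
  obtains \<phi>' where "has_cderiv \<phi> \<phi>' x"
  using assms mv_holomorphic_on_iff by blast

lemma partial_const: "partial i (\<lambda>x. c) x = 0"
  by (rule partial_eq[OF has_cderiv_const])

lemma partial_coord: "partial i (\<lambda>x. x $ l) x = (if l = i then 1 else 0)"
  by (subst partial_eq[OF has_cderiv_coord]) (simp add: axis_def)

lemma partial_add:
  assumes "open U" "mv_holomorphic_on \<phi> U" "mv_holomorphic_on \<theta> U" "x \<in> U"
  shows "partial i (\<lambda>x. \<phi> x + \<theta> x) x = partial i \<phi> x + partial i \<theta> x"
proof -
  obtain \<phi>' where p: "has_cderiv \<phi> \<phi>' x" by (rule mv_holomorphic_onE[OF assms(1,2,4)])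
  obtain \<theta>' where t: "has_cderiv \<theta> \<theta>' x" by (rule mv_holomorphic_onE[OF assms(1,3,4)])
  show ?thesis
    by (simp only: partial_eq[OF p] partial_eq[OF t] partial_eq[OF has_cderiv_add[OF p t]])
qed

lemma partial_mult:
  assumes "open U" "mv_holomorphic_on \<phi> U" "mv_holomorphic_on \<theta> U" "x \<in> U"
  shows "partial i (\<lambda>x. \<phi> x * \<theta> x) x = \<phi> x * partial i \<theta> x + partial i \<phi> x * \<theta> x"
proof -
  obtain \<phi>' where p: "has_cderiv \<phi> \<phi>' x" by (rule mv_holomorphic_onE[OF assms(1,2,4)])
  obtain \<theta>' where t: "has_cderiv \<theta> \<theta>' x" by (rule mv_holomorphic_onE[OF assms(1,3,4)])
  show ?thesis
    by (simp only: partial_eq[OF p] partial_eq[OF t] partial_eq[OF has_cderiv_mult[OF p t]])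
qed

lemma partial_chain:
  assumes "open U" "mv_holomorphic_on \<phi> U" "x \<in> U" "(g has_field_derivative g') (at (\<phi> x))"
  shows "partial i (\<lambda>x. g (\<phi> x)) x = g' * partial i \<phi> x"
proof -
  obtain \<phi>' where p: "has_cderiv \<phi> \<phi>' x" by (rule mv_holomorphic_onE[OF assms(1-3)])
  show ?thesis
    by (simp only: partial_eq[OF p] partial_eq[OF has_cderiv_chain[OF p assms(4)]])
qed

lemma mv_holomorphic_on_const: "open U \<Longrightarrow> mv_holomorphic_on (\<lambda>x. c) U"
  by (simp only: mv_holomorphic_on_iff) (blast intro: has_cderiv_const)

lemma mv_holomorphic_on_coord: "open U \<Longrightarrow> mv_holomorphic_on (\<lambda>x. x $ l) U"
  by (simp only: mv_holomorphic_on_iff) (blast intro: has_cderiv_coord)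

lemma mv_holomorphic_on_add:
  "open U \<Longrightarrow> mv_holomorphic_on \<phi> U \<Longrightarrow> mv_holomorphic_on \<theta> U \<Longrightarrow> mv_holomorphic_on (\<lambda>x. \<phi> x + \<theta> x) U"
  by (simp only: mv_holomorphic_on_iff) (blast intro: has_cderiv_add)

lemma mv_holomorphic_on_mult:
  "open U \<Longrightarrow> mv_holomorphic_on \<phi> U \<Longrightarrow> mv_holomorphic_on \<theta> U \<Longrightarrow> mv_holomorphic_on (\<lambda>x. \<phi> x * \<theta> x) U"
  by (simp only: mv_holomorphic_on_iff) (blast intro: has_cderiv_mult)

lemma mv_holomorphic_on_chain:
  assumes "open U" "mv_holomorphic_on \<phi> U"
    and "\<And>x. x \<in> U \<Longrightarrow> (g has_field_derivative g' (\<phi> x)) (at (\<phi> x))"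
  shows "mv_holomorphic_on (\<lambda>x. g (\<phi> x)) U"
  unfolding mv_holomorphic_on_iff[OF assms(1)]
proof
  fix x assume x: "x \<in> U"
  obtain \<phi>' where p: "has_cderiv \<phi> \<phi>' x" by (rule mv_holomorphic_onE[OF assms(1,2) x])
  show "\<exists>\<phi>'. has_cderiv (\<lambda>x. g (\<phi> x)) \<phi>' x"
    using has_cderiv_chain[OF p assms(3)[OF x]] by blast
qed

lemma mv_holomorphic_on_cong:
  assumes "open U" "\<And>x. x \<in> U \<Longrightarrow> \<phi> x = \<theta> x" "mv_holomorphic_on \<phi> U"
  shows "mv_holomorphic_on \<theta> U"
  using assms(3) has_cderiv_cong[of U _ \<phi> \<theta>, OF assms(1) _ assms(2)]
  unfolding mv_holomorphic_on_iff[OF assms(1)] by blast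

lemma mv_holomorphic_on_sum:
  assumes "open U" "finite S" "\<And>s. s \<in> S \<Longrightarrow> mv_holomorphic_on (F s) U"
  shows "mv_holomorphic_on (\<lambda>x. \<Sum>s\<in>S. F s x) U"
  using assms(2,3)
proof (induction S rule: finite_induct)
  case empty
  show ?case using mv_holomorphic_on_const[OF assms(1), of 0] by simp
next
  case (insert s S)
  have "mv_holomorphic_on (\<lambda>x. F s x + (\<Sum>s\<in>S. F s x)) U"
    using insert by (intro mv_holomorphic_on_add assms(1)) auto
  thus ?case using insert by simp
qed

lemma partial_sum:
  assumes "open U" "finite S" "\<And>s. s \<in> S \<Longrightarrow> mv_holomorphic_on (F s) U" "x \<in> U"
  shows "partial i (\<lambda>x. \<Sum>s\<in>S. F s x) x = (\<Sum>s\<in>S. partial i (F s) x)"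
  using assms(2,3)
proof (induction S rule: finite_induct)
  case empty
  show ?case using partial_const[of i 0] by simp
next
  case (insert s S)
  have "partial i (\<lambda>x. F s x + (\<Sum>s\<in>S. F s x)) x = partial i (F s) x + partial i (\<lambda>x. \<Sum>s\<in>S. F s x) x"
    using insert assms by (intro partial_add[OF assms(1)] mv_holomorphic_on_sum) auto
  thus ?case using insert by simp
qed

lemma partial_cmult:
  assumes "open U" "mv_holomorphic_on \<phi> U" "x \<in> U"
  shows "partial i (\<lambda>x. c * \<phi> x) x = c * partial i \<phi> x"
  using partial_mult[OF assms(1) mv_holomorphic_on_const[OF assms(1)] assms(2,3)]
  by (simp add: partial_const)

lemma partial_funpow_cong:
  assumes "open U" "\<And>x. x \<in> U \<Longrightarrow> \<phi> x = \<theta> x" "x \<in> U"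
  shows "(partial i ^^ n) \<phi> x = (partial i ^^ n) \<theta> x"
  using assms(3)
proof (induction n arbitrary: x)
  case 0
  thus ?case using assms(2) by simp
next
  case (Suc n)
  thus ?case using partial_cong[OF assms(1) Suc.prems Suc.IH] by simp
qed

section \<open>The monomials \<open>x\<^sup>u / u!\<close> and the polynomials \<open>\<Phi>\<close>\<close>

lemma A_mult_upd:
  "A_mult_nat a (u(i := c)) = A_mult_nat a u + (int c - int (u i), (int c - int (u i)) * int (a i))"
  for a :: "'n::finite \<Rightarrow> nat"
proof -
  have 1: "(\<Sum>l\<in>UNIV. int ((u(i := c)) l)) = (\<Sum>l\<in>UNIV. int (u l) + (if l = i then int c - int (u i) else 0))"
    by (intro sum.cong refl) auto
  have 2: "(\<Sum>l\<in>UNIV. int (a l) * int ((u(i := c)) l))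
      = (\<Sum>l\<in>UNIV. int (a l) * int (u l) + (if l = i then (int c - int (u i)) * int (a i) else 0))"
    by (intro sum.cong refl) (auto simp: algebra_simps)
  show ?thesis unfolding A_mult_def 1 2 by (simp add: sum.distrib)
qed

lemma A_mult_Suc:
  "A_mult_nat a (u(l := Suc (u l))) = A_mult_nat a u + (1, int (a l))" for a :: "'n::finite \<Rightarrow> nat"
  unfolding A_mult_upd by simp

text \<open>
  The divided power \<open>x\<^sup>u / u!\<close>: differentiation by \<open>x\<^sub>l\<close> lowers \<open>u\<^sub>l\<close> by one and produces no factor.
\<close>

definition divpow :: "('n::finite \<Rightarrow> nat) \<Rightarrow> complex^'n \<Rightarrow> complex" where
  "divpow u x = (\<Prod>i\<in>UNIV. (x $ i) ^ u i / fact (u i))"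

lemma \<Phi>_divpow: "\<Phi> a \<beta> x = (\<Sum>u | A_mult_nat a u = \<beta>. divpow u x)"
  unfolding \<Phi>_def divpow_def ..

lemma divpow_split:
  "divpow u x = (x $ l) ^ u l / fact (u l) * (\<Prod>i\<in>UNIV - {l}. (x $ i) ^ u i / fact (u i))"
  unfolding divpow_def by (rule prod.remove) auto

lemma divpow_Suc: "of_nat (Suc (u l)) * divpow (u(l := Suc (u l))) x = x $ l * divpow u x"
proof -
  have "(\<Prod>i\<in>UNIV - {l}. (x $ i) ^ (u(l := Suc (u l))) i / fact ((u(l := Suc (u l))) i))
      = (\<Prod>i\<in>UNIV - {l}. (x $ i) ^ u i / fact (u i))"
    by (rule prod.cong) auto
  moreover have "of_nat (Suc (u l)) * ((x $ l) ^ Suc (u l) / fact (Suc (u l))) = x $ l * ((x $ l) ^ u l / fact (u l))"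
    by (simp add: field_simps del: of_nat_Suc)
  ultimately show ?thesis
    unfolding divpow_split[of _ x l] by (simp only: fun_upd_same mult.assoc[symmetric])
qed

lemma partial_divpow_0:
  assumes "u l = 0"
  shows "partial l (divpow u) x = 0"
proof -
  have "(\<Prod>i\<in>UNIV - {l}. ((x + axis l z) $ i) ^ u i / fact (u i))
      = (\<Prod>i\<in>UNIV - {l}. (x $ i) ^ u i / fact (u i))" for z
    by (rule prod.cong) (auto simp: axis_def)
  thus ?thesis unfolding partial_def divpow_split[of _ _ l] assms by simp
qed

lemma partial_divpow_Suc: "partial l (divpow (u(l := Suc (u l)))) x = divpow u x"
proof -
  let ?C = "\<Prod>i\<in>UNIV - {l}. (x $ i) ^ u i / fact (u i)"
  have "(\<Prod>i\<in>UNIV - {l}. ((x + axis l z) $ i) ^ (u(l := Suc (u l))) i / fact ((u(l := Suc (u l))) i)) = ?C" for z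
    by (rule prod.cong) (auto simp: axis_def)
  hence "(\<lambda>z. divpow (u(l := Suc (u l))) (x + axis l z)) = (\<lambda>z. (x $ l + z) ^ Suc (u l) / fact (Suc (u l)) * ?C)"
    unfolding divpow_split[of _ _ l] by (simp add: axis_def)
  moreover have "((\<lambda>z. (x $ l + z) ^ Suc (u l) / fact (Suc (u l)) * ?C) has_field_derivative
      (x $ l) ^ u l / fact (u l) * ?C) (at 0)"
    by (auto intro!: derivative_eq_intros simp: field_simps simp del: power_Suc of_nat_Suc)
  ultimately show ?thesis
    unfolding partial_def divpow_split[of u x l] by (simp add: DERIV_imp_deriv)
qed

lemma bij_add_unit:
  fixes a :: "'n::finite \<Rightarrow> nat"
  shows "bij_betw (\<lambda>u. u(l := Suc (u l))) {u. A_mult_nat a u = \<beta> - (1, int (a l))}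
           {u. A_mult_nat a u = \<beta> \<and> u l \<noteq> 0}"
proof (rule bij_betwI[where g = "\<lambda>u. u(l := u l - 1)"])
  show "(\<lambda>u. u(l := Suc (u l))) \<in> {u. A_mult_nat a u = \<beta> - (1, int (a l))} \<rightarrow> {u. A_mult_nat a u = \<beta> \<and> u l \<noteq> 0}"
    by (intro Pi_I) (simp only: mem_Collect_eq A_mult_Suc fun_upd_same diff_add_cancel, simp)
  show "(\<lambda>u. u(l := u l - 1)) \<in> {u. A_mult_nat a u = \<beta> \<and> u l \<noteq> 0} \<rightarrow> {u. A_mult_nat a u = \<beta> - (1, int (a l))}"
  proof
    fix u assume u: "u \<in> {u. A_mult_nat a u = \<beta> \<and> u l \<noteq> 0}"
    have "(u(l := u l - 1))(l := Suc ((u(l := u l - 1)) l)) = u" using u by auto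
    hence "A_mult_nat a (u(l := u l - 1)) + (1, int (a l)) = A_mult_nat a u"
      using A_mult_Suc[of a "u(l := u l - 1)" l] by (simp only:)
    thus "u(l := u l - 1) \<in> {u. A_mult_nat a u = \<beta> - (1, int (a l))}"
      using u by (simp only: mem_Collect_eq eq_diff_eq)
  qed
qed auto

text \<open>
  Multiplication by \<open>x\<^sub>l\<close> undoes the shift of the exponent at the price of a factor \<open>u\<^sub>l\<close>. Summing over \<open>l\<close>, with
  weights \<open>1\<close> or the labels, turns these factors into the coordinates of \<open>A u\<close>; this is how both Euler equations of
  \<open>\<Phi>\<close> arise.
\<close>

lemma \<Phi>_coord_mult:
  "x $ l * \<Phi> a (\<beta> - (1, int (a l))) x = (\<Sum>u | A_mult_nat a u = \<beta>. of_nat (u l) * divpow u x)"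
  for a :: "'n::finite \<Rightarrow> nat"
proof -
  have "(\<Sum>u | A_mult_nat a u = \<beta>. of_nat (u l) * divpow u x)
      = (\<Sum>u | A_mult_nat a u = \<beta> \<and> u l \<noteq> 0. of_nat (u l) * divpow u x)"
    by (rule sum.mono_neutral_right) (auto intro: finite_\<Phi>_index)
  also have "\<dots> = (\<Sum>u | A_mult_nat a u = \<beta> - (1, int (a l)).
      of_nat ((u(l := Suc (u l))) l) * divpow (u(l := Suc (u l))) x)"
    by (rule sum.reindex_bij_betw[OF bij_add_unit, symmetric])
  also have "\<dots> = x $ l * \<Phi> a (\<beta> - (1, int (a l))) x"
    unfolding \<Phi>_divpow sum_distrib_left by (simp only: fun_upd_same divpow_Suc)
  finally show ?thesis ..
qed

lemma \<Phi>_euler1: "(\<Sum>l\<in>UNIV. x $ l * \<Phi> a (\<beta> - (1, int (a l))) x) = of_int (fst \<beta>) * \<Phi> a \<beta> x"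
  for a :: "'n::finite \<Rightarrow> nat"
proof -
  have "(\<Sum>l\<in>UNIV. x $ l * \<Phi> a (\<beta> - (1, int (a l))) x)
      = (\<Sum>u | A_mult_nat a u = \<beta>. (\<Sum>l\<in>UNIV. of_nat (u l)) * divpow u x)"
    unfolding \<Phi>_coord_mult by (subst sum.swap) (simp only: sum_distrib_right)
  also have "\<dots> = (\<Sum>u | A_mult_nat a u = \<beta>. of_int (fst \<beta>) * divpow u x)"
    by (rule sum.cong) (auto simp: A_mult_def)
  finally show ?thesis unfolding \<Phi>_divpow[of a \<beta>] sum_distrib_left .
qed

lemma \<Phi>_nonzero_index:
  fixes a :: "'n::finite \<Rightarrow> nat"
  assumes "\<Phi> a \<beta> x \<noteq> 0"
  shows "\<beta> \<in> I_set a"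
proof -
  have "{u. A_mult_nat a u = \<beta>} \<noteq> {}" using assms unfolding \<Phi>_def by force
  thus ?thesis unfolding I_set_def by auto
qed

lemma I_set_range:
  fixes a :: "'n::finite \<Rightarrow> nat"
  assumes "\<And>i. a i \<le> d" "(n, s) \<in> I_set a"
  shows "0 \<le> n" "0 \<le> s" "s \<le> int d * n"
proof -
  obtain u where u: "n = (\<Sum>i\<in>UNIV. int (u i))" "s = (\<Sum>i\<in>UNIV. int (a i) * int (u i))"
    using assms(2) unfolding I_set_def A_mult_def by auto
  show "0 \<le> n" "0 \<le> s" unfolding u by (auto intro: sum_nonneg)
  show "s \<le> int d * n" unfolding u sum_distrib_left
    by (rule sum_mono) (use assms(1) in \<open>auto intro!: mult_right_mono\<close>)
qed

lemma partial_\<Phi>: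
  fixes a :: "'n::finite \<Rightarrow> nat"
  assumes "open U" "x \<in> U" "\<And>u :: 'n \<Rightarrow> nat. mv_holomorphic_on (divpow u) U"
  shows "partial l (\<Phi> a \<beta>) x = \<Phi> a (\<beta> - (1, int (a l))) x"
proof -
  have "\<Phi> a \<beta> = (\<lambda>x. \<Sum>u | A_mult_nat a u = \<beta>. divpow u x)"
    by (rule ext) (rule \<Phi>_divpow)
  hence "partial l (\<Phi> a \<beta>) x = (\<Sum>u | A_mult_nat a u = \<beta>. partial l (divpow u) x)"
    using partial_sum[OF assms(1) finite_\<Phi>_index assms(3,2)] by simp
  also have "\<dots> = (\<Sum>u | A_mult_nat a u = \<beta> \<and> u l \<noteq> 0. partial l (divpow u) x)"
    by (rule sum.mono_neutral_right) (auto intro: finite_\<Phi>_index partial_divpow_0)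
  also have "\<dots> = (\<Sum>u | A_mult_nat a u = \<beta> - (1, int (a l)). partial l (divpow (u(l := Suc (u l)))) x)"
    by (rule sum.reindex_bij_betw[OF bij_add_unit, symmetric])
  finally show ?thesis unfolding \<Phi>_divpow partial_divpow_Suc .
qed

lemma \<Phi>_0: "\<Phi> a (0, s) x = (if s = 0 then 1 else 0)" for a :: "'n::finite \<Rightarrow> nat"
proof -
  have "A_mult_nat a u = (0, s) \<longleftrightarrow> u = (\<lambda>_. 0) \<and> s = 0" for u
  proof -
    have "(\<Sum>i\<in>UNIV. int (u i)) = 0 \<longleftrightarrow> u = (\<lambda>_. 0)"
      by (simp add: sum_nonneg_eq_0_iff fun_eq_iff)
    thus ?thesis unfolding A_mult_def by auto
  qed
  hence "{u. A_mult_nat a u = (0, s)} = (if s = 0 then {\<lambda>_. 0} else {})" by auto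
  thus ?thesis by (simp add: \<Phi>_def)
qed

section \<open>Sums over the roots of a polynomial\<close>

lemma poly_generic_poly: "poly (generic_poly a x) t = (\<Sum>i\<in>UNIV. x $ i * t ^ a i)"
  by (simp add: generic_poly_def poly_sum poly_monom)

lemma poly_pderiv_generic_poly:
  "t * poly (pderiv (generic_poly a x)) t = (\<Sum>i\<in>UNIV. of_nat (a i) * x $ i * t ^ a i)"
proof -
  have "t * poly (pderiv (monom (x $ i) (a i))) t = of_nat (a i) * x $ i * t ^ a i" for i
    by (cases "a i") (simp_all add: pderiv_monom poly_monom)
  thus ?thesis
    by (simp add: generic_poly_def pderiv_sum poly_sum sum_distrib_left)
qed

lemma generic_poly_coeff_top:
  fixes a :: "'n::finite \<Rightarrow> nat"
  assumes "inj a" "\<And>i. a i \<le> a h"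
  shows "poly.coeff (generic_poly a x) (a h) = x $ h" "degree (generic_poly a x) \<le> a h"
proof -
  have "poly.coeff (generic_poly a x) (a h) = (\<Sum>i\<in>UNIV. if i = h then x $ i else 0)"
    unfolding generic_poly_def coeff_sum
    by (intro sum.cong refl) (use assms(1) in \<open>auto simp: inj_eq\<close>)
  thus "poly.coeff (generic_poly a x) (a h) = x $ h" by simp
  show "degree (generic_poly a x) \<le> a h"
    unfolding generic_poly_def
    by (rule degree_sum_le) (auto intro: order.trans[OF degree_monom_le] assms(2))
qed

lemma degree_prod_linear: "finite S \<Longrightarrow> degree (\<Prod>l\<in>S. [:- r l, 1:]) = card S" for r :: "'b \<Rightarrow> complex"
  by (subst degree_prod_eq_sum_degree) auto

lemma lead_coeff_prod_linear: "finite S \<Longrightarrow> poly.coeff (\<Prod>l\<in>S. [:- r l, 1:]) (card S) = 1" for r :: "'b \<Rightarrow> complex"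
  using lead_coeff_prod[of "\<lambda>l. [:- r l, 1:]" S] by (simp add: degree_prod_linear)

lemma poly_eq_prod_roots:
  fixes p :: "complex poly"
  assumes "finite S" "inj_on r S" "degree p \<le> card S" "\<And>j. j \<in> S \<Longrightarrow> poly p (r j) = 0"
  shows "p = smult (poly.coeff p (card S)) (\<Prod>l\<in>S. [:- r l, 1:])"
proof (rule poly_eqI_degree_lead_coeff[where A = "r ` S" and n = "card S"])
  show "card S \<le> card (r ` S)" using assms(2) by (simp add: card_image)
  show "poly p z = poly (smult (poly.coeff p (card S)) (\<Prod>l\<in>S. [:- r l, 1:])) z" if "z \<in> r ` S" for z
    using that assms(1,4) by (auto simp: poly_prod intro!: prod_zero)
  show "degree (smult (poly.coeff p (card S)) (\<Prod>l\<in>S. [:- r l, 1:])) \<le> card S"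
    using degree_smult_le[of _ "\<Prod>l\<in>S. [:- r l, 1:]"] by (simp add: degree_prod_linear assms(1))
qed (simp_all add: assms(1,3) lead_coeff_prod_linear)

lemma poly_pderiv_prod_roots:
  fixes r :: "'b \<Rightarrow> complex"
  assumes "finite S" "j \<in> S"
  shows "poly (pderiv (smult C (\<Prod>l\<in>S. [:- r l, 1:]))) (r j) = C * (\<Prod>l\<in>S - {j}. r j - r l)"
proof -
  have "(\<Prod>l\<in>S. [:- r l, 1:]) = [:- r j, 1:] * (\<Prod>l\<in>S - {j}. [:- r l, 1:])"
    by (rule prod.remove[OF assms])
  hence "poly (pderiv (smult C (\<Prod>l\<in>S. [:- r l, 1:]))) (r j)
      = poly (smult C ([:- r j, 1:] * pderiv (\<Prod>l\<in>S - {j}. [:- r l, 1:])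
          + (\<Prod>l\<in>S - {j}. [:- r l, 1:]) * pderiv [:- r j, 1:])) (r j)"
    by (simp only: pderiv_smult pderiv_mult)
  thus ?thesis by (simp add: pderiv_pCons poly_prod del: mult_pCons_left mult_pCons_right)
qed

text \<open>
  The left-hand side is the coefficient of \<open>t^(card S - 1)\<close> in the Lagrange interpolation polynomial of \<open>p\<close>, which is
  \<open>p\<close> itself, of smaller degree. For the polynomial with roots \<open>r\<^sub>j\<close> this is the residue theorem.
\<close>

lemma lagrange_sum_zero:
  fixes r :: "'b \<Rightarrow> complex"
  assumes "finite S" "inj_on r S" "degree p + 2 \<le> card S"
  shows "(\<Sum>j\<in>S. poly p (r j) / (\<Prod>l\<in>S - {j}. r j - r l)) = 0"
proof -
  let ?P = "\<lambda>j. \<Prod>l\<in>S - {j}. r j - r l"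
  let ?L = "\<lambda>j. \<Prod>l\<in>S - {j}. [:- r l, 1:]"
  let ?Q = "\<Sum>j\<in>S. smult (poly p (r j) / ?P j) (?L j)"
  have cd: "card (S - {j}) = card S - 1" if "j \<in> S" for j using that assms(1) by simp
  have nz: "?P j \<noteq> 0" if "j \<in> S" for j
    using that assms(1,2) by (auto simp: inj_on_def)
  have "?Q = p"
  proof (rule poly_eqI_degree[where A = "r ` S"])
    fix z assume "z \<in> r ` S"
    then obtain i where i: "i \<in> S" "z = r i" by blast
    show "poly ?Q z = poly p z"
    proof -
      have "poly ?Q z = (\<Sum>j\<in>S. if j = i then poly p (r i) else 0)"
        unfolding poly_sum
      proof (rule sum.cong[OF refl])
        fix j assume j: "j \<in> S"
        show "poly (smult (poly p (r j) / ?P j) (?L j)) z = (if j = i then poly p (r i) else 0)"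
        proof (cases "j = i")
          case True
          thus ?thesis using nz[OF j] i by (simp add: poly_prod)
        next
          case False
          hence "(\<Prod>l\<in>S - {j}. r i - r l) = 0" using i assms(1) by (auto intro!: prod_zero)
          thus ?thesis using False i by (simp add: poly_prod)
        qed
      qed
      thus ?thesis using i assms(1) by simp
    qed
  next
    have "degree ?Q \<le> card S - 1"
    proof (rule degree_sum_le[OF assms(1)])
      fix j assume "j \<in> S"
      thus "degree (smult (poly p (r j) / ?P j) (?L j)) \<le> card S - 1"
        using degree_smult_le[of _ "?L j"] assms(1) cd by (simp add: degree_prod_linear)
    qed
    thus "degree ?Q < card (r ` S)" using assms by (simp add: card_image)
  next
    show "degree p < card (r ` S)" using assms by (simp add: card_image)
  qed
  hence "poly.coeff ?Q (card S - 1) = 0"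
    using assms(3) by (simp add: coeff_eq_0)
  moreover have "poly.coeff ?Q (card S - 1) = (\<Sum>j\<in>S. poly p (r j) / ?P j)"
    unfolding coeff_sum
  proof (rule sum.cong[OF refl])
    fix j assume "j \<in> S"
    thus "poly.coeff (smult (poly p (r j) / ?P j) (?L j)) (card S - 1) = poly p (r j) / ?P j"
      using lead_coeff_prod_linear[of "S - {j}" r] assms(1) cd by simp
  qed
  ultimately show ?thesis by simp
qed

text \<open>
  The converse of the preceding vanishing: the weights \<open>1 / \<Prod>(r\<^sub>j - r\<^sub>l)\<close> span the kernel of the Vandermonde matrix with
  one row missing. Pairing with the polynomial that vanishes at all nodes except \<open>p\<close> and \<open>q\<close> compares the two values.
\<close>

lemma moments_zero_imp_eq:
  fixes r :: "'b \<Rightarrow> complex" and h :: "'b \<Rightarrow> complex"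
  assumes "finite S" "inj_on r S" "p \<in> S" "q \<in> S"
    and mom: "\<And>e. e + 2 \<le> card S \<Longrightarrow> (\<Sum>j\<in>S. r j ^ e * (h j / (\<Prod>l\<in>S - {j}. r j - r l))) = 0"
  shows "h p = h q"
proof (cases "p = q")
  case False
  let ?P = "\<lambda>j. \<Prod>l\<in>S - {j}. r j - r l"
  let ?Q = "\<Prod>l\<in>S - {p, q}. [:- r l, 1:]"
  have pq: "card {p, q} = 2" "{p, q} \<subseteq> S" using False assms by auto
  hence c: "card (S - {p, q}) + 2 = card S"
    using card_Diff_subset[of "{p, q}" S] card_mono[OF assms(1) pq(2)] by simp
  have nz: "?P j \<noteq> 0" if "j \<in> S" for j
    using that assms(1,2) by (auto simp: inj_on_def)
  have "(\<Sum>j\<in>S. poly ?Q (r j) * (h j / ?P j))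
      = (\<Sum>e\<le>degree ?Q. poly.coeff ?Q e * (\<Sum>j\<in>S. r j ^ e * (h j / ?P j)))"
    unfolding poly_altdef sum_distrib_left sum_distrib_right
    by (subst sum.swap) (simp only: mult.assoc)
  also have "\<dots> = 0"
    by (rule sum.neutral) (use mom c in \<open>auto simp: degree_prod_linear assms(1)\<close>)
  also have "(\<Sum>j\<in>S. poly ?Q (r j) * (h j / ?P j)) = (\<Sum>j\<in>{p, q}. poly ?Q (r j) * (h j / ?P j))"
  proof (rule sum.mono_neutral_right[OF assms(1) pq(2)], rule ballI)
    fix j assume "j \<in> S - {p, q}"
    hence "poly ?Q (r j) = 0" using assms(1) by (auto simp: poly_prod intro!: prod_zero)
    thus "poly ?Q (r j) * (h j / ?P j) = 0" by simp
  qed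
  finally have e: "poly ?Q (r p) * (h p / ?P p) + poly ?Q (r q) * (h q / ?P q) = 0"
    using False by simp
  have sets: "S - {p} - {q} = S - {p, q}" "S - {q} - {p} = S - {p, q}" by auto
  have Pp: "?P p = (r p - r q) * poly ?Q (r p)"
    using prod.remove[of "S - {p}" q "\<lambda>l. r p - r l"] assms(1,4) False
    by (simp add: poly_prod sets)
  have Pq: "?P q = (r q - r p) * poly ?Q (r q)"
    using prod.remove[of "S - {q}" p "\<lambda>l. r q - r l"] assms(1,3) False
    by (simp add: poly_prod sets)
  have "poly ?Q (r p) * (h p / ?P p) = h p / (r p - r q)"
    using nz[OF assms(3)] unfolding Pp by simp
  moreover have "poly ?Q (r q) * (h q / ?P q) = - (h q / (r p - r q))"
    using nz[OF assms(4)] unfolding Pq by (simp add: minus_divide_right)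
  ultimately have "h p / (r p - r q) = h q / (r p - r q)" using e by simp
  moreover have "r p - r q \<noteq> 0" using nz[OF assms(3)] unfolding Pp by auto
  ultimately show ?thesis by simp
qed simp

section \<open>The function algebra generated by the roots\<close>

text \<open>
  The situation of the theorem with the roots given by their logarithms only. The indices \<open>lo\<close>, \<open>mid\<close> and \<open>hi\<close> carry the
  labels \<open>0\<close>, some label strictly in between, and \<open>d\<close>.
\<close>

locale log_roots =
  fixes a :: "'n::finite \<Rightarrow> nat" and d :: nat and U :: "(complex^'n) set"
    and y :: "nat \<Rightarrow> complex^'n \<Rightarrow> complex" and lo mid hi :: 'n
  assumes inj_a: "inj a" and a_le: "\<And>i. a i \<le> d"
    and a_lo: "a lo = 0" and a_hi: "a hi = d" and a_mid: "0 < a mid" "a mid < d"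
    and open_U: "open U"
    and y_holo: "\<And>j. j \<in> {1..d} \<Longrightarrow> mv_holomorphic_on (y j) U"
    and y_root: "\<And>j x. j \<in> {1..d} \<Longrightarrow> x \<in> U \<Longrightarrow> (\<Sum>i\<in>UNIV. x $ i * exp (of_nat (a i) * y j x)) = 0"
    and y_inj: "\<And>x. x \<in> U \<Longrightarrow> inj_on (\<lambda>j. exp (y j x)) {1..d}"
    and lo_nz: "\<And>x. x \<in> U \<Longrightarrow> x $ lo \<noteq> 0"
    and hi_nz: "\<And>x. x \<in> U \<Longrightarrow> x $ hi \<noteq> 0"
begin

text \<open>
  The value of \<open>t f'(t)\<close> at the root \<open>exp y\<^sub>j\<close>. It is the derivative with respect to \<open>y\<close> of the equation \<open>f(x; exp y) = 0\<close>,
  hence the denominator of every implicit derivative.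
\<close>

definition g :: "nat \<Rightarrow> complex^'n \<Rightarrow> complex" where
  "g j x = (\<Sum>i\<in>UNIV. of_nat (a i) * x $ i * exp (of_nat (a i) * y j x))"

text \<open>
  As \<open>f\<close> has degree \<open>d\<close> and \<open>d\<close> distinct roots, it is the product of its linear factors. In particular all roots are
  simple and \<open>g\<close> has no zeros.
\<close>

lemma g_eq_prod:
  assumes j: "j \<in> {1..d}" and x: "x \<in> U"
  shows "g j x = x $ hi * exp (y j x) * (\<Prod>l\<in>{1..d} - {j}. exp (y j x) - exp (y l x))"
proof -
  let ?p = "generic_poly a x" and ?r = "\<lambda>l. exp (y l x)"
  note top = generic_poly_coeff_top[of a hi x, OF inj_a, unfolded a_hi, OF a_le]
  have "?p = smult (poly.coeff ?p (card {1..d})) (\<Prod>l\<in>{1..d}. [:- ?r l, 1:])"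
  proof (rule poly_eq_prod_roots[OF _ y_inj[OF x]])
    show "poly ?p (?r l) = 0" if "l \<in> {1..d}" for l
      using y_root[OF that x] by (simp add: poly_generic_poly exp_of_nat_mult)
    show "degree ?p \<le> card {1..d}" using top(2) by simp
  qed simp
  hence "?p = smult (x $ hi) (\<Prod>l\<in>{1..d}. [:- ?r l, 1:])"
    by (simp only: card_atLeastAtMost diff_Suc_1 top(1))
  hence "poly (pderiv ?p) (?r j) = x $ hi * (\<Prod>l\<in>{1..d} - {j}. ?r j - ?r l)"
    using poly_pderiv_prod_roots[OF _ j, of "x $ hi" ?r] by (simp only: finite_atLeastAtMost)
  moreover have "g j x = ?r j * poly (pderiv ?p) (?r j)"
    unfolding poly_pderiv_generic_poly g_def by (simp add: exp_of_nat_mult)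
  ultimately show ?thesis by simp
qed

definition w :: "nat \<Rightarrow> complex^'n \<Rightarrow> complex" where
  "w j x = inverse (g j x)"

text \<open>
  An algebra of functions on \<open>U\<close> that is visibly stable under partial differentiation, so that statements about all
  iterated derivatives become accessible to induction.
\<close>

inductive root_alg :: "(complex^'n \<Rightarrow> complex) \<Rightarrow> bool" where
  root_alg_const: "root_alg (\<lambda>x. c)"
| root_alg_coord: "root_alg (\<lambda>x. x $ i)"
| root_alg_y: "j \<in> {1..d} \<Longrightarrow> root_alg (y j)"
| root_alg_exp: "j \<in> {1..d} \<Longrightarrow> root_alg (\<lambda>x. exp (c * y j x))"
| root_alg_w: "j \<in> {1..d} \<Longrightarrow> root_alg (w j)"
| root_alg_add: "root_alg \<phi> \<Longrightarrow> root_alg \<theta> \<Longrightarrow> root_alg (\<lambda>x. \<phi> x + \<theta> x)"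
| root_alg_mult: "root_alg \<phi> \<Longrightarrow> root_alg \<theta> \<Longrightarrow> root_alg (\<lambda>x. \<phi> x * \<theta> x)"
| root_alg_cong: "root_alg \<phi> \<Longrightarrow> (\<And>x. x \<in> U \<Longrightarrow> \<phi> x = \<theta> x) \<Longrightarrow> root_alg \<theta>"

lemma root_alg_sum: "finite S \<Longrightarrow> (\<And>s. s \<in> S \<Longrightarrow> root_alg (F s)) \<Longrightarrow> root_alg (\<lambda>x. \<Sum>s\<in>S. F s x)"
  by (induction S rule: finite_induct) (auto intro: root_alg_const root_alg_add)

lemma root_alg_prod: "finite S \<Longrightarrow> (\<And>s. s \<in> S \<Longrightarrow> root_alg (F s)) \<Longrightarrow> root_alg (\<lambda>x. \<Prod>s\<in>S. F s x)"
  by (induction S rule: finite_induct) (auto intro: root_alg_const root_alg_mult)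

lemma root_alg_power: "root_alg \<phi> \<Longrightarrow> root_alg (\<lambda>x. \<phi> x ^ n)"
  by (induction n) (auto intro: root_alg_const root_alg_mult)

lemma root_alg_cmult: "root_alg \<phi> \<Longrightarrow> root_alg (\<lambda>x. c * \<phi> x)"
  by (intro root_alg_mult root_alg_const)

lemma exp_y_holo: "j \<in> {1..d} \<Longrightarrow> mv_holomorphic_on (\<lambda>x. exp (c * y j x)) U"
  by (rule mv_holomorphic_on_chain[OF open_U y_holo, where g' = "\<lambda>z. c * exp (c * z)"])
     (auto intro!: derivative_eq_intros)

lemma partial_exp_y:
  assumes "j \<in> {1..d}" "x \<in> U"
  shows "partial l (\<lambda>x. exp (c * y j x)) x = c * exp (c * y j x) * partial l (y j) x"
  by (rule partial_chain[OF open_U y_holo[OF assms(1)] assms(2), where g = "\<lambda>z. exp (c * z)"])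
     (auto intro!: derivative_eq_intros)

lemma g_summand_holo:
  "j \<in> {1..d} \<Longrightarrow> mv_holomorphic_on (\<lambda>x. c * x $ i * exp (c' * y j x)) U"
  by (intro mv_holomorphic_on_mult mv_holomorphic_on_const mv_holomorphic_on_coord exp_y_holo open_U)

lemma partial_summand:
  assumes "j \<in> {1..d}" "x \<in> U"
  shows "partial l (\<lambda>x. c * x $ i * exp (c' * y j x)) x =
    c * (if i = l then 1 else 0) * exp (c' * y j x) + c * c' * x $ i * exp (c' * y j x) * partial l (y j) x"
proof -
  have "partial l (\<lambda>x. c * x $ i * exp (c' * y j x)) x =
      c * x $ i * partial l (\<lambda>x. exp (c' * y j x)) x + partial l (\<lambda>x. c * x $ i) x * exp (c' * y j x)"
    by (rule partial_mult[OF open_U _ _ assms(2)])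
       (intro mv_holomorphic_on_mult mv_holomorphic_on_const mv_holomorphic_on_coord exp_y_holo open_U assms)+
  also have "partial l (\<lambda>x. c * x $ i) x = c * (if i = l then 1 else 0)"
    by (simp add: partial_cmult[OF open_U mv_holomorphic_on_coord[OF open_U] assms(2)] partial_coord)
  finally show ?thesis by (simp add: partial_exp_y[OF assms])
qed

lemma g_holo: "j \<in> {1..d} \<Longrightarrow> mv_holomorphic_on (g j) U"
  using mv_holomorphic_on_sum[OF open_U finite g_summand_holo] unfolding g_def .

lemma g_nonzero:
  assumes j: "j \<in> {1..d}" and x: "x \<in> U"
  shows "g j x \<noteq> 0"
proof -
  have "exp (y j x) - exp (y l x) \<noteq> 0" if "l \<in> {1..d} - {j}" for l
    using inj_onD[OF y_inj[OF x], of j l] j that by auto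
  hence "(\<Prod>l\<in>{1..d} - {j}. exp (y j x) - exp (y l x)) \<noteq> 0"
    by (simp only: prod_zero_iff finite_Diff finite_atLeastAtMost) blast
  thus ?thesis unfolding g_eq_prod[OF j x] using hi_nz[OF x] by simp
qed

lemma g_w: "j \<in> {1..d} \<Longrightarrow> x \<in> U \<Longrightarrow> g j x * w j x = 1"
  using g_nonzero by (simp add: w_def)

lemma w_holo: "j \<in> {1..d} \<Longrightarrow> mv_holomorphic_on (w j) U"
  unfolding w_def
  by (rule mv_holomorphic_on_chain[OF open_U g_holo, where g' = "\<lambda>z. - (inverse z ^ Suc (Suc 0))"])
     (assumption | rule DERIV_inverse g_nonzero)+

lemma partial_w:
  assumes "j \<in> {1..d}" "x \<in> U"
  shows "partial l (w j) x = - (w j x * w j x) * partial l (g j) x"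
proof -
  have "partial l (\<lambda>x. inverse (g j x)) x = - (inverse (g j x) ^ Suc (Suc 0)) * partial l (g j) x"
    by (rule partial_chain[OF open_U g_holo[OF assms(1)] assms(2) DERIV_inverse[OF g_nonzero[OF assms]]])
  thus ?thesis unfolding w_def[abs_def] by simp
qed

text \<open>
  Implicit differentiation of \<open>f(x; exp y\<^sub>j) = 0\<close>. The derivatives for different \<open>l\<close> differ only by the factor
  \<open>exp (a\<^sub>l y\<^sub>j)\<close>, the source of all shift relations.
\<close>

lemma partial_y:
  assumes "j \<in> {1..d}" "x \<in> U"
  shows "partial l (y j) x = - exp (of_nat (a l) * y j x) * w j x"
proof -
  let ?f = "\<lambda>x. \<Sum>i\<in>UNIV. 1 * x $ i * exp (of_nat (a i) * y j x)"
  have "partial l ?f x = partial l (\<lambda>x. 0) x"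
    by (rule partial_cong[OF open_U assms(2)]) (use y_root[OF assms(1)] in simp)
  moreover have "partial l ?f x = (\<Sum>i\<in>UNIV. partial l (\<lambda>x. 1 * x $ i * exp (of_nat (a i) * y j x)) x)"
    by (rule partial_sum[OF open_U finite g_summand_holo[OF assms(1)] assms(2)])
  moreover have "\<dots> = (\<Sum>i\<in>UNIV. (if i = l then exp (of_nat (a i) * y j x) else 0)
      + of_nat (a i) * x $ i * exp (of_nat (a i) * y j x) * partial l (y j) x)"
    unfolding partial_summand[OF assms] by (rule sum.cong) auto
  ultimately have "exp (of_nat (a l) * y j x) + g j x * partial l (y j) x = 0"
    by (simp add: sum.distrib g_def sum_distrib_right partial_const)
  hence e: "g j x * partial l (y j) x = - exp (of_nat (a l) * y j x)"
    by (metis add.commute eq_neg_iff_add_eq_0)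
  have "partial l (y j) x = (g j x * w j x) * partial l (y j) x"
    by (simp only: g_w[OF assms] mult_1_left)
  also have "\<dots> = (g j x * partial l (y j) x) * w j x" by (simp only: ac_simps)
  finally show ?thesis by (simp only: e)
qed

lemma root_alg_g: "j \<in> {1..d} \<Longrightarrow> root_alg (g j)"
  unfolding g_def[abs_def]
  by (intro root_alg_sum finite root_alg_mult root_alg_const root_alg_coord root_alg_exp)

lemma root_alg_partial_y: "j \<in> {1..d} \<Longrightarrow> root_alg (partial l (y j))"
  by (rule root_alg_cong[where \<phi> = "\<lambda>x. (- 1) * exp (of_nat (a l) * y j x) * w j x"])
     (assumption | rule root_alg_mult root_alg_const root_alg_exp root_alg_w | simp add: partial_y)+

lemma partial_g:
  assumes "j \<in> {1..d}" "x \<in> U"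
  shows "partial l (g j) x = of_nat (a l) * exp (of_nat (a l) * y j x)
     + (\<Sum>i\<in>UNIV. of_nat (a i) * of_nat (a i) * x $ i * exp (of_nat (a i) * y j x)) * partial l (y j) x"
proof -
  have "partial l (g j) x = (\<Sum>i\<in>UNIV. partial l (\<lambda>x. of_nat (a i) * x $ i * exp (of_nat (a i) * y j x)) x)"
    unfolding g_def[abs_def]
    by (rule partial_sum[OF open_U finite g_summand_holo[OF assms(1)] assms(2)])
  also have "\<dots> = (\<Sum>i\<in>UNIV. (if i = l then of_nat (a i) * exp (of_nat (a i) * y j x) else 0)
      + of_nat (a i) * of_nat (a i) * x $ i * exp (of_nat (a i) * y j x) * partial l (y j) x)"
    unfolding partial_summand[OF assms] by (rule sum.cong) auto
  finally show ?thesis by (simp add: sum.distrib sum_distrib_right)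
qed

lemma root_alg_holo_partial: "root_alg \<phi> \<Longrightarrow> mv_holomorphic_on \<phi> U \<and> (\<forall>l. root_alg (partial l \<phi>))"
proof (induction rule: root_alg.induct)
  case (root_alg_const c)
  show ?case
    using mv_holomorphic_on_const[OF open_U] root_alg.root_alg_const[of 0]
    by (auto simp: partial_const[abs_def])
next
  case (root_alg_coord i)
  show ?case
    using mv_holomorphic_on_coord[OF open_U] root_alg.root_alg_const
    by (auto simp: partial_coord[abs_def])
next
  case (root_alg_y j)
  show ?case using y_holo[OF root_alg_y] root_alg_partial_y[OF root_alg_y] by blast
next
  case (root_alg_exp j c)
  have "root_alg (partial l (\<lambda>x. exp (c * y j x)))" for l
    by (rule root_alg_cong[where \<phi> = "\<lambda>x. c * exp (c * y j x) * partial l (y j) x"])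
       (rule root_alg_exp root_alg_mult root_alg.root_alg_const root_alg.root_alg_exp root_alg_partial_y
         | simp add: partial_exp_y[OF root_alg_exp])+
  thus ?case using exp_y_holo[OF root_alg_exp] by blast
next
  case (root_alg_w j)
  have "root_alg (partial l (g j))" for l
    by (rule root_alg_cong[where \<phi> = "\<lambda>x. of_nat (a l) * exp (of_nat (a l) * y j x)
     + (\<Sum>i\<in>UNIV. of_nat (a i) * of_nat (a i) * x $ i * exp (of_nat (a i) * y j x)) * partial l (y j) x"])
       (use root_alg_w in \<open>auto simp: partial_g
         intro!: root_alg_add root_alg_mult root_alg_sum root_alg.root_alg_const root_alg.root_alg_coord root_alg.root_alg_exp root_alg_partial_y\<close>)
  hence n: "root_alg (\<lambda>x. ((- 1) * (w j x * w j x)) * partial l (g j) x)" for l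
    using root_alg_w by (intro root_alg_mult root_alg.root_alg_const root_alg.root_alg_w)
  have "root_alg (partial l (w j))" for l
    by (rule root_alg_cong[OF n[of l]]) (simp add: partial_w[OF root_alg_w])
  thus ?case using w_holo[OF root_alg_w] by blast
next
  case (root_alg_add \<phi> \<theta>)
  have "root_alg (partial l (\<lambda>x. \<phi> x + \<theta> x))" for l
    by (rule root_alg_cong[where \<phi> = "\<lambda>x. partial l \<phi> x + partial l \<theta> x"])
       (use root_alg_add in \<open>auto simp: partial_add[OF open_U] intro!: root_alg.root_alg_add\<close>)
  thus ?case using mv_holomorphic_on_add[OF open_U] root_alg_add by blast
next
  case (root_alg_mult \<phi> \<theta>)
  have "root_alg (partial l (\<lambda>x. \<phi> x * \<theta> x))" for l
    by (rule root_alg_cong[where \<phi> = "\<lambda>x. \<phi> x * partial l \<theta> x + partial l \<phi> x * \<theta> x"])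
       (use root_alg_mult in \<open>auto simp: partial_mult[OF open_U] intro!: root_alg.root_alg_add root_alg.root_alg_mult\<close>)
  thus ?case using mv_holomorphic_on_mult[OF open_U] root_alg_mult by blast
next
  case (root_alg_cong \<phi> \<theta>)
  have "root_alg (partial l \<theta>)" for l
    by (rule root_alg.root_alg_cong[where \<phi> = "partial l \<phi>"])
       (use root_alg_cong partial_cong[OF open_U, of _ \<phi> \<theta>] in auto)
  moreover have "mv_holomorphic_on \<theta> U"
    by (rule mv_holomorphic_on_cong[OF open_U, of \<phi>]) (use root_alg_cong in auto)
  ultimately show ?case by blast
qed

lemma root_alg_holo: "root_alg \<phi> \<Longrightarrow> mv_holomorphic_on \<phi> U"
  and root_alg_partial: "root_alg \<phi> \<Longrightarrow> root_alg (partial l \<phi>)"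
  using root_alg_holo_partial by blast+

lemma root_alg_partial_funpow: "root_alg \<phi> \<Longrightarrow> root_alg ((partial l ^^ n) \<phi>)"
  by (induction n) (auto intro: root_alg_partial)

section \<open>Partial derivatives commute\<close>

definition partials_commute :: "(complex^'n \<Rightarrow> complex) \<Rightarrow> bool" where
  "partials_commute \<phi> \<longleftrightarrow> (\<forall>x\<in>U. \<forall>k l. partial k (partial l \<phi>) x = partial l (partial k \<phi>) x)"

text \<open>
  The symmetry of second derivatives may be checked on explicit formulas for the first derivatives.
\<close>

lemma partials_commuteI:
  assumes "\<And>k l x. x \<in> U \<Longrightarrow> partial l \<phi> x = H l x"
    and "\<And>k l x. x \<in> U \<Longrightarrow> partial k (H l) x = partial l (H k) x"
  shows "partials_commute \<phi>"
proof -
  have "partial k (partial l \<phi>) x = partial k (H l) x" if "x \<in> U" for k l x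
    by (rule partial_cong[OF open_U that assms(1)])
  thus ?thesis using assms(2) by (simp add: partials_commute_def)
qed

text \<open>
  The generator for which the symmetry has to be computed. Second derivatives of \<open>y\<^sub>j\<close> involve the labels \<open>k\<close> and \<open>l\<close>
  only through symmetric expressions.
\<close>

lemma partials_commute_y:
  assumes "j \<in> {1..d}"
  shows "partials_commute (y j)"
proof (rule partials_commuteI)
  let ?H = "\<lambda>l x. (- 1) * exp (of_nat (a l) * y j x) * w j x"
  show "partial l (y j) x = ?H l x" if "x \<in> U" for l x
    using partial_y[OF assms that] by simp
  fix k l x assume x: "x \<in> U"
  let ?S = "\<Sum>i\<in>UNIV. of_nat (a i) * of_nat (a i) * x $ i * exp (of_nat (a i) * y j x)"
  have "partial k (?H l) x = exp (of_nat (a l) * y j x) * exp (of_nat (a k) * y j x) * (w j x)^2 *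
     (of_nat (a l) + of_nat (a k) - ?S * w j x)" for k l
  proof -
    have "partial k (?H l) x = ((- 1) * exp (of_nat (a l) * y j x)) * partial k (w j) x
        + partial k (\<lambda>x. (- 1) * exp (of_nat (a l) * y j x)) x * w j x"
      by (intro partial_mult[OF open_U _ _ x] mv_holomorphic_on_mult mv_holomorphic_on_const
          exp_y_holo w_holo open_U assms)
    also have "partial k (\<lambda>x. (- 1) * exp (of_nat (a l) * y j x)) x
        = (- 1) * partial k (\<lambda>x. exp (of_nat (a l) * y j x)) x"
      by (rule partial_cmult[OF open_U exp_y_holo[OF assms] x])
    finally show ?thesis
      unfolding partial_exp_y[OF assms x] partial_w[OF assms x] partial_g[OF assms x] partial_y[OF assms x]
      by (simp add: algebra_simps power2_eq_square)
  qed
  thus "partial k (?H l) x = partial l (?H k) x" by (simp only: ac_simps)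
qed

lemma partials_commute_chain:
  assumes "root_alg \<phi>" "partials_commute \<phi>"
    and h: "\<And>x. x \<in> U \<Longrightarrow> (h has_field_derivative h' (\<phi> x)) (at (\<phi> x))"
    and h': "\<And>x. x \<in> U \<Longrightarrow> (h' has_field_derivative h'' (\<phi> x)) (at (\<phi> x))"
  shows "partials_commute (\<lambda>x. h (\<phi> x))"
proof (rule partials_commuteI)
  let ?H = "\<lambda>l x. h' (\<phi> x) * partial l \<phi> x"
  show "partial l (\<lambda>x. h (\<phi> x)) x = ?H l x" if "x \<in> U" for l x
    by (rule partial_chain[OF open_U root_alg_holo[OF assms(1)] that h[OF that]])
  fix k l x assume x: "x \<in> U"
  have "partial k (?H l) x = h' (\<phi> x) * partial k (partial l \<phi>) x + h'' (\<phi> x) * partial k \<phi> x * partial l \<phi> x" for k l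
    using partial_mult[OF open_U mv_holomorphic_on_chain[OF open_U root_alg_holo[OF assms(1)] h']
        root_alg_holo[OF root_alg_partial[OF assms(1)]] x]
      partial_chain[OF open_U root_alg_holo[OF assms(1)] x h'[OF x]] by metis
  moreover have "partial k (partial l \<phi>) x = partial l (partial k \<phi>) x"
    using assms(2) x unfolding partials_commute_def by blast
  ultimately show "partial k (?H l) x = partial l (?H k) x" by (simp only: ac_simps)
qed

lemma partials_commute_add:
  assumes "root_alg \<phi>" "partials_commute \<phi>" "root_alg \<theta>" "partials_commute \<theta>"
  shows "partials_commute (\<lambda>x. \<phi> x + \<theta> x)"
proof (rule partials_commuteI)
  let ?H = "\<lambda>l x. partial l \<phi> x + partial l \<theta> x"
  show "partial l (\<lambda>x. \<phi> x + \<theta> x) x = ?H l x" if "x \<in> U" for l x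
    by (rule partial_add[OF open_U root_alg_holo[OF assms(1)] root_alg_holo[OF assms(3)] that])
  fix k l x assume x: "x \<in> U"
  have "partial k (?H l) x = partial k (partial l \<phi>) x + partial k (partial l \<theta>) x" for k l
    by (rule partial_add[OF open_U root_alg_holo[OF root_alg_partial[OF assms(1)]] root_alg_holo[OF root_alg_partial[OF assms(3)]] x])
  thus "partial k (?H l) x = partial l (?H k) x"
    using assms(2,4) x unfolding partials_commute_def by metis
qed

lemma partials_commute_mult:
  assumes "root_alg \<phi>" "partials_commute \<phi>" "root_alg \<theta>" "partials_commute \<theta>"
  shows "partials_commute (\<lambda>x. \<phi> x * \<theta> x)"
proof (rule partials_commuteI)
  note n = assms(1,3) root_alg_partial[OF assms(1)] root_alg_partial[OF assms(3)]
  note pm = partial_mult[OF open_U root_alg_holo root_alg_holo]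
  let ?H = "\<lambda>l x. \<phi> x * partial l \<theta> x + partial l \<phi> x * \<theta> x"
  show "partial l (\<lambda>x. \<phi> x * \<theta> x) x = ?H l x" if "x \<in> U" for l x
    by (rule pm[OF n(1,2) that])
  fix k l x assume x: "x \<in> U"
  have "partial k (?H l) x = partial k (\<lambda>x. \<phi> x * partial l \<theta> x) x + partial k (\<lambda>x. partial l \<phi> x * \<theta> x) x" for k l
    by (intro partial_add[OF open_U _ _ x] root_alg_holo root_alg_mult n)
  hence "partial k (?H l) x = (\<phi> x * partial k (partial l \<theta>) x + partial k \<phi> x * partial l \<theta> x)
      + (partial l \<phi> x * partial k \<theta> x + partial k (partial l \<phi>) x * \<theta> x)" for k l
    by (simp only: pm[OF n(1,4) x] pm[OF n(3,2) x])
  moreover have "partial k (partial l \<phi>) x = partial l (partial k \<phi>) x"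
      "partial k (partial l \<theta>) x = partial l (partial k \<theta>) x"
    using assms(2,4) x unfolding partials_commute_def by blast+
  ultimately show "partial k (?H l) x = partial l (?H k) x" by (simp only: ac_simps)
qed

lemma partials_commute_const: "partials_commute (\<lambda>x. c)"
  by (rule partials_commuteI[where H = "\<lambda>l x. 0"]) (simp_all only: partial_const)

lemma partials_commute_coord: "partials_commute (\<lambda>x. x $ i)"
  by (rule partials_commuteI[where H = "\<lambda>l x. if i = l then 1 else 0"])
     (rule partial_coord, simp add: partial_const)

lemma partials_commute_exp: "j \<in> {1..d} \<Longrightarrow> partials_commute (\<lambda>x. exp (c * y j x))"
  by (rule partials_commute_chain[OF root_alg_y partials_commute_y,
        where h = "\<lambda>z. exp (c * z)" and h' = "\<lambda>z. c * exp (c * z)" and h'' = "\<lambda>z. c * (c * exp (c * z))"])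
     (auto intro!: derivative_eq_intros)

lemma partials_commute_sum:
  "finite S \<Longrightarrow> (\<And>s. s \<in> S \<Longrightarrow> root_alg (F s) \<and> partials_commute (F s)) \<Longrightarrow> partials_commute (\<lambda>x. \<Sum>s\<in>S. F s x)"
proof (induction S rule: finite_induct)
  case empty
  show ?case using partials_commute_const[of 0] by simp
next
  case (insert s S)
  have "partials_commute (\<lambda>x. F s x + (\<Sum>s\<in>S. F s x))"
    using insert by (intro partials_commute_add root_alg_sum) auto
  thus ?case using insert by simp
qed

text \<open>
  \<open>g\<close> is built from coordinates and exponentials of \<open>y\<^sub>j\<close>, so only the inverse remains to be taken.
\<close>

lemma partials_commute_w:
  assumes "j \<in> {1..d}"
  shows "partials_commute (w j)"
proof -
  have "partials_commute (g j)"
    unfolding g_def[abs_def]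
    by (intro partials_commute_sum finite conjI partials_commute_mult partials_commute_const
        partials_commute_coord partials_commute_exp root_alg_mult root_alg_const root_alg_coord root_alg_exp assms)
  thus ?thesis unfolding w_def[abs_def]
    by (rule partials_commute_chain[OF root_alg_g[OF assms],
          where h' = "\<lambda>z. - (inverse z ^ Suc (Suc 0))" and h'' = "\<lambda>z. 2 * inverse z ^ 3"])
       (use g_nonzero[OF assms] in \<open>auto intro!: derivative_eq_intros simp: power3_eq_cube field_simps\<close>)
qed

lemma partials_commute_root_alg: "root_alg \<phi> \<Longrightarrow> partials_commute \<phi>"
proof (induction rule: root_alg.induct)
  case (root_alg_cong \<phi> \<theta>)
  show ?case
  proof (rule partials_commuteI)
    show "partial l \<theta> x = partial l \<phi> x" if "x \<in> U" for l x
      by (rule partial_cong[OF open_U that]) (simp add: root_alg_cong.hyps)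
    show "partial k (partial l \<phi>) x = partial l (partial k \<phi>) x" if "x \<in> U" for k l x
      using root_alg_cong that unfolding partials_commute_def by blast
  qed
qed (auto intro: partials_commute_const partials_commute_coord partials_commute_y partials_commute_exp
       partials_commute_w partials_commute_add partials_commute_mult)

lemma partial_commute: "root_alg \<phi> \<Longrightarrow> x \<in> U \<Longrightarrow> partial k (partial l \<phi>) x = partial l (partial k \<phi>) x"
  using partials_commute_root_alg unfolding partials_commute_def by blast

lemma partial_funpow_commute:
  "root_alg \<phi> \<Longrightarrow> x \<in> U \<Longrightarrow> partial k ((partial l ^^ n) \<phi>) x = (partial l ^^ n) (partial k \<phi>) x"
proof (induction n arbitrary: x)
  case (Suc n)
  have "partial k (partial l ((partial l ^^ n) \<phi>)) x = partial l (partial k ((partial l ^^ n) \<phi>)) x"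
    by (rule partial_commute[OF root_alg_partial_funpow[OF Suc.prems(1)] Suc.prems(2)])
  also have "\<dots> = partial l ((partial l ^^ n) (partial k \<phi>)) x"
    by (rule partial_cong[OF open_U Suc.prems(2) Suc.IH[OF Suc.prems(1)]])
  finally show ?case by simp
qed simp

end

section \<open>The contiguous family of solutions\<close>

text \<open>
  An antiderivative in \<open>z\<close> of \<open>exp (- s z) (b + c z)\<close>; in terms of \<open>t = exp z\<close> the integrand is
  \<open>t^(-s-1) (b + c log t) dt\<close>.
\<close>

definition antider :: "complex \<Rightarrow> complex \<Rightarrow> int \<Rightarrow> complex \<Rightarrow> complex" where
  "antider b c s z =
     (if s = 0 then b * z + c * z\<^sup>2 / 2
      else - exp (- of_int s * z) * (b + c * z) / of_int s - c * exp (- of_int s * z) / (of_int s)\<^sup>2)"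

lemma DERIV_antider:
  "(antider b c s has_field_derivative exp (- of_int s * z) * (b + c * z)) (at z)"
proof (cases "s = 0")
  case True
  thus ?thesis unfolding antider_def[abs_def] by (auto intro!: derivative_eq_intros)
next
  case False
  thus ?thesis unfolding antider_def[abs_def]
    by (auto intro!: derivative_eq_intros simp: field_simps power2_eq_square)
qed

text \<open>
  The integrand is recovered from the antiderivative by multiplication with \<open>- s\<close>, except for the terms that come from the
  logarithm in the integrand and from the logarithm in the antiderivative. These two exceptions are the error terms of the
  second Euler equation.
\<close>

lemma antider_weight:
  "of_int s * antider b c s z
     = - exp (- of_int s * z) * (b + c * z) + antider c 0 s z + (if s = 0 then b else 0)"
  by (simp add: antider_def field_simps power2_eq_square)

lemma antider_linear: "antider (r * b + r' * b') (r * c + r' * c') s z = r * antider b c s z + r' * antider b' c' s z"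
  by (simp add: antider_def field_simps power2_eq_square)

context log_roots
begin

definition base :: "(nat \<Rightarrow> complex) \<Rightarrow> complex \<Rightarrow> int \<Rightarrow> complex^'n \<Rightarrow> complex" where
  "base b c s x = (\<Sum>j=1..d. antider (b j) c s (y j x))"

text \<open>
  For \<open>n \<ge> 0\<close> the polynomials \<open>\<Phi>(n, i)\<close> are the coefficients of \<open>f^n / n!\<close>, so this is the termwise antiderivative of
  \<open>f^n / n! * t^(-s-1) (b\<^sub>j + c log t)\<close> at the roots. For \<open>n < 0\<close> differentiation by the one coordinate with label \<open>0\<close>
  leaves the second coordinate of the exponent unchanged.
\<close>

definition sol :: "(nat \<Rightarrow> complex) \<Rightarrow> complex \<Rightarrow> int \<times> int \<Rightarrow> complex^'n \<Rightarrow> complex" where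
  "sol b c \<alpha> =
     (if fst \<alpha> \<ge> 0 then \<lambda>x. \<Sum>i=0..int d * fst \<alpha>. \<Phi> a (fst \<alpha>, i) x * base b c (snd \<alpha> - i) x
      else (partial lo ^^ nat (- fst \<alpha>)) (base b c (snd \<alpha>)))"

lemma root_alg_antider:
  assumes "j \<in> {1..d}"
  shows "root_alg (\<lambda>x. antider b c s (y j x))"
proof (cases "s = 0")
  case True
  have "root_alg (\<lambda>x. b * y j x + (c / 2) * (y j x)\<^sup>2)"
    by (intro root_alg_add root_alg_mult root_alg_const root_alg_y root_alg_power assms)
  thus ?thesis by (simp add: antider_def True)
next
  case False
  have "root_alg (\<lambda>x. (- 1 / of_int s) * (exp (- of_int s * y j x) * (b + c * y j x))
      + (- c / (of_int s)\<^sup>2) * exp (- of_int s * y j x))"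
    by (intro root_alg_add root_alg_mult root_alg_const root_alg_y root_alg_exp assms)
  thus ?thesis by (rule root_alg_cong) (simp add: antider_def False)
qed

lemma root_alg_base: "root_alg (base b c s)"
  unfolding base_def[abs_def] by (intro root_alg_sum root_alg_antider) auto

lemma partial_antider:
  assumes "j \<in> {1..d}" "x \<in> U"
  shows "partial l (\<lambda>x. antider b c s (y j x)) x
     = - exp (of_int (int (a l) - s) * y j x) * (b + c * y j x) * w j x"
proof -
  have "partial l (\<lambda>x. antider b c s (y j x)) x = exp (- of_int s * y j x) * (b + c * y j x) * partial l (y j) x"
    by (rule partial_chain[OF open_U y_holo[OF assms(1)] assms(2) DERIV_antider])
  moreover have "exp (of_int (int (a l) - s) * y j x) = exp (- of_int s * y j x) * exp (of_nat (a l) * y j x)"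
    unfolding exp_add[symmetric] by (simp add: algebra_simps)
  ultimately show ?thesis by (simp add: partial_y[OF assms] algebra_simps)
qed

lemma partial_base:
  assumes "x \<in> U"
  shows "partial l (base b c s) x = - (\<Sum>j=1..d. exp (of_int (int (a l) - s) * y j x) * (b j + c * y j x) * w j x)"
proof -
  have "partial l (base b c s) x = (\<Sum>j=1..d. partial l (\<lambda>x. antider (b j) c s (y j x)) x)"
    unfolding base_def[abs_def]
    by (rule partial_sum[OF open_U _ root_alg_holo[OF root_alg_antider] assms]) auto
  also have "\<dots> = (\<Sum>j=1..d. - (exp (of_int (int (a l) - s) * y j x) * (b j + c * y j x) * w j x))"
    by (rule sum.cong) (simp_all add: partial_antider assms)
  finally show ?thesis by (simp add: sum_negf)
qed

text \<open>
  At level \<open>0\<close> the shift relation follows from \<open>D\<^sub>l y\<^sub>j = exp (a\<^sub>l y\<^sub>j) D\<^sub>0 y\<^sub>j\<close>: the extra exponential is absorbed by changing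
  the exponent of the integrand.
\<close>

lemma partial_base_shift: "x \<in> U \<Longrightarrow> partial l (base b c s) x = partial lo (base b c (s - int (a l))) x"
  by (simp add: partial_base a_lo algebra_simps)

lemma root_alg_divpow: "root_alg (divpow u)"
  unfolding divpow_def[abs_def] divide_inverse
  by (intro root_alg_prod finite root_alg_mult root_alg_power root_alg_coord root_alg_const)

lemma root_alg_\<Phi>: "root_alg (\<Phi> a \<beta>)"
  unfolding \<Phi>_divpow[abs_def] by (intro root_alg_sum finite_\<Phi>_index root_alg_divpow)

lemma root_alg_sol: "root_alg (sol b c \<alpha>)"
proof (cases "fst \<alpha> \<ge> 0")
  case True
  have "root_alg (\<lambda>x. \<Sum>i=0..int d * fst \<alpha>. \<Phi> a (fst \<alpha>, i) x * base b c (snd \<alpha> - i) x)"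
    by (intro root_alg_sum root_alg_mult root_alg_\<Phi> root_alg_base) auto
  thus ?thesis by (simp add: sol_def True)
next
  case False
  thus ?thesis by (simp add: sol_def root_alg_partial_funpow root_alg_base)
qed

lemma sol_neg: "sol b c (- int n, s) = (partial lo ^^ n) (base b c s) " if "n > 0"
  using that by (simp add: sol_def)

lemma sol_0: "sol b c (0, s) = base b c s"
  by (simp add: sol_def \<Phi>_0)

lemma sol_nonpos: "sol b c (- int n, s) = (partial lo ^^ n) (base b c s)"
  using sol_neg[of n] sol_0 by (cases "n = 0") auto

text \<open>
  This allows sums over the second coordinate to be taken over any sufficiently long interval.
\<close>

lemma \<Phi>_out:
  assumes "i \<notin> {0..int d * n}"
  shows "\<Phi> a (n, i) x = 0"
proof (rule ccontr)
  assume "\<Phi> a (n, i) x \<noteq> 0"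
  hence "(n, i) \<in> I_set a" by (rule \<Phi>_nonzero_index)
  thus False using I_set_range[of a d n i, OF a_le] assms by simp
qed

lemma \<Phi>_shift_sum:
  "(\<Sum>i=0..int d * n. \<Phi> a (n - 1, i - int (a l)) x * F i)
     = (\<Sum>i=0..int d * (n - 1). \<Phi> a (n - 1, i) x * F (i + int (a l)))"
proof -
  have "(\<Sum>i=0..int d * n. \<Phi> a (n - 1, i - int (a l)) x * F i)
      = (\<Sum>i\<in>(\<lambda>i. i + int (a l)) ` {0..int d * (n - 1)}. \<Phi> a (n - 1, i - int (a l)) x * F i)"
  proof (rule sum.mono_neutral_right, safe)
    fix i assume i: "i \<notin> (\<lambda>i. i + int (a l)) ` {0..int d * (n - 1)}"
    have "i - int (a l) \<notin> {0..int d * (n - 1)}"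
      using i image_eqI[of i "\<lambda>i. i + int (a l)" "i - int (a l)"] by fastforce
    hence "\<Phi> a (n - 1, i - int (a l)) x = 0" by (rule \<Phi>_out)
    thus "\<Phi> a (n - 1, i - int (a l)) x * F i = 0" by simp
  qed (use a_le[of l] in \<open>auto simp: algebra_simps\<close>)
  also have "\<dots> = (\<Sum>i=0..int d * (n - 1). \<Phi> a (n - 1, i) x * F (i + int (a l)))"
    by (subst sum.reindex) auto
  finally show ?thesis .
qed

text \<open>
  The sum is \<open>f(\<rho>\<^sub>j)^n / n!\<close>: by the first Euler equation for \<open>\<Phi>\<close>, \<open>n\<close> times the sum for \<open>n\<close> is \<open>f(\<rho>\<^sub>j)\<close> times the sum for
  \<open>n - 1\<close>.
\<close>

lemma \<Phi>_sum_root: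
  assumes "n \<ge> 1" "j \<in> {1..d}" "x \<in> U"
  shows "(\<Sum>i=0..int d * n. \<Phi> a (n, i) x * exp (of_int i * y j x)) = 0"
proof -
  let ?e = "\<lambda>i. exp (of_int i * y j x)"
  have "of_int n * (\<Sum>i=0..int d * n. \<Phi> a (n, i) x * ?e i)
      = (\<Sum>i=0..int d * n. (\<Sum>l\<in>UNIV. x $ l * \<Phi> a (n - 1, i - int (a l)) x) * ?e i)"
    unfolding sum_distrib_left using \<Phi>_euler1[of x a "(n, i)" for i] by (simp add: algebra_simps)
  also have "\<dots> = (\<Sum>l\<in>UNIV. \<Sum>i=0..int d * n. \<Phi> a (n - 1, i - int (a l)) x * (x $ l * ?e i))"
    unfolding sum_distrib_right by (subst sum.swap) (simp only: ac_simps)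
  also have "\<dots> = (\<Sum>l\<in>UNIV. x $ l * exp (of_nat (a l) * y j x) * (\<Sum>i=0..int d * (n - 1). \<Phi> a (n - 1, i) x * ?e i))"
    unfolding \<Phi>_shift_sum sum_distrib_left
    by (intro sum.cong refl) (simp add: exp_add algebra_simps)
  also have "\<dots> = (\<Sum>l\<in>UNIV. x $ l * exp (of_nat (a l) * y j x)) * (\<Sum>i=0..int d * (n - 1). \<Phi> a (n - 1, i) x * ?e i)"
    by (rule sum_distrib_right[symmetric])
  also have "\<dots> = 0" using y_root[OF assms(2,3)] by simp
  finally show ?thesis using assms(1) by simp
qed

text \<open>
  For \<open>n \<ge> 1\<close> the derivative hits either the coefficients \<open>\<Phi>\<close>, which gives the right-hand side, or the root, which
  gives a multiple of \<open>f(\<rho>\<^sub>j)^n = 0\<close>. For \<open>n \<le> 0\<close> the derivative is moved past the derivatives by \<open>x\<^sub>0\<close> and acts on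
  the function of level \<open>0\<close>.
\<close>

lemma partial_sol:
  assumes x: "x \<in> U"
  shows "partial l (sol b c (n, s)) x = sol b c (n - 1, s - int (a l)) x"
proof (cases "n \<ge> 1")
  case True
  let ?L = "\<lambda>i. (\<Sum>j=1..d. exp (of_int (int (a l) - (s - i)) * y j x) * (b j + c * y j x) * w j x)"
  have "sol b c (n, s) = (\<lambda>x. \<Sum>i=0..int d * n. \<Phi> a (n, i) x * base b c (s - i) x)"
    using True by (simp add: sol_def)
  hence "partial l (sol b c (n, s)) x = (\<Sum>i=0..int d * n. partial l (\<lambda>x. \<Phi> a (n, i) x * base b c (s - i) x) x)"
    by (simp only:) (rule partial_sum[OF open_U finite_atLeastAtMost_int _ x],
        intro root_alg_holo root_alg_mult root_alg_\<Phi> root_alg_base)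
  also have "\<dots> = (\<Sum>i=0..int d * n. \<Phi> a (n - 1, i - int (a l)) x * base b c (s - i) x - \<Phi> a (n, i) x * ?L i)"
  proof (rule sum.cong[OF refl])
    fix i
    have "partial l (\<lambda>x. \<Phi> a (n, i) x * base b c (s - i) x) x
        = \<Phi> a (n, i) x * partial l (base b c (s - i)) x + partial l (\<Phi> a (n, i)) x * base b c (s - i) x"
      by (rule partial_mult[OF open_U root_alg_holo[OF root_alg_\<Phi>] root_alg_holo[OF root_alg_base] x])
    thus "partial l (\<lambda>x. \<Phi> a (n, i) x * base b c (s - i) x) x
        = \<Phi> a (n - 1, i - int (a l)) x * base b c (s - i) x - \<Phi> a (n, i) x * ?L i"
      unfolding partial_base[OF x] partial_\<Phi>[OF open_U x root_alg_holo[OF root_alg_divpow]] by simp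
  qed
  also have "\<dots> = (\<Sum>i=0..int d * n. \<Phi> a (n - 1, i - int (a l)) x * base b c (s - i) x)
      - (\<Sum>i=0..int d * n. \<Phi> a (n, i) x * ?L i)"
    by (rule sum_subtractf)
  also have "(\<Sum>i=0..int d * n. \<Phi> a (n, i) x * ?L i)
      = (\<Sum>j=1..d. \<Sum>i=0..int d * n. \<Phi> a (n, i) x * (exp (of_int (int (a l) - (s - i)) * y j x) * (b j + c * y j x) * w j x))"
    unfolding sum_distrib_left by (rule sum.swap)
  also have "\<dots> = (\<Sum>j=1..d. (\<Sum>i=0..int d * n. \<Phi> a (n, i) x * exp (of_int i * y j x))
      * (exp (of_int (int (a l) - s) * y j x) * (b j + c * y j x) * w j x))"
    unfolding sum_distrib_right by (intro sum.cong refl) (simp add: algebra_simps flip: exp_add)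
  also have "\<dots> = 0"
    using \<Phi>_sum_root[OF True _ x] by (intro sum.neutral ballI) simp
  also have "(\<Sum>i=0..int d * n. \<Phi> a (n - 1, i - int (a l)) x * base b c (s - i) x)
      = (\<Sum>i=0..int d * (n - 1). \<Phi> a (n - 1, i) x * base b c (s - (i + int (a l))) x)"
    by (rule \<Phi>_shift_sum)
  also have "\<dots> = sol b c (n - 1, s - int (a l)) x"
    using True by (simp add: sol_def algebra_simps)
  finally show ?thesis by simp
next
  case False
  define N where "N = nat (- n)"
  have n: "n = - int N" using False by (simp add: N_def)
  have "partial l (sol b c (n, s)) x = partial l ((partial lo ^^ N) (base b c s)) x"
    by (simp only: n sol_nonpos)
  also have "\<dots> = (partial lo ^^ N) (partial l (base b c s)) x"
    by (rule partial_funpow_commute[OF root_alg_base x])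
  also have "\<dots> = (partial lo ^^ N) (partial lo (base b c (s - int (a l)))) x"
    by (rule partial_funpow_cong[OF open_U partial_base_shift x])
  also have "\<dots> = sol b c (- int (Suc N), s - int (a l)) x"
    by (simp only: sol_nonpos funpow_Suc_right o_apply)
  also have "- int (Suc N) = n - 1" by (simp add: n)
  finally show ?thesis .
qed

section \<open>Euler relations\<close>

text \<open>
  The Euler operators applied to \<open>y\<^sub>j\<close> give \<open>0\<close> and \<open>- 1\<close>: the roots are homogeneous of degree \<open>0\<close> and of weight \<open>- 1\<close>.
\<close>

lemma weighted_root_sums:
  assumes j: "j \<in> {1..d}" and x: "x \<in> U"
  shows "(\<Sum>l\<in>UNIV. x $ l * exp (of_int (int (a l) - s) * y j x)) = 0"
    and "(\<Sum>l\<in>UNIV. of_nat (a l) * x $ l * exp (of_int (int (a l) - s) * y j x)) * w j x = exp (- of_int s * y j x)"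
proof -
  have e: "exp (of_int (int (a l) - s) * y j x) = exp (of_nat (a l) * y j x) * exp (- of_int s * y j x)" for l
    unfolding exp_add[symmetric] by (simp add: algebra_simps)
  show "(\<Sum>l\<in>UNIV. x $ l * exp (of_int (int (a l) - s) * y j x)) = 0"
    unfolding e mult.assoc[symmetric] sum_distrib_right[symmetric] y_root[OF j x] by simp
  have "(\<Sum>l\<in>UNIV. of_nat (a l) * x $ l * exp (of_int (int (a l) - s) * y j x)) = g j x * exp (- of_int s * y j x)"
    unfolding e mult.assoc[symmetric] sum_distrib_right[symmetric] by (simp add: g_def)
  thus "(\<Sum>l\<in>UNIV. of_nat (a l) * x $ l * exp (of_int (int (a l) - s) * y j x)) * w j x = exp (- of_int s * y j x)"
    using g_w[OF j x] by (simp add: algebra_simps)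
qed

lemma sol_shift:
  assumes "n \<ge> 1"
  shows "sol b c (n - 1, s - int (a l)) x = (\<Sum>i=0..int d * n. \<Phi> a (n - 1, i - int (a l)) x * base b c (s - i) x)"
  unfolding \<Phi>_shift_sum using assms by (simp add: sol_def algebra_simps)

lemma sol_euler1_nonneg:
  assumes x: "x \<in> U" and "n \<ge> 0"
  shows "(\<Sum>l\<in>UNIV. x $ l * sol b c (n - 1, s - int (a l)) x) = of_int n * sol b c (n, s) x"
proof (cases "n = 0")
  case True
  have "(\<Sum>l\<in>UNIV. x $ l * sol b c (n - 1, s - int (a l)) x) = (\<Sum>l\<in>UNIV. x $ l * partial l (base b c s) x)"
    using partial_sol[OF x, of _ b c 0 s] by (simp add: True sol_0[abs_def])
  also have "\<dots> = - (\<Sum>l\<in>UNIV. \<Sum>j=1..d. x $ l * exp (of_int (int (a l) - s) * y j x) * ((b j + c * y j x) * w j x))"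
    unfolding partial_base[OF x] by (simp add: sum_negf sum_distrib_left mult.assoc)
  also have "\<dots> = - (\<Sum>j=1..d. (\<Sum>l\<in>UNIV. x $ l * exp (of_int (int (a l) - s) * y j x)) * ((b j + c * y j x) * w j x))"
    unfolding sum_distrib_right by (subst sum.swap) (rule refl)
  also have "\<dots> = 0"
    using weighted_root_sums(1)[OF _ x] by (simp add: sum.neutral)
  finally show ?thesis by (simp add: True)
next
  case False
  have "(\<Sum>l\<in>UNIV. x $ l * sol b c (n - 1, s - int (a l)) x)
      = (\<Sum>l\<in>UNIV. \<Sum>i=0..int d * n. x $ l * \<Phi> a (n - 1, i - int (a l)) x * base b c (s - i) x)"
    using sol_shift[of n b c s _ x] assms(2) False by (simp add: sum_distrib_left mult.assoc)
  also have "\<dots> = (\<Sum>i=0..int d * n. (\<Sum>l\<in>UNIV. x $ l * \<Phi> a (n - 1, i - int (a l)) x) * base b c (s - i) x)"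
    unfolding sum_distrib_right by (rule sum.swap)
  also have "\<dots> = of_int n * sol b c (n, s) x"
    unfolding sum_distrib_left using \<Phi>_euler1[of x a "(n, i)" for i] assms(2)
    by (simp add: sol_def sum_distrib_left mult.assoc)
  finally show ?thesis .
qed

lemma \<Phi>_euler2: "(\<Sum>l\<in>UNIV. of_nat (a l) * x $ l * \<Phi> a (n - 1, i - int (a l)) x) = of_int i * \<Phi> a (n, i) x"
proof -
  have "(\<Sum>l\<in>UNIV. of_nat (a l) * x $ l * \<Phi> a (n - 1, i - int (a l)) x)
      = (\<Sum>l\<in>UNIV. of_nat (a l) * (x $ l * \<Phi> a ((n, i) - (1, int (a l))) x))"
    by (simp add: mult.assoc)
  also have "\<dots> = (\<Sum>u | A_mult_nat a u = (n, i). (\<Sum>l\<in>UNIV. of_nat (a l) * of_nat (u l)) * divpow u x)"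
    unfolding \<Phi>_coord_mult sum_distrib_left sum_distrib_right mult.assoc by (rule sum.swap)
  also have "\<dots> = (\<Sum>u | A_mult_nat a u = (n, i). of_int i * divpow u x)"
    by (rule sum.cong) (auto simp: A_mult_def)
  finally show ?thesis unfolding \<Phi>_divpow[of a "(n, i)"] sum_distrib_left .
qed

lemma base_weight:
  "of_int s * base b c s x = - (\<Sum>j=1..d. exp (- of_int s * y j x) * (b j + c * y j x))
     + base (\<lambda>_. c) 0 s x + (if s = 0 then \<Sum>j=1..d. b j else 0)"
proof -
  have "(\<Sum>j=1..d. of_int s * antider (b j) c s (y j x))
     = (\<Sum>j=1..d. - (exp (- of_int s * y j x) * (b j + c * y j x)) + antider c 0 s (y j x) + (if s = 0 then b j else 0))"
    by (intro sum.cong refl) (simp only: antider_weight mult_minus_left)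
  also have "\<dots> = - (\<Sum>j=1..d. exp (- of_int s * y j x) * (b j + c * y j x))
     + (\<Sum>j=1..d. antider c 0 s (y j x)) + (\<Sum>j=1..d. if s = 0 then b j else 0)"
    by (simp only: sum.distrib sum_negf)
  finally show ?thesis unfolding base_def sum_distrib_left by simp
qed

lemma sol_euler2_nonneg:
  assumes x: "x \<in> U" and "n \<ge> 0"
  shows "(\<Sum>l\<in>UNIV. of_nat (a l) * x $ l * sol b c (n - 1, s - int (a l)) x)
     = of_int s * sol b c (n, s) x - sol (\<lambda>_. c) 0 (n, s) x - \<Phi> a (n, s) x * (\<Sum>j=1..d. b j)"
proof (cases "n = 0")
  case True
  have "(\<Sum>l\<in>UNIV. of_nat (a l) * x $ l * sol b c (n - 1, s - int (a l)) x)
      = (\<Sum>l\<in>UNIV. of_nat (a l) * x $ l * partial l (base b c s) x)"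
    using partial_sol[OF x, of _ b c 0 s] by (simp add: True sol_0[abs_def])
  also have "\<dots> = - (\<Sum>l\<in>UNIV. \<Sum>j=1..d. of_nat (a l) * x $ l * exp (of_int (int (a l) - s) * y j x) * w j x * (b j + c * y j x))"
    unfolding partial_base[OF x] by (simp add: sum_negf sum_distrib_left algebra_simps)
  also have "\<dots> = - (\<Sum>j=1..d. (\<Sum>l\<in>UNIV. of_nat (a l) * x $ l * exp (of_int (int (a l) - s) * y j x)) * w j x * (b j + c * y j x))"
    unfolding sum_distrib_right by (subst sum.swap) (rule refl)
  also have "\<dots> = - (\<Sum>j=1..d. exp (- of_int s * y j x) * (b j + c * y j x))"
    using weighted_root_sums(2)[OF _ x] by simp
  also have "\<dots> = of_int s * base b c s x - base (\<lambda>_. c) 0 s x - (if s = 0 then \<Sum>j=1..d. b j else 0)"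
    unfolding base_weight by simp
  finally show ?thesis by (simp add: True sol_0 \<Phi>_0)
next
  case False
  have "(\<Sum>l\<in>UNIV. of_nat (a l) * x $ l * sol b c (n - 1, s - int (a l)) x)
      = (\<Sum>l\<in>UNIV. \<Sum>i=0..int d * n. of_nat (a l) * x $ l * \<Phi> a (n - 1, i - int (a l)) x * base b c (s - i) x)"
    using sol_shift[of n b c s _ x] assms(2) False by (simp add: sum_distrib_left mult.assoc)
  also have "\<dots> = (\<Sum>i=0..int d * n. (\<Sum>l\<in>UNIV. of_nat (a l) * x $ l * \<Phi> a (n - 1, i - int (a l)) x) * base b c (s - i) x)"
    unfolding sum_distrib_right by (rule sum.swap)
  also have "\<dots> = (\<Sum>i=0..int d * n. \<Phi> a (n, i) x * (of_int s * base b c (s - i) x - of_int (s - i) * base b c (s - i) x))"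
    unfolding \<Phi>_euler2 by (intro sum.cong refl) (simp add: algebra_simps)
  also have "\<dots> = (\<Sum>i=0..int d * n. of_int s * (\<Phi> a (n, i) x * base b c (s - i) x) - \<Phi> a (n, i) x * base (\<lambda>_. c) 0 (s - i) x
        - (if i = s then \<Phi> a (n, i) x * (\<Sum>j=1..d. b j) else 0)
        + \<Phi> a (n, i) x * (\<Sum>j=1..d. exp (- of_int (s - i) * y j x) * (b j + c * y j x)))"
    unfolding base_weight by (intro sum.cong refl) (simp add: algebra_simps)
  also have "\<dots> = of_int s * sol b c (n, s) x - sol (\<lambda>_. c) 0 (n, s) x
        - (\<Sum>i=0..int d * n. if i = s then \<Phi> a (n, i) x * (\<Sum>j=1..d. b j) else 0)
        + (\<Sum>i=0..int d * n. \<Phi> a (n, i) x * (\<Sum>j=1..d. exp (- of_int (s - i) * y j x) * (b j + c * y j x)))"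
    using assms(2) by (simp add: sol_def sum.distrib sum_subtractf sum_distrib_left)
  also have "(\<Sum>i=0..int d * n. if i = s then \<Phi> a (n, i) x * (\<Sum>j=1..d. b j) else 0) = \<Phi> a (n, s) x * (\<Sum>j=1..d. b j)"
    using \<Phi>_out[of s n x] by (auto simp: sum.delta)
  also have "(\<Sum>i=0..int d * n. \<Phi> a (n, i) x * (\<Sum>j=1..d. exp (- of_int (s - i) * y j x) * (b j + c * y j x)))
      = (\<Sum>j=1..d. \<Sum>i=0..int d * n. \<Phi> a (n, i) x * (exp (- of_int (s - i) * y j x) * (b j + c * y j x)))"
    unfolding sum_distrib_left by (rule sum.swap)
  also have "\<dots> = (\<Sum>j=1..d. (\<Sum>i=0..int d * n. \<Phi> a (n, i) x * exp (of_int i * y j x))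
      * (exp (- of_int s * y j x) * (b j + c * y j x)))"
    unfolding sum_distrib_right by (intro sum.cong refl) (simp add: algebra_simps flip: exp_add)
  also have "\<dots> = 0"
    using \<Phi>_sum_root[OF _ _ x, of n] assms(2) False by (intro sum.neutral ballI) simp
  finally show ?thesis by simp
qed

text \<open>
  Both Euler equations pass from level \<open>n\<close> to level \<open>n - 1\<close> when they are differentiated by \<open>x\<^sub>0\<close>. The additional
  term from the explicit factor \<open>x\<^sub>0\<close> is what lowers the eigenvalue \<open>n\<close> in the first equation; in the second one it carries the
  label \<open>0\<close>.
\<close>

lemma partial_lo_euler_sum:
  assumes x: "x \<in> U"
  shows "partial lo (\<lambda>x. \<Sum>l\<in>UNIV. e l * x $ l * sol b c (n - 1, s - int (a l)) x) x
    = e lo * sol b c (n - 1, s) x + (\<Sum>l\<in>UNIV. e l * x $ l * sol b c (n - 1 - 1, s - int (a l)) x)"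
proof -
  have h: "mv_holomorphic_on (\<lambda>x. e l * x $ l * sol b c (n - 1, s - int (a l)) x) U" for l
    by (intro root_alg_holo root_alg_mult root_alg_const root_alg_coord root_alg_sol)
  have "partial lo (\<lambda>x. \<Sum>l\<in>UNIV. e l * x $ l * sol b c (n - 1, s - int (a l)) x) x
      = (\<Sum>l\<in>UNIV. partial lo (\<lambda>x. e l * x $ l * sol b c (n - 1, s - int (a l)) x) x)"
    by (rule partial_sum[OF open_U finite h x])
  also have "\<dots> = (\<Sum>l\<in>UNIV. e l * x $ l * sol b c (n - 1 - 1, s - int (a l)) x
       + (if l = lo then e l * sol b c (n - 1, s - int (a l)) x else 0))"
  proof (rule sum.cong[OF refl])
    fix l
    have "partial lo (\<lambda>x. e l * x $ l * sol b c (n - 1, s - int (a l)) x) x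
      = e l * x $ l * partial lo (sol b c (n - 1, s - int (a l))) x
        + partial lo (\<lambda>x. e l * x $ l) x * sol b c (n - 1, s - int (a l)) x"
      by (rule partial_mult[OF open_U _ _ x]) (intro root_alg_holo root_alg_mult root_alg_const root_alg_coord root_alg_sol)+
    moreover have "partial lo (\<lambda>x. e l * x $ l) x = e l * (if l = lo then 1 else 0)"
      by (simp add: partial_cmult[OF open_U mv_holomorphic_on_coord[OF open_U] x] partial_coord)
    ultimately show "partial lo (\<lambda>x. e l * x $ l * sol b c (n - 1, s - int (a l)) x) x =
        e l * x $ l * sol b c (n - 1 - 1, s - int (a l)) x
       + (if l = lo then e l * sol b c (n - 1, s - int (a l)) x else 0)"
      by (simp add: partial_sol[OF x] a_lo)
  qed
  finally show ?thesis by (simp add: sum.distrib a_lo)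
qed

lemma partial_sol_cmult: "x \<in> U \<Longrightarrow> partial l (\<lambda>x. r * sol b c (n, s) x) x = r * sol b c (n - 1, s - int (a l)) x"
  using partial_cmult[OF open_U root_alg_holo[OF root_alg_sol]] partial_sol by simp

lemma sol_euler1:
  assumes "x \<in> U"
  shows "(\<Sum>l\<in>UNIV. x $ l * sol b c (n - 1, s - int (a l)) x) = of_int n * sol b c (n, s) x"
proof (cases "n \<ge> 0")
  case True
  thus ?thesis using sol_euler1_nonneg assms by blast
next
  case False
  have "\<forall>x\<in>U. (\<Sum>l\<in>UNIV. 1 * x $ l * sol b c (- int N - 1, s - int (a l)) x) = of_int (- int N) * sol b c (- int N, s) x" for N
  proof (induction N)
    case 0
    show ?case using sol_euler1_nonneg[of _ 0] by simp
  next
    case (Suc N)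
    show ?case
    proof
      fix x assume x: "x \<in> U"
      let ?n = "- int N"
      have "partial lo (\<lambda>x. \<Sum>l\<in>UNIV. 1 * x $ l * sol b c (?n - 1, s - int (a l)) x) x
          = partial lo (\<lambda>x. of_int ?n * sol b c (?n, s) x) x"
        by (rule partial_cong[OF open_U x]) (use Suc.IH in blast)
      hence "1 * sol b c (?n - 1, s) x + (\<Sum>l\<in>UNIV. 1 * x $ l * sol b c (?n - 1 - 1, s - int (a l)) x)
          = of_int ?n * sol b c (?n - 1, s) x"
        unfolding partial_lo_euler_sum[OF x, where e = "\<lambda>_. 1"] partial_sol_cmult[OF x] by (simp add: a_lo)
      moreover have "- int (Suc N) = ?n - 1" by simp
      ultimately show "(\<Sum>l\<in>UNIV. 1 * x $ l * sol b c (- int (Suc N) - 1, s - int (a l)) x)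
          = of_int (- int (Suc N)) * sol b c (- int (Suc N), s) x"
        by (simp only:) (simp add: algebra_simps)
    qed
  qed
  from this[of "nat (- n)"] show ?thesis using assms False by simp
qed

lemma sol_euler2:
  assumes "x \<in> U"
  shows "(\<Sum>l\<in>UNIV. of_nat (a l) * x $ l * sol b c (n - 1, s - int (a l)) x)
     = of_int s * sol b c (n, s) x - sol (\<lambda>_. c) 0 (n, s) x - \<Phi> a (n, s) x * (\<Sum>j=1..d. b j)"
proof (cases "n \<ge> 0")
  case True
  thus ?thesis using sol_euler2_nonneg assms by blast
next
  case False
  \<comment> \<open>The term \<open>\<Phi>(n, s) \<Sum>b\<^sub>j\<close> at \<open>n = - N\<close>: a constant at level \<open>0\<close>, removed by the first differentiation.\<close>
  let ?C = "\<lambda>N. if N = 0 \<and> s = 0 then (\<Sum>j=1..d. b j) else (0::complex)"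
  have "\<forall>x\<in>U. (\<Sum>l\<in>UNIV. of_nat (a l) * x $ l * sol b c (- int N - 1, s - int (a l)) x)
      = of_int s * sol b c (- int N, s) x + ((- 1) * sol (\<lambda>_. c) 0 (- int N, s) x + (- ?C N))" for N
  proof (induction N)
    case 0
    show ?case using sol_euler2_nonneg[of _ 0 b c s] by (simp add: \<Phi>_0)
  next
    case (Suc N)
    show ?case
    proof
      fix x assume x: "x \<in> U"
      let ?n = "- int N"
      have "partial lo (\<lambda>x. \<Sum>l\<in>UNIV. of_nat (a l) * x $ l * sol b c (?n - 1, s - int (a l)) x) x
          = partial lo (\<lambda>x. of_int s * sol b c (?n, s) x + ((- 1) * sol (\<lambda>_. c) 0 (?n, s) x + (- ?C N))) x"
        by (rule partial_cong[OF open_U x]) (use Suc.IH in blast)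
      also have "\<dots> = partial lo (\<lambda>x. of_int s * sol b c (?n, s) x) x
          + partial lo (\<lambda>x. (- 1) * sol (\<lambda>_. c) 0 (?n, s) x + (- ?C N)) x"
        by (rule partial_add[OF open_U _ _ x]) (intro root_alg_holo root_alg_add root_alg_mult root_alg_const root_alg_sol)+
      also have "partial lo (\<lambda>x. (- 1) * sol (\<lambda>_. c) 0 (?n, s) x + (- ?C N)) x
          = partial lo (\<lambda>x. (- 1) * sol (\<lambda>_. c) 0 (?n, s) x) x + partial lo (\<lambda>x. - ?C N) x"
        by (rule partial_add[OF open_U _ _ x]) (intro root_alg_holo root_alg_mult root_alg_const root_alg_sol)+
      finally have "of_nat (a lo) * sol b c (?n - 1, s) x
            + (\<Sum>l\<in>UNIV. of_nat (a l) * x $ l * sol b c (?n - 1 - 1, s - int (a l)) x)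
          = of_int s * sol b c (?n - 1, s) x + ((- 1) * sol (\<lambda>_. c) 0 (?n - 1, s) x + 0)"
        unfolding partial_lo_euler_sum[OF x, where e = "\<lambda>l. of_nat (a l)"] partial_sol_cmult[OF x] partial_const
        by (simp only: a_lo of_nat_0 diff_zero)
      moreover have "- int (Suc N) = ?n - 1" by simp
      ultimately show "(\<Sum>l\<in>UNIV. of_nat (a l) * x $ l * sol b c (- int (Suc N) - 1, s - int (a l)) x)
        = of_int s * sol b c (- int (Suc N), s) x + ((- 1) * sol (\<lambda>_. c) 0 (- int (Suc N), s) x + (- ?C (Suc N)))"
        by (simp only: a_lo) simp
    qed
  qed
  note this[of "nat (- n)"]
  moreover have "\<Phi> a (n, s) x = 0" using False \<Phi>_out[of s n x]
    by (cases "d = 0") (use a_mid in \<open>auto simp: mult_less_0_iff zero_le_mult_iff\<close>)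
  ultimately show ?thesis using assms False by simp
qed

end

section \<open>Vanishing of the sum over all roots\<close>

lemma A_mult_plus: "A_mult_nat a (\<lambda>i. u i + v i) = A_mult_nat a u + A_mult_nat a v"
  by (simp add: A_mult_def sum.distrib algebra_simps)

text \<open>
  The union of \<open>I(A)\<close> and \<open>F\<^sub>e(A)\<close>, described without the requirement that the coordinate with label \<open>e\<close> vanishes: a
  multiple of that column cancels against the subtracted one. In this form the set is visibly stable under adding columns
  and under subtracting \<open>(1, e)\<close>.
\<close>

definition IF_set :: "('n::finite \<Rightarrow> nat) \<Rightarrow> nat \<Rightarrow> (int \<times> int) set" where
  "IF_set a e = {A_mult_nat a u - (int r, int r * int e) | u r. True}"

lemma IF_set_I: "\<beta> \<in> I_set a \<Longrightarrow> \<beta> \<in> IF_set a e" for a :: "'n::finite \<Rightarrow> nat"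
proof -
  assume "\<beta> \<in> I_set a"
  then obtain u where "\<beta> = A_mult_nat a u" unfolding I_set_def by blast
  hence "\<beta> = A_mult_nat a u - (int 0, int 0 * int e)" by (simp add: zero_prod_def[symmetric])
  thus ?thesis unfolding IF_set_def by blast
qed

lemma I_set_0: "(0, 0) \<in> I_set a" for a :: "'n::finite \<Rightarrow> nat"
  unfolding I_set_def by (rule range_eqI[where x = "\<lambda>_. 0"]) (simp add: A_mult_def)

lemma I_set_multiple: "(int k, int k * int (a l)) \<in> I_set a" for a :: "'n::finite \<Rightarrow> nat"
  unfolding I_set_def
proof (rule range_eqI[where x = "(\<lambda>_. 0)(l := k)"])
  show "(int k, int k * int (a l)) = A_mult_nat a ((\<lambda>_. 0)(l := k))"
    unfolding A_mult_upd by (simp add: A_mult_def)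
qed

lemma I_set_col: "(1, int (a l)) \<in> I_set a" for a :: "'n::finite \<Rightarrow> nat"
  using I_set_multiple[of 1 a l] by simp

lemma IF_set_add:
  fixes a :: "'n::finite \<Rightarrow> nat"
  assumes "\<gamma> \<in> I_set a" "\<beta> \<in> IF_set a e"
  shows "\<gamma> + \<beta> \<in> IF_set a e"
proof -
  obtain u where u: "\<gamma> = A_mult_nat a u" using assms(1) unfolding I_set_def by blast
  obtain v r where v: "\<beta> = A_mult_nat a v - (int r, int r * int e)" using assms(2) unfolding IF_set_def by blast
  have "\<gamma> + \<beta> = A_mult_nat a (\<lambda>i. u i + v i) - (int r, int r * int e)"
    unfolding u v A_mult_plus by (rule add_diff_eq)
  thus ?thesis unfolding IF_set_def by (intro CollectI exI[of _ "\<lambda>i. u i + v i"] exI[of _ r] conjI TrueI)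
qed

lemma IF_set_diff:
  fixes a :: "'n::finite \<Rightarrow> nat"
  assumes "\<beta> \<in> IF_set a e"
  shows "\<beta> - (int k, int k * int e) \<in> IF_set a e"
proof -
  obtain v r where v: "\<beta> = A_mult_nat a v - (int r, int r * int e)" using assms unfolding IF_set_def by blast
  have "\<beta> - (int k, int k * int e) = A_mult_nat a v - (int (r + k), int (r + k) * int e)"
    unfolding v by (simp add: diff_diff_eq algebra_simps)
  thus ?thesis unfolding IF_set_def by blast
qed

lemma IF_set_col: "(n, s) \<in> IF_set a e \<Longrightarrow> (n + 1, s + int (a l)) \<in> IF_set a e" for a :: "'n::finite \<Rightarrow> nat"
  using IF_set_add[OF I_set_col, of "(n, s)" a e l] by (simp add: add.commute)

lemma IF_set_sub: "(n, s) \<in> IF_set a e \<Longrightarrow> (n - 1, s - int e) \<in> IF_set a e" for a :: "'n::finite \<Rightarrow> nat"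
  using IF_set_diff[of "(n, s)" a e 1] by simp

lemma IF_set_move: "(n, s) \<in> IF_set a e \<Longrightarrow> (n, s + int (a l) - int e) \<in> IF_set a e" for a :: "'n::finite \<Rightarrow> nat"
  using IF_set_sub[OF IF_set_col, of n s a e l] by simp

lemma IF_set_subset:
  fixes a :: "'n::finite \<Rightarrow> nat"
  assumes "inj a" "a h = e"
  shows "IF_set a e \<subseteq> I_set a \<union> F_set a e"
proof
  fix \<beta> assume "\<beta> \<in> IF_set a e"
  then obtain u r where \<beta>: "\<beta> = A_mult_nat a u - (int r, int r * int e)" unfolding IF_set_def by blast
  have h: "the_inv a e = h" using the_inv_f_f[OF assms(1), of h] assms(2) by simp
  show "\<beta> \<in> I_set a \<union> F_set a e"
  proof (cases "r \<le> u h")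
    case True
    hence "\<beta> = A_mult_nat a (u(h := u h - r))"
      unfolding \<beta> A_mult_upd assms(2) by (simp add: of_nat_diff prod_eq_iff)
    thus ?thesis unfolding I_set_def by blast
  next
    case False
    hence "\<beta> = A_mult_nat a (u(h := 0)) - (int (r - u h), int (r - u h) * int e)"
      unfolding \<beta> A_mult_upd assms(2) by (simp add: of_nat_diff prod_eq_iff algebra_simps)
    moreover have "(u(h := 0)) (the_inv a e) = 0" by (simp add: h)
    ultimately show ?thesis unfolding F_set_def by blast
  qed
qed

context log_roots
begin

lemma w_eq: "j \<in> {1..d} \<Longrightarrow> x \<in> U \<Longrightarrow>
    exp (y j x) * w j x = 1 / (\<Prod>l\<in>{1..d} - {j}. exp (y j x) - exp (y l x)) / x $ hi"
  by (simp add: w_def g_eq_prod field_simps)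

text \<open>
  The sum of the residues of \<open>t^(e-1) / f(t)\<close>, a form without pole at \<open>0\<close> and at infinity.
\<close>

lemma root_sum_zero:
  assumes "x \<in> U" "1 \<le> e" "e < int d"
  shows "(\<Sum>j=1..d. exp (of_int e * y j x) * w j x) = 0"
proof -
  define k where "k = nat (e - 1)"
  have e: "e = 1 + int k" and k: "k + 2 \<le> d" using assms by (simp_all add: k_def)
  have "exp (of_int e * y j x) * w j x
      = poly (monom 1 k) (exp (y j x)) / (\<Prod>l\<in>{1..d} - {j}. exp (y j x) - exp (y l x)) / x $ hi"
    if "j \<in> {1..d}" for j
  proof -
    have "exp (of_int e * y j x) = exp (y j x) ^ k * exp (y j x)"
      by (simp add: e exp_of_nat_mult[symmetric] exp_add[symmetric] algebra_simps)
    thus ?thesis using w_eq[OF that assms(1)] by (simp add: poly_monom mult.assoc)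
  qed
  hence "(\<Sum>j=1..d. exp (of_int e * y j x) * w j x)
      = (\<Sum>j=1..d. poly (monom 1 k) (exp (y j x)) / (\<Prod>l\<in>{1..d} - {j}. exp (y j x) - exp (y l x))) / x $ hi"
    unfolding sum_divide_distrib by (intro sum.cong refl) blast
  also have "\<dots> = 0"
    by (subst lagrange_sum_zero[OF _ y_inj[OF assms(1)]]) (use k in \<open>auto simp: degree_monom_eq\<close>)
  finally show ?thesis .
qed

abbreviation "\<Psi> \<equiv> sol (\<lambda>_. 1) 0"

lemma sol_minus_one: "x \<in> U \<Longrightarrow> sol b c (- 1, s) x = - (\<Sum>j=1..d. exp (- of_int s * y j x) * (b j + c * y j x) * w j x)"
  using sol_nonpos[of b c 1 s] by (simp add: partial_base a_lo)

lemma partial_vanish: "(\<And>x. x \<in> U \<Longrightarrow> \<phi> x = 0) \<Longrightarrow> x \<in> U \<Longrightarrow> partial l \<phi> x = 0"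
  using partial_cong[OF open_U, of x \<phi> "\<lambda>_. 0" l] partial_const[of l 0 x] by simp

lemma sol_vanish_partial:
  "(\<And>x. x \<in> U \<Longrightarrow> sol b c (n, s) x = 0) \<Longrightarrow> x \<in> U \<Longrightarrow> sol b c (n - 1, s - int (a l)) x = 0"
  using partial_vanish[of "sol b c (n, s)" x l] partial_sol[of x l b c n s] by simp

text \<open>
  For \<open>n = 1\<close> this is the residue sum; larger \<open>n\<close> follow by differentiation.
\<close>

lemma \<Psi>_middle:
  assumes "n \<ge> 1" "- int d < s" "s < 0" "x \<in> U"
  shows "\<Psi> (- int n, s) x = 0"
  using assms(1,4)
proof (induction n arbitrary: x rule: dec_induct)
  case base
  thus ?case using root_sum_zero[of x "- s"] assms by (simp add: sol_minus_one)
next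
  case (step n)
  have e: "- int (Suc n) = - int n - 1" by simp
  show ?case
    using sol_vanish_partial[OF step.IH step.prems, of lo] unfolding e by (simp only: a_lo of_nat_0 diff_0_right)
qed

text \<open>
  At the left end of the previous interval the value for \<open>n = 1\<close> is \<open>1 / x\<^sub>d\<close> up to sign. For larger \<open>n\<close> the exponent is reached
  from the interior by differentiation with respect to a coordinate whose label is strictly between \<open>0\<close> and \<open>d\<close>.
\<close>

lemma \<Psi>_edge:
  assumes "n \<ge> 2" "x \<in> U"
  shows "\<Psi> (- int n, - int d) x = 0"
proof -
  have "\<Psi> (- int (n - 1), - int d + int (a mid)) z = 0" if "z \<in> U" for z
    using assms a_mid that by (intro \<Psi>_middle) auto
  from sol_vanish_partial[OF this assms(2), of mid] show ?thesis using assms(1) by (simp add: of_nat_diff)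
qed

text \<open>
  The first Euler equation at \<open>(1 - n, s)\<close> expresses \<open>x\<^sub>0 \<Psi>(-n, s)\<close> by \<open>\<Psi>(1-n, s)\<close> and by values with smaller second
  coordinate. All of these exponents lie outside \<open>IF_set a 0\<close> again or in the interval where \<open>\<Psi>\<close> vanishes anyway.
\<close>

lemma \<Psi>_pos:
  assumes "n \<ge> 1" "s > 0" "(- int n, s) \<notin> IF_set a 0" "x \<in> U"
  shows "\<Psi> (- int n, s) x = 0"
  using assms
proof (induction "n + nat s" arbitrary: n s rule: less_induct)
  case less
  have rhs: "of_int (1 - int n) * \<Psi> (1 - int n, s) x = 0"
  proof (cases "n = 1")
    case False
    have "\<Psi> (- int (n - 1), s) x = 0"
    proof (rule less.hyps)
      show "(- int (n - 1), s) \<notin> IF_set a 0"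
      proof
        assume "(- int (n - 1), s) \<in> IF_set a 0"
        from IF_set_sub[OF this] show False using less.prems by (simp add: of_nat_diff)
      qed
    qed (use False less.prems in auto)
    thus ?thesis using less.prems by (simp add: of_nat_diff)
  qed simp
  have "x $ l * \<Psi> (- int n, s - int (a l)) x = 0" if l: "l \<noteq> lo" for l
  proof -
    have al: "a l > 0" using l inj_a a_lo by (metis injD neq0_conv)
    consider "s - int (a l) > 0" | "s = int (a l)" | "s - int (a l) < 0" by linarith
    hence "\<Psi> (- int n, s - int (a l)) x = 0"
    proof cases
      case 1
      show ?thesis
      proof (rule less.hyps)
        show "(- int n, s - int (a l)) \<notin> IF_set a 0"
          using IF_set_move[of "- int n" "s - int (a l)" a 0 l] less.prems(3) by auto
      qed (use 1 al less.prems in auto)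
    next
      case 2
      have "(1, s) \<in> IF_set a 0" using IF_set_I[OF I_set_col] 2 by blast
      from IF_set_diff[OF this, of "n + 1"] have False using less.prems(3) by simp
      thus ?thesis ..
    next
      case 3
      thus ?thesis using a_le[of l] less.prems by (intro \<Psi>_middle) auto
    qed
    thus ?thesis by simp
  qed
  hence "(\<Sum>l\<in>UNIV - {lo}. x $ l * \<Psi> (- int n, s - int (a l)) x) = 0"
    by (intro sum.neutral ballI) blast
  hence "(\<Sum>l\<in>UNIV. x $ l * \<Psi> (- int n, s - int (a l)) x) = x $ lo * \<Psi> (- int n, s - int (a lo)) x"
    by (subst sum.remove[where x = lo]) auto
  moreover have "(\<Sum>l\<in>UNIV. x $ l * \<Psi> (- int n, s - int (a l)) x) = 0"
    using sol_euler1[OF less.prems(4), of "\<lambda>_. 1" 0 "1 - int n" s] rhs by simp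
  ultimately show ?case using lo_nz[OF less.prems(4)] by (simp add: a_lo)
qed

text \<open>
  The mirror image of the preceding lemma: now the first Euler equation at \<open>(1 - n, s + d)\<close> is solved for its term
  with \<open>x\<^sub>d\<close>.
\<close>

lemma \<Psi>_neg:
  assumes "n \<ge> 1" "s < 0" "(- int n, s) \<notin> IF_set a d" "x \<in> U"
  shows "\<Psi> (- int n, s) x = 0"
  using assms
proof (induction "n + nat (- s)" arbitrary: n s rule: less_induct)
  case less
  consider "- int d < s" | "s = - int d" "n = 1" | "s = - int d" "n \<ge> 2" | "s < - int d"
    using less.prems(1) by linarith
  thus ?case
  proof cases
    case 1
    thus ?thesis using less.prems by (intro \<Psi>_middle) auto
  next
    case 2
    have False using IF_set_sub[OF IF_set_I[OF I_set_0[of a], of d]] less.prems(3) 2 by simp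
    thus ?thesis ..
  next
    case 3
    thus ?thesis using \<Psi>_edge less.prems by simp
  next
    case 4
    have rhs: "of_int (1 - int n) * \<Psi> (1 - int n, s + int d) x = 0"
    proof (cases "n = 1")
      case False
      have "\<Psi> (- int (n - 1), s + int d) x = 0"
      proof (rule less.hyps)
        show "(- int (n - 1), s + int d) \<notin> IF_set a d"
        proof
          assume "(- int (n - 1), s + int d) \<in> IF_set a d"
          from IF_set_sub[OF this] show False using less.prems by (simp add: of_nat_diff)
        qed
      qed (use False less.prems 4 in auto)
      thus ?thesis using less.prems by (simp add: of_nat_diff)
    qed simp
    have "x $ l * \<Psi> (- int n, s + int d - int (a l)) x = 0" if l: "l \<noteq> hi" for l
    proof -
      have al: "a l < d" using l inj_a a_hi a_le[of l] by (metis injD le_neq_implies_less)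
      have "\<Psi> (- int n, s + int d - int (a l)) x = 0"
      proof (rule less.hyps)
        show "(- int n, s + int d - int (a l)) \<notin> IF_set a d"
          using IF_set_move[of "- int n" "s + int d - int (a l)" a d l] less.prems(3) by auto
      qed (use 4 al less.prems in auto)
      thus ?thesis by simp
    qed
    hence "(\<Sum>l\<in>UNIV - {hi}. x $ l * \<Psi> (- int n, s + int d - int (a l)) x) = 0"
      by (intro sum.neutral ballI) blast
    hence "(\<Sum>l\<in>UNIV. x $ l * \<Psi> (- int n, s + int d - int (a l)) x) = x $ hi * \<Psi> (- int n, s + int d - int (a hi)) x"
      by (subst sum.remove[where x = hi]) auto
    moreover have "(\<Sum>l\<in>UNIV. x $ l * \<Psi> (- int n, s + int d - int (a l)) x) = 0"
      using sol_euler1[OF less.prems(4), of "\<lambda>_. 1" 0 "1 - int n" "s + int d"] rhs by simp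
    ultimately show ?thesis using hi_nz[OF less.prems(4)] by (simp add: a_hi)
  qed
qed

lemma sol_zero_coeffs: "sol (\<lambda>_. 0) 0 \<alpha> x = 0" if "x \<in> U"
proof -
  have "antider 0 0 s z = 0" for s z by (simp add: antider_def)
  hence b: "base (\<lambda>_. 0) 0 s = (\<lambda>_. 0)" for s by (simp add: base_def[abs_def])
  have "(partial lo ^^ n) (\<lambda>_. 0) = (\<lambda>_. 0)" for n
    by (induction n) (simp_all add: partial_const[abs_def])
  thus ?thesis by (simp add: sol_def b)
qed

text \<open>
  The second Euler equation minus \<open>d\<close> times the first one. Here the term with label \<open>d\<close> has coefficient \<open>0\<close>, just as the
  term with label \<open>0\<close> has in the second equation itself; this is the symmetry \<open>t \<mapsto> 1/t\<close>.
\<close>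

lemma sol_euler_upper:
  assumes x: "x \<in> U"
  shows "(\<Sum>l\<in>UNIV. (of_nat (a l) - of_nat d) * x $ l * sol b c (n - 1, s - int (a l)) x)
     = (of_int s - of_nat d * of_int n) * sol b c (n, s) x - sol (\<lambda>_. c) 0 (n, s) x - \<Phi> a (n, s) x * (\<Sum>j=1..d. b j)"
proof -
  have "(\<Sum>l\<in>UNIV. (of_nat (a l) - of_nat d) * x $ l * sol b c (n - 1, s - int (a l)) x)
      = (\<Sum>l\<in>UNIV. of_nat (a l) * x $ l * sol b c (n - 1, s - int (a l)) x)
        - of_nat d * (\<Sum>l\<in>UNIV. x $ l * sol b c (n - 1, s - int (a l)) x)"
    by (simp add: sum_distrib_left sum_subtractf left_diff_distrib mult.assoc)
  thus ?thesis unfolding sol_euler1[OF x] sol_euler2[OF x] by (simp add: algebra_simps)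
qed

text \<open>
  Up to a factor \<open>\<Psi>(0, s)\<close> is the power sum of the roots with exponent \<open>- s\<close>. It is recovered from level \<open>- 1\<close> by an Euler
  equation: the second one for \<open>s > 0\<close>, its mirror image for \<open>s < 0\<close>, so that the term that is not under control drops out.
\<close>

lemma \<Psi>_0:
  assumes "s \<noteq> 0" "(0, s) \<notin> IF_set a 0" "(0, s) \<notin> IF_set a d" and x: "x \<in> U"
  shows "\<Psi> (0, s) x = 0"
proof (cases "s > 0")
  case True
  have "of_nat (a l) * x $ l * \<Psi> (0 - 1, s - int (a l)) x = 0" for l
  proof -
    consider "s - int (a l) > 0" | "s = int (a l)" | "s - int (a l) < 0" by linarith
    hence "\<Psi> (- int 1, s - int (a l)) x = 0"
    proof cases
      case 1
      have "(- int 1, s - int (a l)) \<notin> IF_set a 0"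
        using IF_set_col[of "- 1" "s - int (a l)" a 0 l] assms(2) by auto
      thus ?thesis using 1 x by (intro \<Psi>_pos) auto
    next
      case 2
      have "(1, s) \<in> IF_set a 0" using IF_set_I[OF I_set_col] 2 by blast
      from IF_set_sub[OF this] have False using assms(2) by simp
      thus ?thesis ..
    next
      case 3
      thus ?thesis using a_le[of l] x True by (intro \<Psi>_middle) auto
    qed
    thus ?thesis by simp
  qed
  hence "(\<Sum>l\<in>UNIV. of_nat (a l) * x $ l * \<Psi> (0 - 1, s - int (a l)) x) = 0"
    by (intro sum.neutral ballI)
  thus ?thesis using sol_euler2[OF x, of "\<lambda>_. 1" 0 0 s] assms(1) sol_zero_coeffs[OF x, of "(0, s)"] by (simp add: \<Phi>_0)
next
  case False
  have "(of_nat (a l) - of_nat d) * x $ l * \<Psi> (0 - 1, s - int (a l)) x = 0" for l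
  proof -
    have "(- int 1, s - int (a l)) \<notin> IF_set a d"
      using IF_set_col[of "- 1" "s - int (a l)" a d l] assms(3) by auto
    hence "\<Psi> (- int 1, s - int (a l)) x = 0"
      using False assms(1) x by (intro \<Psi>_neg) auto
    thus ?thesis by simp
  qed
  hence "(\<Sum>l\<in>UNIV. (of_nat (a l) - of_nat d) * x $ l * \<Psi> (0 - 1, s - int (a l)) x) = 0"
    by (intro sum.neutral ballI)
  thus ?thesis using sol_euler_upper[OF x, of "\<lambda>_. 1" 0 0 s] assms(1) sol_zero_coeffs[OF x, of "(0, s)"] by (simp add: \<Phi>_0)
qed

text \<open>
  If both factors were nonzero, \<open>(n, s)\<close> would be the sum of an exponent in \<open>I(A)\<close> and one in \<open>F\<^sub>0(A) \<union> F\<^sub>d(A)\<close>.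
\<close>

lemma \<Phi>_\<Psi>_zero:
  assumes "(n, s) \<notin> IF_set a 0" "(n, s) \<notin> IF_set a d" and x: "x \<in> U"
  shows "\<Phi> a (n, i) x * base (\<lambda>_. 1) 0 (s - i) x = 0"
proof (cases "\<Phi> a (n, i) x = 0")
  case False
  hence I: "(n, i) \<in> I_set a" by (rule \<Phi>_nonzero_index)
  have "s - i \<noteq> 0" using IF_set_I[OF I] assms(1) by auto
  moreover have "(0, s - i) \<notin> IF_set a 0" "(0, s - i) \<notin> IF_set a d"
    using IF_set_add[OF I, of "(0, s - i)"] assms(1,2) by auto
  ultimately show ?thesis using \<Psi>_0[of "s - i" x] x by (simp add: sol_0)
qed simp

text \<open>
  On \<open>J(A)\<close> the functions \<open>\<psi>\<^sub>1, \<dots>, \<psi>\<^sub>d\<close> add up to zero. For \<open>n < 0\<close> the exponent \<open>(n, 0)\<close> belongs to \<open>F\<^sub>0(A)\<close>, so the sign of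
  \<open>s\<close> decides which of the two vanishing lemmas applies.
\<close>

lemma \<Psi>_vanish:
  assumes "(n, s) \<notin> IF_set a 0" "(n, s) \<notin> IF_set a d" and x: "x \<in> U"
  shows "\<Psi> (n, s) x = 0"
proof (cases "n \<ge> 0")
  case True
  have "(\<Sum>i=0..int d * n. \<Phi> a (n, i) x * base (\<lambda>_. 1) 0 (s - i) x) = 0"
    by (intro sum.neutral ballI \<Phi>_\<Psi>_zero assms)
  thus ?thesis using True by (simp add: sol_def)
next
  case False
  define N where "N = nat (- n)"
  have n: "n = - int N" "N \<ge> 1" using False by (simp_all add: N_def)
  have "(- int N, 0) \<in> IF_set a 0" using IF_set_diff[OF IF_set_I[OF I_set_0[of a], of 0], of N] by simp
  hence "s \<noteq> 0" using assms(1) n by auto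
  hence "s > 0 \<or> s < 0" by linarith
  thus ?thesis using \<Psi>_pos[of N s x] \<Psi>_neg[of N s x] assms n by auto
qed

end

section \<open>Linear relations between solutions\<close>

lemma finite_bezout:
  fixes a :: "'b \<Rightarrow> nat"
  assumes "finite S"
  shows "\<exists>c. (\<Sum>i\<in>S. c i * int (a i)) = int (Gcd (a ` S))"
  using assms
proof (induction S rule: finite_induct)
  case (insert i S)
  then obtain c where c: "(\<Sum>i\<in>S. c i * int (a i)) = int (Gcd (a ` S))" by blast
  obtain u v where uv: "u * int (a i) + v * int (Gcd (a ` S)) = gcd (int (a i)) (int (Gcd (a ` S)))"
    using bezout_int by blast
  have "(\<Sum>l\<in>S. (if l = i then u else v * c l) * int (a l)) = (\<Sum>l\<in>S. v * (c l * int (a l)))"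
    using insert.hyps by (intro sum.cong refl) auto
  hence "(\<Sum>l\<in>insert i S. (if l = i then u else v * c l) * int (a l)) = u * int (a i) + v * int (Gcd (a ` S))"
    using insert.hyps by (simp add: c sum_distrib_left[symmetric])
  also have "\<dots> = int (Gcd (a ` insert i S))" by (simp add: uv)
  finally show ?case by (rule exI[where P = "\<lambda>c. (\<Sum>l\<in>insert i S. c l * int (a l)) = int (Gcd (a ` insert i S))"])
qed simp

lemma I_set_add: "\<beta> \<in> I_set a \<Longrightarrow> \<gamma> \<in> I_set a \<Longrightarrow> \<beta> + \<gamma> \<in> I_set a" for a :: "'n::finite \<Rightarrow> nat"
proof -
  assume "\<beta> \<in> I_set a" "\<gamma> \<in> I_set a"
  then obtain u v where "\<beta> = A_mult_nat a u" "\<gamma> = A_mult_nat a v" unfolding I_set_def by blast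
  hence "\<beta> + \<gamma> = A_mult_nat a (\<lambda>i. u i + v i)" by (simp only: A_mult_plus)
  thus ?thesis unfolding I_set_def by (rule range_eqI[where x = "\<lambda>i. u i + v i"])
qed

text \<open>
  The projective version of the conductor of a numerical semigroup: far from both ends of \<open>[0, d N]\<close> every integer is a sum
  of exactly \<open>N\<close> labels. A Bezout combination of the labels, with coefficients reduced modulo \<open>d\<close>, reaches the residue class of
  \<open>e\<close> using a bounded number of summands; summands \<open>d\<close> then correct the value and summands \<open>0\<close> the number.
\<close>

lemma I_set_conductor:
  fixes a :: "'n::finite \<Rightarrow> nat"
  assumes gcd: "Gcd (range a) = 1" and a_le: "\<And>i. a i \<le> d" and lo: "a lo = 0" and hi: "a hi = d" and d: "d > 0"
  shows "\<exists>M\<ge>0. \<forall>N e. M \<le> e \<and> e \<le> int d * N - M \<longrightarrow> (N, e) \<in> I_set a"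
proof -
  obtain c where c: "(\<Sum>i\<in>UNIV. c i * int (a i)) = 1"
    using finite_bezout[of "UNIV :: 'n set" a] gcd by auto
  \<comment> \<open>A bound for the number of summands of a combination with coefficients below \<open>d\<close>.\<close>
  define K where "K = int CARD('n) * int d"
  have "(N, e) \<in> I_set a" if e: "int d * K \<le> e" "e \<le> int d * N - int d * K" for N e
  proof -
    define u where "u i = nat ((e * c i) mod int d)" for i
    define W where "W = (\<Sum>i\<in>UNIV. int (u i))"
    define V where "V = (\<Sum>i\<in>UNIV. int (a i) * int (u i))"
    have ui: "int (u i) = (e * c i) mod int d" for i using d by (simp add: u_def)
    have "W \<le> (\<Sum>i\<in>(UNIV :: 'n set). int d)"
      unfolding W_def ui by (rule sum_mono) (use d in \<open>simp add: less_imp_le\<close>)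
    hence WK: "W \<le> K" by (simp add: K_def)
    have "V \<le> int d * W" unfolding V_def W_def sum_distrib_left
      by (intro sum_mono mult_right_mono) (use a_le in auto)
    also have "\<dots> \<le> int d * K" using WK by (simp add: mult_left_mono)
    finally have VK: "V \<le> int d * K" .
    have V0: "0 \<le> V" unfolding V_def by (intro sum_nonneg) simp
    have "V mod int d = (\<Sum>i\<in>UNIV. int (a i) * (e * c i)) mod int d"
      unfolding V_def ui by (subst (1 2) mod_sum_eq[symmetric]) (simp add: mod_mult_right_eq)
    also have "(\<Sum>i\<in>UNIV. int (a i) * (e * c i)) = e * (\<Sum>i\<in>UNIV. c i * int (a i))"
      unfolding sum_distrib_left by (intro sum.cong refl) simp
    finally have "int d dvd e - V" using c by (simp add: mod_eq_dvd_iff[symmetric])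
    then obtain q where q: "e - V = int d * q" by (elim dvdE)
    have "int d * q \<ge> 0" using q e(1) VK by linarith
    hence q0: "q \<ge> 0" using d by (simp add: zero_le_mult_iff)
    have "int d * q \<le> int d * (N - K)" using q e(2) V0 by (simp add: right_diff_distrib)
    hence "q \<le> N - K" using d by simp
    hence qW: "q + W \<le> N" using WK by linarith
    have "(W, V) \<in> I_set a" unfolding I_set_def W_def V_def A_mult_def by (rule range_eqI) (rule refl)
    moreover have "(q, q * int d) \<in> I_set a" using I_set_multiple[of "nat q" a hi] q0 hi by simp
    moreover have "(N - W - q, 0) \<in> I_set a" using I_set_multiple[of "nat (N - W - q)" a lo] qW lo by simp
    ultimately have "(W, V) + (q, q * int d) + (N - W - q, 0) \<in> I_set a" by (intro I_set_add)
    moreover have "(W, V) + (q, q * int d) + (N - W - q, 0) = (N, e)" using q by (simp add: algebra_simps)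
    ultimately show ?thesis by (simp only:)
  qed
  moreover have "int d * K \<ge> 0" by (simp add: K_def)
  ultimately show ?thesis by blast
qed

context log_roots
begin

lemma partial_funpow_linear:
  assumes "root_alg \<phi>" "root_alg \<theta>" "x \<in> U"
  shows "(partial l ^^ n) (\<lambda>x. r * \<phi> x + r' * \<theta> x) x = r * (partial l ^^ n) \<phi> x + r' * (partial l ^^ n) \<theta> x"
  using assms(3)
proof (induction n arbitrary: x)
  case (Suc n)
  have "partial l ((partial l ^^ n) (\<lambda>x. r * \<phi> x + r' * \<theta> x)) x
      = partial l (\<lambda>x. r * (partial l ^^ n) \<phi> x + r' * (partial l ^^ n) \<theta> x) x"
    by (rule partial_cong[OF open_U Suc.prems Suc.IH])
  also have "\<dots> = partial l (\<lambda>x. r * (partial l ^^ n) \<phi> x) x + partial l (\<lambda>x. r' * (partial l ^^ n) \<theta> x) x"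
    by (intro partial_add[OF open_U _ _ Suc.prems] root_alg_holo root_alg_cmult root_alg_partial_funpow assms)
  finally show ?case
    by (simp add: partial_cmult[OF open_U root_alg_holo[OF root_alg_partial_funpow] Suc.prems] assms)
qed simp

lemma base_linear:
  "base (\<lambda>j. r * b j + r' * b' j) (r * c + r' * c') s = (\<lambda>x. r * base b c s x + r' * base b' c' s x)"
  by (rule ext) (simp add: base_def antider_linear sum.distrib sum_distrib_left)

lemma sol_linear:
  assumes "x \<in> U"
  shows "sol (\<lambda>j. r * b j + r' * b' j) (r * c + r' * c') \<alpha> x = r * sol b c \<alpha> x + r' * sol b' c' \<alpha> x"
proof (cases "fst \<alpha> \<ge> 0")
  case True
  thus ?thesis
    unfolding sol_def base_linear by (simp add: sum_distrib_left algebra_simps sum.distrib)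
next
  case False
  thus ?thesis
    unfolding sol_def base_linear by (simp add: partial_funpow_linear[OF root_alg_base root_alg_base assms])
qed

lemma sol_sum:
  assumes "x \<in> U" "finite S"
  shows "sol (\<lambda>j. \<Sum>i\<in>S. r i * B i j) (\<Sum>i\<in>S. r i * C i) \<alpha> x = (\<Sum>i\<in>S. r i * sol (B i) (C i) \<alpha> x)"
  using assms(2)
proof (induction S rule: finite_induct)
  case empty
  show ?case using sol_zero_coeffs[OF assms(1)] by simp
next
  case (insert k S)
  thus ?case
    using sol_linear[OF assms(1), of "r k" "B k" 1 "\<lambda>j. \<Sum>i\<in>S. r i * B i j" "C k" "\<Sum>i\<in>S. r i * C i" \<alpha>] by simp
qed

lemma sol_const_coeffs: "x \<in> U \<Longrightarrow> sol (\<lambda>_. c) 0 \<alpha> x = c * \<Psi> \<alpha> x"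
  using sol_linear[of x c "\<lambda>_. 1" 0 "\<lambda>_. 0" 0 0 \<alpha>] by simp

text \<open>
  Points of \<open>IF_set a d\<close> satisfy \<open>s \<le> d n\<close>, which excludes \<open>(-n, -e)\<close> when \<open>e < d n\<close>.
\<close>

lemma \<Psi>_range:
  assumes "n \<ge> 1" "1 \<le> e" "e < int d * int n" "x \<in> U"
  shows "\<Psi> (- int n, - e) x = 0"
proof (rule \<Psi>_neg)
  show "(- int n, - e) \<notin> IF_set a d"
  proof
    assume "(- int n, - e) \<in> IF_set a d"
    then obtain u r where ur: "- int n = fst (A_mult_nat a u) - int r" "- e = snd (A_mult_nat a u) - int r * int d"
      unfolding IF_set_def by (auto simp: prod_eq_iff)
    define N E where "N = fst (A_mult_nat a u)" and "E = snd (A_mult_nat a u)"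
    have "E \<le> int d * N"
      using I_set_range(3)[of a d N E, OF a_le] by (simp add: I_set_def N_def E_def)
    moreover have "int n = int r - N" using ur(1) by (simp add: N_def)
    hence "int d * int n = int r * int d - int d * N" by (simp only: right_diff_distrib mult.commute)
    moreover have "e = int r * int d - E" using ur(2) by (simp add: E_def)
    ultimately show False using assms(3) by linarith
  qed
qed (use assms in auto)

lemma sol_vanish_A:
  assumes "\<And>x. x \<in> U \<Longrightarrow> sol b c \<alpha> x = 0" "x \<in> U"
  shows "sol b c (\<alpha> - A_mult_nat a u) x = 0"
  using assms(2)
proof (induction "\<Sum>i\<in>UNIV. u i" arbitrary: u x)
  case 0
  hence "u = (\<lambda>_. 0)" by (auto simp: fun_eq_iff)
  hence "\<alpha> - A_mult_nat a u = \<alpha>" by (simp add: A_mult_def zero_prod_def[symmetric])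
  thus ?case using assms(1) 0 by simp
next
  case (Suc k)
  have "\<exists>l. u l \<noteq> 0" by (rule ccontr) (use Suc.hyps(2) in simp)
  then obtain l where l: "u l \<noteq> 0" by blast
  define v where "v = u(l := u l - 1)"
  have u: "u = v(l := Suc (v l))" using l by (auto simp: v_def)
  have "(\<Sum>i\<in>UNIV. u i) = Suc (\<Sum>i\<in>UNIV. v i)"
    unfolding sum.remove[OF finite UNIV_I[of l], of u] sum.remove[OF finite UNIV_I[of l], of v]
    using l by (simp add: v_def)
  hence "k = (\<Sum>i\<in>UNIV. v i)" using Suc.hyps(2) by simp
  note IH = Suc.hyps(1)[OF this]
  have "sol b c (fst (\<alpha> - A_mult_nat a v) - 1, snd (\<alpha> - A_mult_nat a v) - int (a l)) x = 0"
    by (rule sol_vanish_partial[OF _ Suc.prems]) (simp only: prod.collapse IH)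
  moreover have "(fst (\<alpha> - A_mult_nat a v) - 1, snd (\<alpha> - A_mult_nat a v) - int (a l)) = \<alpha> - A_mult_nat a u"
    unfolding u A_mult_Suc by (simp add: prod_eq_iff)
  ultimately show ?case by (simp only:)
qed

text \<open>
  In the second Euler equation at \<open>(-n, -e)\<close> the term with label \<open>0\<close> is absent, and all others have the form
  \<open>sol b c (-(n+1), -e')\<close> with \<open>e < e' \<le> e + d\<close>. So vanishing for all \<open>n\<close> down to a bound on \<open>e\<close> implies
  vanishing one step below the bound.
\<close>

lemma sol_vanish_lower:
  assumes M: "M \<ge> 1"
    and van: "\<And>n e x. n \<ge> 1 \<Longrightarrow> int M \<le> e \<Longrightarrow> e \<le> int d * int n - int M \<Longrightarrow> x \<in> U \<Longrightarrow> sol b c (- int n, - e) x = 0"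
    and n: "n \<ge> 1" "1 \<le> e" "e \<le> int d * int n - int M" "x \<in> U"
  shows "sol b c (- int n, - e) x = 0"
proof -
  define P where "P m \<longleftrightarrow> (\<forall>n e x. n \<ge> 1 \<longrightarrow> int m \<le> e \<longrightarrow> e \<le> int d * int n - int M \<longrightarrow> x \<in> U \<longrightarrow> sol b c (- int n, - e) x = 0)" for m
  have "P 1"
    using M
  proof (induction rule: inc_induct)
    case base
    show ?case using van unfolding P_def by blast
  next
    case (step m)
    have "sol b c (- int n, - e) x = 0"
      if n: "n \<ge> 1" "int m \<le> e" "e \<le> int d * int n - int M" "x \<in> U" for n e x
    proof (cases "e = int m")
      case True
      have "of_nat (a l) * x $ l * sol b c (- int n - 1, - e - int (a l)) x = 0" for l
      proof (cases "a l = 0")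
        case False
        have "sol b c (- int (Suc n), - (e + int (a l))) x = 0"
        proof (rule step.IH[unfolded P_def, rule_format])
          show "e + int (a l) \<le> int d * int (Suc n) - int M"
            using n(3) a_le[of l] by (simp add: algebra_simps)
        qed (use False True n in auto)
        moreover have "- int (Suc n) = - int n - 1" "- (e + int (a l)) = - e - int (a l)" by simp_all
        ultimately show ?thesis by (simp only:) simp
      qed simp
      hence "(\<Sum>l\<in>UNIV. of_nat (a l) * x $ l * sol b c (- int n - 1, - e - int (a l)) x) = 0"
        by (intro sum.neutral ballI)
      moreover have "sol (\<lambda>_. c) 0 (- int n, - e) x = 0"
        using \<Psi>_range[of n e x] n True step.hyps M by (simp add: sol_const_coeffs[OF n(4), of c])
      moreover have "\<Phi> a (- int n, - e) x = 0" using True step.hyps by (intro \<Phi>_out) auto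
      ultimately have "of_int e * sol b c (- int n, - e) x = 0"
        using sol_euler2[OF n(4), of b c "- int n" "- e"] by simp
      thus ?thesis using True step.hyps by simp
    next
      case False
      thus ?thesis using step.IH n unfolding P_def by auto
    qed
    thus ?case unfolding P_def by blast
  qed
  thus ?thesis using n unfolding P_def by simp
qed

text \<open>
  The same descent at the other end, measured by the distance of \<open>e\<close> from \<open>d n\<close>.
\<close>

lemma sol_vanish_upper:
  assumes M: "M \<ge> 1"
    and van: "\<And>n e x. n \<ge> 1 \<Longrightarrow> 1 \<le> e \<Longrightarrow> e \<le> int d * int n - int M \<Longrightarrow> x \<in> U \<Longrightarrow> sol b c (- int n, - e) x = 0"
    and n: "n \<ge> 1" "1 \<le> e" "e < int d * int n" "x \<in> U"
  shows "sol b c (- int n, - e) x = 0"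
proof -
  define P where "P m \<longleftrightarrow> (\<forall>n e x. n \<ge> 1 \<longrightarrow> 1 \<le> e \<longrightarrow> e \<le> int d * int n - int m \<longrightarrow> x \<in> U \<longrightarrow> sol b c (- int n, - e) x = 0)" for m
  have "P 1"
    using M
  proof (induction rule: inc_induct)
    case base
    show ?case using van unfolding P_def by blast
  next
    case (step m)
    have "sol b c (- int n, - e) x = 0"
      if n: "n \<ge> 1" "1 \<le> e" "e \<le> int d * int n - int m" "x \<in> U" for n e x
    proof (cases "e = int d * int n - int m")
      case True
      have "(of_nat (a l) - of_nat d) * x $ l * sol b c (- int n - 1, - e - int (a l)) x = 0" for l
      proof (cases "a l = d")
        case False
        have "sol b c (- int (Suc n), - (e + int (a l))) x = 0"
        proof (rule step.IH[unfolded P_def, rule_format])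
          have "a l < d" using False a_le[of l] by simp
          thus "e + int (a l) \<le> int d * int (Suc n) - int (Suc m)"
            using True by (simp add: algebra_simps)
        qed (use True n in auto)
        moreover have "- int (Suc n) = - int n - 1" "- (e + int (a l)) = - e - int (a l)" by simp_all
        ultimately show ?thesis by (simp only:) simp
      qed simp
      hence "(\<Sum>l\<in>UNIV. (of_nat (a l) - of_nat d) * x $ l * sol b c (- int n - 1, - e - int (a l)) x) = 0"
        by (intro sum.neutral ballI)
      moreover have "sol (\<lambda>_. c) 0 (- int n, - e) x = 0"
        using \<Psi>_range[of n e x] n True step.hyps M by (simp add: sol_const_coeffs[OF n(4), of c])
      moreover have "\<Phi> a (- int n, - e) x = 0" using n by (intro \<Phi>_out) auto
      ultimately have "(of_int (- e) - of_nat d * of_int (- int n)) * sol b c (- int n, - e) x = 0"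
        using sol_euler_upper[OF n(4), of b c "- int n" "- e"] by simp
      moreover have "(of_int (- e) - of_nat d * of_int (- int n) :: complex) = of_nat m"
        using True by simp
      ultimately have "of_nat m * sol b c (- int n, - e) x = 0" by (simp only:)
      thus ?thesis using step.hyps by simp
    next
      case False
      thus ?thesis using step.IH n unfolding P_def by auto
    qed
    thus ?case unfolding P_def by blast
  qed
  thus ?thesis using n unfolding P_def by simp
qed

text \<open>
  The relation is extended by differentiation and by the two descents until it contains all \<open>(-1, -e)\<close> with
  \<open>1 \<le> e \<le> d - 1\<close>, that is, the vanishing of \<open>d - 1\<close> moments of the numbers \<open>b\<^sub>j + c y\<^sub>j\<close>.
\<close>

lemma sol_zero_imp_coeffs_equal:
  assumes gcd: "Gcd (range a) = 1"
    and van: "\<And>x. x \<in> U \<Longrightarrow> sol b c \<alpha> x = 0"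
    and "p \<in> {1..d}" "q \<in> {1..d}" and x: "x \<in> U"
  shows "b p + c * y p x = b q + c * y q x"
proof -
  have d: "d > 0" using a_mid by simp
  obtain M0 where M0: "M0 \<ge> 0" "\<And>N e. M0 \<le> e \<Longrightarrow> e \<le> int d * N - M0 \<Longrightarrow> (N, e) \<in> I_set a"
    using I_set_conductor[OF gcd a_le a_lo a_hi d] by blast
  \<comment> \<open>\<open>(-n, -e) = \<alpha> - A u\<close> means \<open>A u = (fst \<alpha> + n, snd \<alpha> + e)\<close>; \<open>M\<close> is chosen so that the range
  \<open>M \<le> e \<le> d n - M\<close> translates into the range of the conductor bound.\<close>
  define M where "M = nat (max 1 (max (M0 - snd \<alpha>) (M0 + snd \<alpha> - int d * fst \<alpha>)))"
  have M: "M \<ge> 1" "int M \<ge> M0 - snd \<alpha>" "int M \<ge> M0 + snd \<alpha> - int d * fst \<alpha>" by (auto simp: M_def)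
  have 1: "sol b c (- int n, - e) x = 0"
    if "n \<ge> 1" "int M \<le> e" "e \<le> int d * int n - int M" "x \<in> U" for n e x
  proof -
    have "(fst \<alpha> + int n, snd \<alpha> + e) \<in> I_set a"
      by (rule M0(2)) (use that M in \<open>auto simp: algebra_simps\<close>)
    then obtain u where u: "(fst \<alpha> + int n, snd \<alpha> + e) = A_mult_nat a u" unfolding I_set_def by blast
    have "\<alpha> - A_mult_nat a u = (- int n, - e)" unfolding u[symmetric] by (simp add: prod_eq_iff)
    moreover have "sol b c (\<alpha> - A_mult_nat a u) x = 0" by (rule sol_vanish_A[OF _ that(4)]) (rule van)
    ultimately show ?thesis by (simp only:)
  qed
  have 2: "sol b c (- int n, - e) x = 0"
    if "n \<ge> 1" "1 \<le> e" "e \<le> int d * int n - int M" "x \<in> U" for n e x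
    by (rule sol_vanish_lower[OF M(1) 1 that])
  have 3: "sol b c (- int n, - e) x = 0"
    if "n \<ge> 1" "1 \<le> e" "e < int d * int n" "x \<in> U" for n e x
    by (rule sol_vanish_upper[OF M(1) 2 that])
  show ?thesis
  proof (rule moments_zero_imp_eq[OF _ y_inj[OF x] assms(3,4)])
    fix k assume k: "k + 2 \<le> card {1..d}"
    let ?P = "\<lambda>j. \<Prod>l\<in>{1..d} - {j}. exp (y j x) - exp (y l x)"
    have "sol b c (- int 1, - (1 + int k)) x = 0" by (rule 3) (use k x in auto)
    hence "(\<Sum>j=1..d. exp (of_int (1 + int k) * y j x) * (b j + c * y j x) * w j x) = 0"
      using sol_minus_one[OF x, of b c "- (1 + int k)"] by (simp add: algebra_simps)
    moreover have "exp (of_int (1 + int k) * y j x) * (b j + c * y j x) * w j x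
        = exp (y j x) ^ k * ((b j + c * y j x) / ?P j) / x $ hi" if "j \<in> {1..d}" for j
    proof -
      have "exp (of_int (1 + int k) * y j x) = exp (y j x) ^ k * exp (y j x)"
        by (simp add: exp_of_nat_mult[symmetric] exp_add[symmetric] algebra_simps)
      hence "exp (of_int (1 + int k) * y j x) * (b j + c * y j x) * w j x
          = exp (y j x) ^ k * (b j + c * y j x) * (exp (y j x) * w j x)" by (simp only: ac_simps)
      thus ?thesis unfolding w_eq[OF that x] by simp
    qed
    ultimately have "(\<Sum>j=1..d. exp (y j x) ^ k * ((b j + c * y j x) / ?P j) / x $ hi) = 0" by simp
    thus "(\<Sum>j\<in>{1..d}. exp (y j x) ^ k * ((b j + c * y j x) / ?P j)) = 0"
      unfolding sum_divide_distrib[symmetric] using hi_nz[OF x] by simp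
  qed simp
qed

text \<open>
  If two roots had a constant ratio, their logarithmic derivatives \<open>- exp (a\<^sub>l y) w\<close> would agree for all labels. Label
  \<open>0\<close> gives equal factors \<open>w\<close>, hence the \<open>a\<^sub>l\<close>-th power of the ratio is \<open>1\<close> for every \<open>l\<close>, and these exponents
  have greatest common divisor \<open>1\<close>.
\<close>

lemma y_diff_not_const:
  assumes gcd: "Gcd (range a) = 1" and "U \<noteq> {}" and p: "p \<in> {1..d}" and q: "q \<in> {1..d}"
    and const: "\<And>x. x \<in> U \<Longrightarrow> y p x = y q x + C"
  shows "p = q"
proof -
  obtain x where x: "x \<in> U" using assms(2) by blast
  have "partial l (y p) x = partial l (y q) x" for l
  proof -
    have "partial l (y p) x = partial l (\<lambda>x. y q x + C) x"
      by (rule partial_cong[OF open_U x const])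
    also have "\<dots> = partial l (y q) x + partial l (\<lambda>x. C) x"
      by (rule partial_add[OF open_U y_holo[OF q] mv_holomorphic_on_const[OF open_U] x])
    finally show ?thesis by (simp add: partial_const)
  qed
  hence e: "exp (of_nat (a l) * y p x) * w p x = exp (of_nat (a l) * y q x) * w q x" for l
    by (simp add: partial_y[OF p x] partial_y[OF q x])
  have "w p x = w q x" using e[of lo] by (simp add: a_lo)
  moreover have "w q x \<noteq> 0" using g_nonzero[OF q x] by (simp add: w_def)
  ultimately have e: "exp (of_nat (a l) * y p x) = exp (of_nat (a l) * y q x)" for l using e[of l] by simp
  obtain c where c: "(\<Sum>i\<in>UNIV. c i * int (a i)) = 1"
    using finite_bezout[of "UNIV :: 'n set" a] gcd by auto
  have E: "exp z = (\<Prod>i\<in>UNIV. exp (of_nat (a i) * z) powi c i)" for z :: complex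
  proof -
    have "z = of_int (\<Sum>i\<in>UNIV. c i * int (a i)) * z" by (simp add: c)
    also have "\<dots> = (\<Sum>i\<in>UNIV. of_int (c i) * (of_nat (a i) * z))"
      unfolding of_int_sum sum_distrib_right by (intro sum.cong refl) simp
    finally have "exp z = exp (\<Sum>i\<in>UNIV. of_int (c i) * (of_nat (a i) * z))" by (rule arg_cong)
    thus ?thesis by (simp add: exp_sum exp_power_int)
  qed
  have "exp (y p x) = exp (y q x)" unfolding E[of "y p x"] E[of "y q x"] e ..
  thus ?thesis using inj_onD[OF y_inj[OF x]] p q by blast
qed

lemma sol_zero_imp:
  assumes gcd: "Gcd (range a) = 1" and "U \<noteq> {}"
    and van: "\<And>x. x \<in> U \<Longrightarrow> sol b c \<alpha> x = 0"
    and p: "p \<in> {1..d}" and q: "q \<in> {1..d}"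
  shows "c = 0" "b p = b q"
proof -
  have eq: "b p + c * y p x = b q + c * y q x" if "p \<in> {1..d}" "q \<in> {1..d}" "x \<in> U" for p q x
    by (rule sol_zero_imp_coeffs_equal[OF gcd _ that]) (rule van)
  show c: "c = 0"
  proof (rule ccontr)
    assume c: "c \<noteq> 0"
    have d2: "1 \<in> {1..d}" "2 \<in> {1..d}" using a_mid by auto
    have "y 1 x = y 2 x + (b 2 - b 1) / c" if "x \<in> U" for x
      using eq[OF d2 that] c by (simp add: field_simps)
    from y_diff_not_const[OF gcd assms(2) d2 this] show False by simp
  qed
  obtain x where "x \<in> U" using assms(2) by blast
  thus "b p = b q" using eq[OF p q] c by simp
qed

end

section \<open>The functions \<open>\<psi>\<close> and \<open>\<chi>\<close>\<close>

text \<open>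
  \<open>\<chi>\<close> multiplies an antiderivative by the logarithm, whereas \<open>sol\<close> has the logarithm inside the integral. Integration
  by parts measures the difference.
\<close>

lemma antider_times:
  "s \<noteq> 0 \<Longrightarrow> antider 1 0 s z * z = antider 0 1 s z - antider 1 0 s z / of_int s"
  by (simp add: antider_def field_simps power2_eq_square)

lemma D_op_cong:
  assumes "open U" "\<And>x. x \<in> U \<Longrightarrow> \<phi> x = \<theta> x" "x \<in> U"
  shows "D_op a u \<phi> x = D_op a u \<theta> x"
proof -
  have "\<forall>x\<in>U. foldr (\<lambda>j. partial (the_inv a j) ^^ u (the_inv a j)) js \<phi> x
           = foldr (\<lambda>j. partial (the_inv a j) ^^ u (the_inv a j)) js \<theta> x" for js
  proof (induction js)
    case (Cons j js)
    show ?case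
      unfolding foldr_Cons o_apply
      by (rule ballI, rule partial_funpow_cong[OF assms(1)]) (use Cons.IH in blast)+
  qed (use assms(2) in simp)
  thus ?thesis unfolding D_op_def using assms(3) by blast
qed

context log_roots
begin

lemma sol_funpow: "x \<in> U \<Longrightarrow> (partial l ^^ k) (sol b c \<alpha>) x = sol b c (\<alpha> - (int k, int k * int (a l))) x"
proof (induction k arbitrary: x)
  case 0
  thus ?case by (simp add: zero_prod_def[symmetric])
next
  case (Suc k)
  have "partial l ((partial l ^^ k) (sol b c \<alpha>)) x = partial l (sol b c (fst \<alpha> - int k, snd \<alpha> - int k * int (a l))) x"
    by (rule partial_cong[OF open_U Suc.prems]) (simp add: Suc.IH minus_prod_def)
  also have "\<dots> = sol b c (fst \<alpha> - int k - 1, snd \<alpha> - int k * int (a l) - int (a l)) x"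
    by (rule partial_sol[OF Suc.prems])
  finally show ?case by (simp add: minus_prod_def algebra_simps)
qed

text \<open>
  The iterated form of \<open>partial_sol\<close>: the result depends only on \<open>A u\<close>.
\<close>

lemma D_op_sol:
  assumes "x \<in> U"
  shows "D_op a u (sol b c \<alpha>) x = sol b c (\<alpha> - A_mult_nat a u) x"
proof -
  let ?F = "\<lambda>j. (int (u (the_inv a j)), int (u (the_inv a j)) * int (a (the_inv a j)))"
  have fold: "\<forall>x\<in>U. foldr (\<lambda>j. partial (the_inv a j) ^^ u (the_inv a j)) js (sol b c \<alpha>) x
           = sol b c (\<alpha> - sum_list (map ?F js)) x" for js
  proof (induction js)
    case (Cons j js)
    show ?case
    proof
      fix x assume x: "x \<in> U"
      have "foldr (\<lambda>j. partial (the_inv a j) ^^ u (the_inv a j)) (j # js) (sol b c \<alpha>) x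
          = (partial (the_inv a j) ^^ u (the_inv a j)) (sol b c (\<alpha> - sum_list (map ?F js))) x"
        unfolding foldr_Cons o_apply by (rule partial_funpow_cong[OF open_U _ x]) (use Cons.IH in blast)
      also have "\<dots> = sol b c (\<alpha> - sum_list (map ?F js) - ?F j) x" by (rule sol_funpow[OF x])
      also have "\<alpha> - sum_list (map ?F js) - ?F j = \<alpha> - sum_list (map ?F (j # js))"
        by (simp only: list.map sum_list.Cons diff_diff_eq add.commute)
      finally show "foldr (\<lambda>j. partial (the_inv a j) ^^ u (the_inv a j)) (j # js) (sol b c \<alpha>) x
          = sol b c (\<alpha> - sum_list (map ?F (j # js))) x" .
    qed
  qed simp
  have "sum_list (map ?F (sorted_list_of_set (range a))) = (\<Sum>j\<in>range a. ?F j)"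
    by (subst sum_list_distinct_conv_sum_set) simp_all
  also have "\<dots> = (\<Sum>i\<in>UNIV. ?F (a i))"
    using inj_a by (subst sum.reindex) simp_all
  also have "\<dots> = A_mult_nat a u"
    using inj_a by (simp add: prod_eq_iff fst_sum snd_sum the_inv_f_f A_mult_def mult.commute)
  finally show ?thesis using fold[of "sorted_list_of_set (range a)"] assms unfolding D_op_def by simp
qed

lemma sol_hypergeometric:
  assumes eq: "\<And>x. x \<in> U \<Longrightarrow> F x = sol b c \<alpha> x"
    and z: "\<And>x. x \<in> U \<Longrightarrow> sol (\<lambda>_. c) 0 \<alpha> x = 0" "\<And>x. x \<in> U \<Longrightarrow> \<Phi> a \<alpha> x = 0"
  shows "F \<in> hypergeometric_solutions a (of_int (fst \<alpha>), of_int (snd \<alpha>)) U"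
proof -
  have D: "D_op a u F x = sol b c (\<alpha> - A_mult_nat a u) x" if "x \<in> U" for u x
  proof -
    have "D_op a u F x = D_op a u (sol b c \<alpha>) x"
      by (rule D_op_cong[OF open_U _ that]) (rule eq)
    thus ?thesis by (simp only: D_op_sol[OF that])
  qed
  have p: "partial l F x = sol b c (fst \<alpha> - 1, snd \<alpha> - int (a l)) x" if "x \<in> U" for l x
  proof -
    have "partial l F x = partial l (sol b c \<alpha>) x"
      by (rule partial_cong[OF open_U that]) (rule eq)
    thus ?thesis using partial_sol[OF that, of l b c "fst \<alpha>" "snd \<alpha>"] by simp
  qed
  have "mv_holomorphic_on F U"
    by (rule root_alg_holo, rule root_alg_cong[OF root_alg_sol[of b c \<alpha>]]) (simp add: eq)
  moreover have "D_op a (\<lambda>i. nat (v i)) F x = D_op a (\<lambda>i. nat (- v i)) F x"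
    if v: "A_mult a v = (0, 0)" and x: "x \<in> U" for v x
  proof -
    have "int (nat (v i)) - int (nat (- v i)) = v i" for i by simp
    hence "A_mult_nat a (\<lambda>i. nat (v i)) - A_mult_nat a (\<lambda>i. nat (- v i)) = A_mult a v"
      unfolding A_mult_def by (simp add: sum_subtractf[symmetric] right_diff_distrib[symmetric] del: int_nat_eq)
    hence "A_mult_nat a (\<lambda>i. nat (v i)) = A_mult_nat a (\<lambda>i. nat (- v i))"
      using v by (simp add: zero_prod_def[symmetric])
    thus ?thesis by (simp only: D[OF x])
  qed
  moreover have "(\<Sum>i\<in>UNIV. x $ i * partial i F x) = of_int (fst \<alpha>) * F x" if x: "x \<in> U" for x
    using sol_euler1[OF x, of b c "fst \<alpha>" "snd \<alpha>"] by (simp add: p[OF x] eq[OF x])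
  moreover have "(\<Sum>i\<in>UNIV. of_nat (a i) * x $ i * partial i F x) = of_int (snd \<alpha>) * F x" if x: "x \<in> U" for x
    using sol_euler2[OF x, of b c "fst \<alpha>" "snd \<alpha>"] z[OF x] by (simp add: p[OF x] eq[OF x])
  ultimately show ?thesis unfolding hypergeometric_solutions_def by simp
qed

definition unit_coeff :: "nat \<Rightarrow> nat \<Rightarrow> complex" where
  "unit_coeff j l = (if l = j then 1 else 0)"

lemma sol_unit_nonneg:
  assumes "j \<in> {1..d}" "n \<ge> 0"
  shows "sol (unit_coeff j) 0 (n, s) x = (\<Sum>i=0..int d * n. \<Phi> a (n, i) x * antider 1 0 (s - i) (y j x))"
proof -
  have "base (unit_coeff j) 0 t x = antider 1 0 t (y j x)" for t
  proof -
    have "base (unit_coeff j) 0 t x = (\<Sum>l=1..d. if l = j then antider 1 0 t (y j x) else 0)"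
      unfolding base_def by (intro sum.cong refl) (auto simp: unit_coeff_def antider_def)
    thus ?thesis using assms(1) by simp
  qed
  thus ?thesis using assms(2) by (simp add: sol_def)
qed

context
  fixes \<rho> :: "nat \<Rightarrow> complex^'n \<Rightarrow> complex"
  assumes \<rho>: "\<And>j x. j \<in> {1..d} \<Longrightarrow> x \<in> U \<Longrightarrow> \<rho> j x = exp (y j x)"
begin

lemma \<psi>_nonneg_eq_sol:
  assumes j: "j \<in> {1..d}" and x: "x \<in> U" and n: "n \<ge> 0"
  shows "\<psi>_nonneg a d \<rho> y j (n, s) x = sol (unit_coeff j) 0 (n, s) x"
proof -
  have a: "antider 1 0 (s - i) (y j x) = \<rho> j x powi (i - s) / of_int (i - s)" if "i \<noteq> s" for i
  proof -
    have "exp (- of_int (s - i) * y j x) = \<rho> j x powi (i - s)"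
      using exp_power_int[of "y j x" "i - s"] by (simp add: \<rho>[OF j x])
    thus ?thesis using that unfolding antider_def by (simp add: field_simps)
  qed
  have "sol (unit_coeff j) 0 (n, s) x
      = (\<Sum>i\<in>insert s {0..int d * n}. \<Phi> a (n, i) x * antider 1 0 (s - i) (y j x))"
    unfolding sol_unit_nonneg[OF j n]
    by (rule sum.mono_neutral_left) (auto simp: \<Phi>_out)
  also have "\<dots> = \<Phi> a (n, s) x * antider 1 0 0 (y j x)
      + (\<Sum>i\<in>{0..int d * n} - {s}. \<Phi> a (n, i) x * antider 1 0 (s - i) (y j x))"
    by (subst sum.insert_remove) simp_all
  also have "(\<Sum>i\<in>{0..int d * n} - {s}. \<Phi> a (n, i) x * antider 1 0 (s - i) (y j x))
      = (\<Sum>i\<in>{0..int d * n} - {s}. \<Phi> a (n, i) x * (\<rho> j x powi (i - s) / of_int (i - s)))"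
    by (intro sum.cong refl) (simp add: a)
  also have "antider 1 0 0 (y j x) = y j x" by (simp add: antider_def)
  finally show ?thesis by (simp add: \<psi>_nonneg_def)
qed

lemma \<psi>_eq_sol:
  assumes j: "j \<in> {1..d}" and x: "x \<in> U"
  shows "\<psi> a d \<rho> y j \<alpha> x = sol (unit_coeff j) 0 \<alpha> x"
proof (cases "fst \<alpha> \<ge> 0")
  case True
  thus ?thesis using \<psi>_nonneg_eq_sol[OF j x, of "fst \<alpha>" "snd \<alpha>"] by (simp add: \<psi>_def)
next
  case False
  define u where "u = \<psi>_shift a \<alpha>"
  define \<beta> where "\<beta> = \<alpha> + A_mult_nat a u"
  have "fst \<beta> \<ge> 0" using \<psi>_shift[of \<alpha> a] by (simp add: \<beta>_def u_def)
  hence "\<psi>_nonneg a d \<rho> y j \<beta> x = sol (unit_coeff j) 0 \<beta> x" if "x \<in> U" for x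
    using \<psi>_nonneg_eq_sol[OF j that, of "fst \<beta>" "snd \<beta>"] by simp
  hence "D_op a u (\<psi>_nonneg a d \<rho> y j \<beta>) x = D_op a u (sol (unit_coeff j) 0 \<beta>) x"
    by (rule D_op_cong[OF open_U _ x])
  also have "\<dots> = sol (unit_coeff j) 0 \<alpha> x"
    using D_op_sol[OF x] by (simp add: \<beta>_def)
  finally show ?thesis using False by (simp add: \<psi>_def \<beta>_def u_def)
qed

lemma \<chi>_nonneg_eq:
  assumes x: "x \<in> U" and n: "n \<ge> 0"
  shows "\<chi>_nonneg a d \<rho> y (n, s) x
     = (\<Sum>i=0..int d * n. \<Phi> a (n, i) x * (\<Sum>j=1..d. antider 1 0 (s - i) (y j x) * y j x))"
proof -
  have "\<chi>_nonneg a d \<rho> y (n, s) x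
      = (\<Sum>j=1..d. (\<Sum>i=0..int d * n. \<Phi> a (n, i) x * antider 1 0 (s - i) (y j x)) * y j x)"
    unfolding \<chi>_nonneg_def
    by (intro sum.cong refl) (simp add: \<psi>_eq_sol[OF _ x] sol_unit_nonneg n)
  also have "\<dots> = (\<Sum>i=0..int d * n. \<Sum>j=1..d. \<Phi> a (n, i) x * antider 1 0 (s - i) (y j x) * y j x)"
    unfolding sum_distrib_right by (rule sum.swap)
  finally show ?thesis by (simp only: sum_distrib_left mult.assoc)
qed

lemma sum_antider_times:
  "s \<noteq> 0 \<Longrightarrow> (\<Sum>j=1..d. antider 1 0 s (y j x) * y j x) = base (\<lambda>_. 0) 1 s x - base (\<lambda>_. 1) 0 s x / of_int s"
  unfolding base_def by (simp add: antider_times sum_subtractf sum_divide_distrib)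

text \<open>
  The corrections from integration by parts are multiples of \<open>\<Phi>(n, i) \<Psi>(0, s - i)\<close>. For \<open>i = s\<close> the two sides involve
  different multiples of the squared logarithm, but there the coefficient \<open>\<Phi>(n, s)\<close> is zero.
\<close>

lemma \<chi>_nonneg_eq_sol:
  assumes G: "(n, s) \<notin> IF_set a 0" "(n, s) \<notin> IF_set a d" and x: "x \<in> U" and n: "n \<ge> 0"
  shows "\<chi>_nonneg a d \<rho> y (n, s) x = sol (\<lambda>_. 0) 1 (n, s) x"
proof -
  have "\<Phi> a (n, i) x * (\<Sum>j=1..d. antider 1 0 (s - i) (y j x) * y j x) = \<Phi> a (n, i) x * base (\<lambda>_. 0) 1 (s - i) x" for i
  proof (cases "i = s")
    case True
    have "\<Phi> a (n, s) x = 0" using \<Phi>_nonzero_index[of a "(n, s)" x] IF_set_I[of "(n, s)" a 0] G(1) by blast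
    thus ?thesis using True by simp
  next
    case False
    have e: "(\<Sum>j=1..d. antider 1 0 (s - i) (y j x) * y j x)
        = base (\<lambda>_. 0) 1 (s - i) x - base (\<lambda>_. 1) 0 (s - i) x / of_int (s - i)"
      by (rule sum_antider_times) (use False in simp)
    show ?thesis unfolding e using \<Phi>_\<Psi>_zero[OF G x, of i] by (auto simp: right_diff_distrib)
  qed
  hence "\<chi>_nonneg a d \<rho> y (n, s) x = (\<Sum>i=0..int d * n. \<Phi> a (n, i) x * base (\<lambda>_. 0) 1 (s - i) x)"
    by (simp only: \<chi>_nonneg_eq[OF x n])
  thus ?thesis using n by (simp add: sol_def)
qed

text \<open>
  For \<open>n < 0\<close> the function that is differentiated is \<open>\<chi>(0, s)\<close>, and \<open>(0, s)\<close> need not be in \<open>J(A)\<close>. So the correction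
  \<open>\<Psi>(0, s) / s\<close> is kept, and it disappears only after the differentiation, as \<open>\<Psi>(n, s) = 0\<close>.
\<close>

lemma \<chi>_fun_eq_sol:
  assumes G: "(n, s) \<notin> IF_set a 0" "(n, s) \<notin> IF_set a d" and x: "x \<in> U"
  shows "\<chi>_fun a d k1 \<rho> y (n, s) x = sol (\<lambda>_. 0) 1 (n, s) x"
proof (cases "n \<ge> 0")
  case True
  thus ?thesis using \<chi>_nonneg_eq_sol[OF G x] by (simp add: \<chi>_fun_def)
next
  case False
  define N where "N = nat (- n)"
  have n: "n = - int N" "N \<ge> 1" using False by (simp_all add: N_def)
  have "(- int N, 0) \<in> IF_set a 0" using IF_set_diff[OF IF_set_I[OF I_set_0[of a], of 0], of N] by simp
  hence s: "s \<noteq> 0" using G(1) n by auto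
  have lo: "the_inv a 0 = lo" using the_inv_f_f[OF inj_a, of lo] by (simp add: a_lo)
  \<comment> \<open>\<open>\<chi>(0, s)\<close> belongs to the family with \<open>c = 1\<close> and this constant coefficient.\<close>
  let ?b = "\<lambda>_::nat. - 1 / of_int s :: complex"
  have c: "\<chi>_nonneg a d \<rho> y (0, s) z = base ?b 1 s z" if "z \<in> U" for z
  proof -
    have "\<chi>_nonneg a d \<rho> y (0, s) z = base (\<lambda>_. 0) 1 s z - base (\<lambda>_. 1) 0 s z / of_int s"
      using \<chi>_nonneg_eq[OF that, of 0 s] unfolding sum_antider_times[OF s, symmetric] by (simp add: \<Phi>_0)
    thus ?thesis using fun_cong[OF base_linear[of 1 "\<lambda>_. 0" "- 1 / of_int s" "\<lambda>_. 1" 1 0 s], of z] by simp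
  qed
  have "\<chi>_fun a d k1 \<rho> y (n, s) x = (partial lo ^^ N) (\<chi>_nonneg a d \<rho> y (0, s)) x"
    using False s by (simp add: \<chi>_fun_def lo N_def)
  also have "\<dots> = (partial lo ^^ N) (base ?b 1 s) x"
    by (rule partial_funpow_cong[OF open_U c x])
  also have "\<dots> = sol ?b 1 (n, s) x" by (simp only: n sol_nonpos)
  also have "\<dots> = sol (\<lambda>_. 0) 1 (n, s) x - \<Psi> (n, s) x / of_int s"
    using sol_linear[OF x, of 1 "\<lambda>_. 0" "- 1 / of_int s" "\<lambda>_. 1" 1 0 "(n, s)"] by simp
  also have "\<Psi> (n, s) x = 0" by (rule \<Psi>_vanish[OF G x])
  finally show ?thesis by simp
qed

lemma solutions_and_independence:
  assumes gcd: "Gcd (range a) = 1" and ne: "U \<noteq> {}" and G: "\<alpha> \<notin> IF_set a 0" "\<alpha> \<notin> IF_set a d"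
  shows "\<And>j. j \<in> {1..d} \<Longrightarrow> \<psi> a d \<rho> y j \<alpha> \<in> hypergeometric_solutions a (of_int (fst \<alpha>), of_int (snd \<alpha>)) U"
    and "\<chi>_fun a d k1 \<rho> y \<alpha> \<in> hypergeometric_solutions a (of_int (fst \<alpha>), of_int (snd \<alpha>)) U"
    and "lin_indep_on U {1..d} (\<lambda>j. if j < d then \<psi> a d \<rho> y j \<alpha> else \<chi>_fun a d k1 \<rho> y \<alpha>)"
proof -
  have \<Phi>0: "\<Phi> a \<alpha> x = 0" for x using \<Phi>_nonzero_index[of a \<alpha> x] IF_set_I[of \<alpha> a 0] G(1) by blast
  have \<psi>: "\<psi> a d \<rho> y j \<alpha> x = sol (unit_coeff j) 0 \<alpha> x" if "j \<in> {1..d}" "x \<in> U" for j x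
    by (rule \<psi>_eq_sol[OF that])
  have \<chi>: "\<chi>_fun a d k1 \<rho> y \<alpha> x = sol (\<lambda>_. 0) 1 \<alpha> x" if "x \<in> U" for x
    using \<chi>_fun_eq_sol[of "fst \<alpha>" "snd \<alpha>" x k1] G that by simp
  show "\<psi> a d \<rho> y j \<alpha> \<in> hypergeometric_solutions a (of_int (fst \<alpha>), of_int (snd \<alpha>)) U" if "j \<in> {1..d}" for j
  proof (rule sol_hypergeometric)
    show "\<psi> a d \<rho> y j \<alpha> x = sol (unit_coeff j) 0 \<alpha> x" if "x \<in> U" for x
      by (rule \<psi>[OF \<open>j \<in> {1..d}\<close> that])
  qed (rule sol_zero_coeffs, assumption, rule \<Phi>0)
  have \<Psi>: "\<Psi> \<alpha> x = 0" if "x \<in> U" for x using \<Psi>_vanish[of "fst \<alpha>" "snd \<alpha>" x] G that by simp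
  show "\<chi>_fun a d k1 \<rho> y \<alpha> \<in> hypergeometric_solutions a (of_int (fst \<alpha>), of_int (snd \<alpha>)) U"
    by (rule sol_hypergeometric, erule \<chi>, erule \<Psi>, rule \<Phi>0)
  show "lin_indep_on U {1..d} (\<lambda>j. if j < d then \<psi> a d \<rho> y j \<alpha> else \<chi>_fun a d k1 \<rho> y \<alpha>)"
    unfolding lin_indep_on_def
  proof (intro allI impI)
    fix c :: "nat \<Rightarrow> complex"
    assume rel: "\<forall>x\<in>U. (\<Sum>i\<in>{1..d}. c i * (if i < d then \<psi> a d \<rho> y i \<alpha> else \<chi>_fun a d k1 \<rho> y \<alpha>) x) = 0"
    \<comment> \<open>The family is \<open>sol (B i) (C i) \<alpha>\<close>; the last member contributes only to \<open>c\<close>.\<close>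
    define B where "B i = (if i < d then unit_coeff i else (\<lambda>_. 0))" for i
    define C where "C i = (if i < d then 0 else 1 :: complex)" for i
    define b where "b j = (\<Sum>i\<in>{1..d}. c i * B i j)" for j
    have d: "d \<ge> 1" using a_mid by simp
    have "sol b (\<Sum>i\<in>{1..d}. c i * C i) \<alpha> x = 0" if x: "x \<in> U" for x
    proof -
      have "sol b (\<Sum>i\<in>{1..d}. c i * C i) \<alpha> x = (\<Sum>i\<in>{1..d}. c i * sol (B i) (C i) \<alpha> x)"
        unfolding b_def[abs_def] by (rule sol_sum[OF x]) simp
      also have "\<dots> = (\<Sum>i\<in>{1..d}. c i * (if i < d then \<psi> a d \<rho> y i \<alpha> else \<chi>_fun a d k1 \<rho> y \<alpha>) x)"
        by (intro sum.cong refl) (simp add: B_def C_def \<psi>[OF _ x] \<chi>[OF x])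
      finally show ?thesis using rel x by simp
    qed
    note van = this
    have d_in: "d \<in> {1..d}" using d by simp
    have T1: "(\<Sum>i\<in>{1..d}. c i * C i) = 0"
      by (rule sol_zero_imp(1)[OF gcd ne _ d_in d_in]) (rule van)
    have T2: "b p = b d" if "p \<in> {1..d}" for p
      by (rule sol_zero_imp(2)[OF gcd ne _ that d_in]) (rule van)
    have "(\<Sum>i\<in>{1..d}. c i * C i) = (\<Sum>i\<in>{1..d}. if i = d then c i else 0)"
      by (intro sum.cong refl) (auto simp: C_def)
    hence cd: "c d = 0" using T1 d by simp
    have b: "b j = (if j < d then c j else 0)" if "j \<in> {1..d}" for j
    proof -
      have "b j = (\<Sum>i\<in>{1..d}. if i = j then (if j < d then c j else 0) else 0)"
        unfolding b_def by (intro sum.cong refl) (auto simp: B_def unit_coeff_def)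
      thus ?thesis using that by simp
    qed
    show "\<forall>i\<in>{1..d}. c i = 0"
    proof
      fix i assume i: "i \<in> {1..d}"
      show "c i = 0"
      proof (cases "i = d")
        case False
        thus ?thesis using T2[OF i] i unfolding b[OF i] b[OF d_in] by simp
      qed (use cd in simp)
    qed
  qed
qed

end

end

theorem theorem3p5:
  fixes m d :: nat and k :: "nat \<Rightarrow> nat" and a :: "'n::finite \<Rightarrow> nat"
    and U :: "(complex^'n) set"
    and \<rho> log\<rho> :: "nat \<Rightarrow> complex^'n \<Rightarrow> complex"
    and \<alpha> :: "int \<times> int"
  assumes "m \<ge> 1"
    and "0 < k 1" and "strict_mono_on {1..m} k" and "k m < d"
    and "Gcd (insert d (k ` {1..m})) = 1"
    and "bij_betw a UNIV (\<Lambda>_set m k d)"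
    and "open U" and "U \<noteq> {}" and "simply_connected U" and "U \<subseteq> - \<Sigma>_set a d"
    and "root_branches a d U \<rho>" and "log_branches d U \<rho> log\<rho>"
    and "\<alpha> \<in> J_set a d"
  shows "(\<forall>j\<in>{1..d-1}. \<psi> a d \<rho> log\<rho> j \<alpha>
            \<in> hypergeometric_solutions a (of_int (fst \<alpha>), of_int (snd \<alpha>)) U)
       \<and> \<chi>_fun a d (k 1) \<rho> log\<rho> \<alpha>
            \<in> hypergeometric_solutions a (of_int (fst \<alpha>), of_int (snd \<alpha>)) U
       \<and> lin_indep_on U {1..d} (\<lambda>j. if j < d then \<psi> a d \<rho> log\<rho> j \<alpha> else \<chi>_fun a d (k 1) \<rho> log\<rho> \<alpha>)"
proof -
  have inj: "inj a" and ran: "range a = \<Lambda>_set m k d" using assms(6) by (auto simp: bij_betw_def)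
  have kmono: "k i \<le> k m" if "i \<in> {1..m}" for i
    using strict_mono_on_leD[OF assms(3) that, of m] that by simp
  define lo mid hi where "lo = the_inv a 0" and "mid = the_inv a (k 1)" and "hi = the_inv a d"
  have inv: "a (the_inv a t) = t" if "t \<in> \<Lambda>_set m k d" for t
    using f_the_inv_into_f[OF inj] that ran by simp
  have al: "a lo = 0" "a mid = k 1" "a hi = d"
  proof -
    have "k 1 \<in> k ` {1..m}" using assms(1) by (intro imageI) simp
    thus "a lo = 0" "a mid = k 1" "a hi = d"
      unfolding lo_def mid_def hi_def by (intro inv; simp add: \<Lambda>_set_def)+
  qed
  have exp\<rho>: "exp (log\<rho> j x) = \<rho> j x" if "j \<in> {1..d}" "x \<in> U" for j x
    using assms(12) that by (simp add: log_branches_def)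
  have bij: "bij_betw (\<lambda>j. \<rho> j x) {1..d} {t. poly (generic_poly a x) t = 0}" if "x \<in> U" for x
    using assms(11) that by (simp add: root_branches_def)
  interpret log_roots a d U log\<rho> lo mid hi
  proof
    show "a i \<le> d" for i
    proof -
      have "a i \<in> \<Lambda>_set m k d" using ran by auto
      hence "a i = 0 \<or> (\<exists>j\<in>{1..m}. a i = k j) \<or> a i = d" by (auto simp: \<Lambda>_set_def)
      thus ?thesis
      proof (elim disjE bexE)
        fix j assume "j \<in> {1..m}" "a i = k j"
        thus ?thesis using kmono[of j] assms(4) by simp
      qed simp_all
    qed
    show "a mid < d" using kmono[of 1] assms(1,4) by (simp add: al)
    show "mv_holomorphic_on (log\<rho> j) U" if "j \<in> {1..d}" for j
      using assms(12) that by (simp add: log_branches_def)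
    show "(\<Sum>i\<in>UNIV. x $ i * exp (of_nat (a i) * log\<rho> j x)) = 0" if "j \<in> {1..d}" "x \<in> U" for j x
    proof -
      have "poly (generic_poly a x) (\<rho> j x) = 0"
        using bij_betwE[OF bij[OF that(2)]] that(1) by blast
      thus ?thesis by (simp add: poly_generic_poly exp_of_nat_mult exp\<rho>[OF that])
    qed
    show "inj_on (\<lambda>j. exp (log\<rho> j x)) {1..d}" if "x \<in> U" for x
    proof (rule inj_onI)
      fix i j assume ij: "i \<in> {1..d}" "j \<in> {1..d}" "exp (log\<rho> i x) = exp (log\<rho> j x)"
      hence "\<rho> i x = \<rho> j x" by (simp only: exp\<rho> that)
      thus "i = j" using inj_onD[OF bij_betw_imp_inj_on[OF bij[OF that]]] ij by blast
    qed
    show "x $ lo \<noteq> 0" "x $ hi \<noteq> 0" if "x \<in> U" for x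
      using assms(10) that by (auto simp: \<Sigma>_set_def lo_def hi_def)
    show "0 < a mid" using assms(2) by (simp only: al)
  qed (rule inj al assms(7))+
  have "range a = insert 0 (insert d (k ` {1..m}))" using ran by (auto simp: \<Lambda>_set_def)
  hence gcd: "Gcd (range a) = 1" using assms(5) by simp
  have "IF_set a 0 \<subseteq> I_set a \<union> F_set a 0" "IF_set a d \<subseteq> I_set a \<union> F_set a d"
    by (rule IF_set_subset[OF inj al(1)], rule IF_set_subset[OF inj al(3)])
  hence G: "\<alpha> \<notin> IF_set a 0" "\<alpha> \<notin> IF_set a d" using assms(13) by (auto simp: J_set_def)
  note res = solutions_and_independence[of \<rho>, OF exp\<rho>[symmetric] gcd assms(8) G]
  have "\<psi> a d \<rho> log\<rho> j \<alpha> \<in> hypergeometric_solutions a (of_int (fst \<alpha>), of_int (snd \<alpha>)) U" if "j \<in> {1..d-1}" for j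
    by (rule res(1)) (use that in auto)
  thus ?thesis using res(2,3) by blast
qed

end
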